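(* Let $q=\sigma'+\tau\in W^{-1}_{2,unif}(\mathbb{R})$ with real-valued $\sigma\in L_{2,unif}(\mathbb{R})$ and $\tau\in L_{1,unif}(\mathbb{R})$. Let $S$ be the operator in $L_2(\mathbb{R})$ acting by $$Su=l(u):=-(u'-\sigma u)'-\sigma u'+\tau u$$ on the domain $$\mathfrak{D}(S)=\{u\in L_2(\mathbb{R})\cap W^1_{1,loc}(\mathbb{R})\mid u^{[1]}:=u'-\sigma u\in W^1_{1,loc}(\mathbb{R}),\ l(u)\in L_2(\mathbb{R})\},$$ and let $T$ be the selfadjoint operator associated with the closed, bounded below quadratic form $$\mathfrak{t}(u)=(u',u')-(\sigma u',u)-(\sigma u,u')+(\tau u,u),\qquad \mathfrak{D}(\mathfrak{t})=W^1_2(\mathbb{R}).$$ Then the operator $S$ coincides with $T$. In particular, $S$ is selfadjoint, bounded below, and $\mathfrak{D}(S)\subset W^1_2(\mathbb{R})$.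
   Context: $(\cdot,\cdot)$ denotes the $L_2(\mathbb{R})$ inner product, and expressions such as $(\sigma u',u)$ and $(\tau u,u)$ denote the corresponding (absolutely convergent) integrals $\int_{\mathbb{R}}\sigma u'\overline{u}\,dt$, $\int_{\mathbb{R}}\tau|u|^2\,dt$. $L_{2,unif}(\mathbb{R})$ and $L_{1,unif}(\mathbb{R})$ are the spaces of measurable functions with $\sup_{t\in\mathbb{R}}\int_t^{t+1}|\sigma(s)|^2\,ds<\infty$ and $\sup_{t\in\mathbb{R}}\int_t^{t+1}|\tau(s)|\,ds<\infty$, respectively; derivatives are in the sense of distributions. The space $W^{-1}_{2,unif}(\mathbb{R})$ consists exactly of the distributions of the form $\sigma'+\tau$ with $\sigma\in L_{2,unif}(\mathbb{R})$, $\tau\in L_{1,unif}(\mathbb{R})$. $W^1_{1,loc}(\mathbb{R})$ is the space of locally absolutely continuous functions. The form $\mathfrak{t}$ is closed and bounded below on $W^1_2(\mathbb{R})$. The operator $T$ associated with $\mathfrak{t}$ is the selfadjoint operator for which $\mathfrak{D}(T)\subset\mathfrak{D}(\mathfrak{t})$ and $(Tu,v)=\mathfrak{t}(u,v)$ for all $u\in\mathfrak{D}(T)$ and all $v\in\mathfrak{D}(\mathfrak{t})$, where $\mathfrak{t}(u,v)=(u',v')-(\sigma u',v)-(\sigma u,v')+(\tau u,v)$ is the associated sesquilinear form. *)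

theory Defs
  imports "HOL-Analysis.Analysis"
begin

section \<open>The Hilbert space \<open>L\<^sub>2(\<real>)\<close>\<close>

definition square_integrable :: "(real \<Rightarrow> complex) \<Rightarrow> bool" where
  "square_integrable f \<longleftrightarrow>
     f \<in> borel_measurable lebesgue \<and> integrable lebesgue (\<lambda>x. (cmod (f x))\<^sup>2)"

text \<open>The pairing is also applied to functions that are not both square integrable, as in
  \<open>(\<sigma>u', v)\<close>; it is then simply the integral of \<open>f\<close> times the conjugate of \<open>g\<close>.\<close>

definition pairing :: "(real \<Rightarrow> complex) \<Rightarrow> (real \<Rightarrow> complex) \<Rightarrow> complex" where
  "pairing f g = (LINT x|lebesgue. f x * cnj (g x))"

definition l2_rel :: "(real \<Rightarrow> complex) \<Rightarrow> (real \<Rightarrow> complex) \<Rightarrow> bool" where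
  "l2_rel f g \<longleftrightarrow>
     square_integrable f \<and> square_integrable g \<and> (AE x in lebesgue. f x = g x)"

lemma square_integrable_mult:
  assumes "square_integrable f" "square_integrable g"
  shows "integrable lebesgue (\<lambda>x. f x * cnj (g x))"
proof (rule Bochner_Integration.integrable_bound)
  show "integrable lebesgue (\<lambda>x. (cmod (f x))\<^sup>2 + (cmod (g x))\<^sup>2)"
    using assms by (simp add: square_integrable_def)
  have [measurable]: "f \<in> borel_measurable lebesgue" "g \<in> borel_measurable lebesgue"
    using assms by (auto simp: square_integrable_def)
  have "(\<lambda>x. cnj (g x)) \<in> borel_measurable lebesgue"
    by (rule borel_measurable_continuous_on[of cnj]) (auto intro: continuous_intros)
  then show "(\<lambda>x. f x * cnj (g x)) \<in> borel_measurable lebesgue"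
    by measurable
  have "cmod (f x * cnj (g x)) \<le> (cmod (f x))\<^sup>2 + (cmod (g x))\<^sup>2" for x
  proof -
    have "2 * (cmod (f x) * cmod (g x)) \<le> (cmod (f x))\<^sup>2 + (cmod (g x))\<^sup>2"
      using sum_squares_bound[of "cmod (f x)" "cmod (g x)"] by (simp add: mult.assoc)
    moreover have "0 \<le> cmod (f x) * cmod (g x)"
      by simp
    ultimately show ?thesis
      unfolding norm_mult complex_mod_cnj by linarith
  qed
  then show "AE x in lebesgue. norm (f x * cnj (g x))
      \<le> norm ((cmod (f x))\<^sup>2 + (cmod (g x))\<^sup>2)"
    by (auto intro!: AE_I2)
qed

lemma square_integrable_add:
  assumes "square_integrable f" "square_integrable g"
  shows "square_integrable (\<lambda>x. f x + g x)"
proof -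
  have [measurable]: "f \<in> borel_measurable lebesgue" "g \<in> borel_measurable lebesgue"
    using assms by (auto simp: square_integrable_def)
  have "integrable lebesgue (\<lambda>x. 2 * (cmod (f x))\<^sup>2 + 2 * (cmod (g x))\<^sup>2)"
    using assms by (simp add: square_integrable_def)
  moreover have "(cmod (f x + g x))\<^sup>2 \<le> 2 * (cmod (f x))\<^sup>2 + 2 * (cmod (g x))\<^sup>2" for x
  proof -
    have "(cmod (f x + g x))\<^sup>2 \<le> (cmod (f x) + cmod (g x))\<^sup>2"
      by (intro power_mono norm_triangle_ineq) simp
    also have "\<dots> \<le> 2 * (cmod (f x))\<^sup>2 + 2 * (cmod (g x))\<^sup>2"
      using sum_squares_bound[of "cmod (f x)" "cmod (g x)"] by (simp add: power2_sum)
    finally show ?thesis .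
  qed
  ultimately have "integrable lebesgue (\<lambda>x. (cmod (f x + g x))\<^sup>2)"
    by (elim Bochner_Integration.integrable_bound) (auto intro!: AE_I2)
  then show ?thesis
    by (simp add: square_integrable_def)
qed

lemma square_integrable_cmult:
  assumes "square_integrable f"
  shows "square_integrable (\<lambda>x. c * f x)"
  using assms unfolding square_integrable_def norm_mult power_mult_distrib
  by (auto intro: integrable_mult_right)

lemma square_integrable_zero: "square_integrable (\<lambda>x. 0)"
  by (simp add: square_integrable_def)

lemma part_equivp_l2_rel: "part_equivp l2_rel"
proof (rule part_equivpI)
  show "\<exists>f. l2_rel f f"
    using square_integrable_zero by (auto simp: l2_rel_def)
  show "symp l2_rel"
    by (rule sympI) (auto simp: l2_rel_def)
  show "transp l2_rel"
    by (rule transpI) (auto simp: l2_rel_def)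
qed

quotient_type l2 = "real \<Rightarrow> complex" / partial: l2_rel
  by (rule part_equivp_l2_rel)

lift_definition cinner :: "l2 \<Rightarrow> l2 \<Rightarrow> complex" is pairing
proof -
  fix f f' g g' :: "real \<Rightarrow> complex"
  assume "l2_rel f f'" "l2_rel g g'"
  then have s: "square_integrable f" "square_integrable f'" "square_integrable g" "square_integrable g'"
    and "AE x in lebesgue. f x = f' x" "AE x in lebesgue. g x = g' x"
    by (auto simp: l2_rel_def)
  then have "AE x in lebesgue. f x * cnj (g x) = f' x * cnj (g' x)"
    by auto
  then show "pairing f g = pairing f' g'"
    unfolding pairing_def using s
    by (intro integral_cong_AE borel_measurable_integrable square_integrable_mult)
qed

lift_definition scaleC :: "complex \<Rightarrow> l2 \<Rightarrow> l2" is "\<lambda>c f x. c * f x"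
  by (auto simp: l2_rel_def intro: square_integrable_cmult)

instantiation l2 :: real_inner
begin

lift_definition zero_l2 :: l2 is "\<lambda>x. 0"
  by (simp add: l2_rel_def square_integrable_zero)

lift_definition plus_l2 :: "l2 \<Rightarrow> l2 \<Rightarrow> l2" is "\<lambda>f g x. f x + g x"
  by (auto simp: l2_rel_def intro: square_integrable_add)

definition uminus_l2 :: "l2 \<Rightarrow> l2" where "uminus_l2 u = scaleC (-1) u"
definition minus_l2 :: "l2 \<Rightarrow> l2 \<Rightarrow> l2" where "minus_l2 u v = u + (- v)"
definition scaleR_l2 :: "real \<Rightarrow> l2 \<Rightarrow> l2" where "scaleR_l2 r u = scaleC (of_real r) u"
definition inner_l2 :: "l2 \<Rightarrow> l2 \<Rightarrow> real" where "inner_l2 u v = Re (cinner u v)"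
definition norm_l2 :: "l2 \<Rightarrow> real" where "norm_l2 u = sqrt (inner u u)"
definition sgn_l2 :: "l2 \<Rightarrow> l2" where "sgn_l2 u = inverse (norm u) *\<^sub>R u"
definition dist_l2 :: "l2 \<Rightarrow> l2 \<Rightarrow> real" where "dist_l2 u v = norm (u - v)"
definition uniformity_l2 :: "(l2 \<times> l2) filter" where
  "uniformity_l2 = (INF e\<in>{0<..}. principal {(x, y). dist x y < e})"
definition open_l2 :: "l2 set \<Rightarrow> bool" where
  "open_l2 U \<longleftrightarrow> (\<forall>x\<in>U. eventually (\<lambda>(x', y). x' = x \<longrightarrow> y \<in> U) uniformity)"

lemma pairing_self: "pairing f f = of_real (LINT x|lebesgue. (cmod (f x))\<^sup>2)"
proof -
  have "pairing f f = (LINT x|lebesgue. complex_of_real ((cmod (f x))\<^sup>2))"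
    unfolding pairing_def by (simp only: complex_norm_square)
  then show ?thesis
    by (simp only: integral_complex_of_real)
qed

instance
proof
  fix a b c x y z :: l2 and r s :: real and U :: "l2 set"
  show "a + b + c = a + (b + c)"
    by transfer (auto simp: l2_rel_def add.assoc intro!: square_integrable_add)
  show "a + b = b + a"
    by transfer (auto simp: l2_rel_def add.commute intro!: square_integrable_add)
  show "0 + a = a"
    by transfer (auto simp: l2_rel_def)
  show "- a + a = 0"
    unfolding uminus_l2_def
    by transfer
      (auto simp: l2_rel_def square_integrable_zero)
  show "a - b = a + - b"
    by (fact minus_l2_def)
  show "r *\<^sub>R (x + y) = r *\<^sub>R x + r *\<^sub>R y"
    unfolding scaleR_l2_def
    by transfer (auto simp: l2_rel_def distrib_left
        intro!: square_integrable_add square_integrable_cmult)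
  show "(r + s) *\<^sub>R x = r *\<^sub>R x + s *\<^sub>R x"
    unfolding scaleR_l2_def
    by transfer (auto simp: l2_rel_def distrib_right
        intro!: square_integrable_add square_integrable_cmult)
  show "r *\<^sub>R s *\<^sub>R x = (r * s) *\<^sub>R x"
    unfolding scaleR_l2_def
    by transfer (auto simp: l2_rel_def mult.assoc intro!: square_integrable_cmult)
  show "1 *\<^sub>R x = x"
    unfolding scaleR_l2_def by transfer (auto simp: l2_rel_def)
  show "dist x y = norm (x - y)"
    by (fact dist_l2_def)
  show "sgn x = inverse (norm x) *\<^sub>R x"
    by (fact sgn_l2_def)
  show "uniformity = (INF e\<in>{0<..}. principal {(x, y). dist (x::l2) y < e})"
    by (fact uniformity_l2_def)
  show "open U = (\<forall>x\<in>U. \<forall>\<^sub>F (x', y) in uniformity. x' = x \<longrightarrow> y \<in> U)"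
    by (fact open_l2_def)
  show "norm x = sqrt (inner x x)"
    by (fact norm_l2_def)
  have "cinner x y = cnj (cinner y x)"
    by transfer (simp add: pairing_def mult.commute flip: Bochner_Integration.integral_cnj)
  then show "inner x y = inner y x"
    by (simp add: inner_l2_def)
  have "cinner (x + y) z = cinner x z + cinner y z"
    by transfer (simp add: pairing_def distrib_right l2_rel_def square_integrable_mult)
  then show "inner (x + y) z = inner x z + inner y z"
    by (simp add: inner_l2_def)
  have "cinner (scaleC (of_real r) x) y = of_real r * cinner x y"
    by transfer (simp add: pairing_def mult.assoc)
  then show "inner (r *\<^sub>R x) y = r * inner x y"
    by (simp add: inner_l2_def scaleR_l2_def)
  show "0 \<le> inner x x"
    unfolding inner_l2_def by transfer (simp add: pairing_self)
  show "(inner x x = 0) = (x = 0)"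
    unfolding inner_l2_def
  proof transfer
    fix f :: "real \<Rightarrow> complex"
    assume f: "l2_rel f f"
    then have "Re (pairing f f) = 0 \<longleftrightarrow> (AE x in lebesgue. (cmod (f x))\<^sup>2 = 0)"
      using integral_nonneg_eq_0_iff_AE[of lebesgue "\<lambda>x. (cmod (f x))\<^sup>2"]
      by (simp add: pairing_self l2_rel_def square_integrable_def)
    then show "(Re (pairing f f) = 0) = l2_rel f (\<lambda>x. 0)"
      using f by (simp add: l2_rel_def square_integrable_zero)
  qed
qed

end


section \<open>Unbounded operators and quadratic forms\<close>

text \<open>An operator is represented by its graph; its domain is \<^term>\<open>Domain A\<close>.\<close>

definition linear_operator :: "(l2 \<times> l2) set \<Rightarrow> bool" where
  "linear_operator A \<longleftrightarrow> single_valued A \<and> (0, 0) \<in> A \<and>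
     (\<forall>u f v g. (u, f) \<in> A \<longrightarrow> (v, g) \<in> A \<longrightarrow> (u + v, f + g) \<in> A) \<and>
     (\<forall>c u f. (u, f) \<in> A \<longrightarrow> (scaleC c u, scaleC c f) \<in> A)"

definition adjoint_operator :: "(l2 \<times> l2) set \<Rightarrow> (l2 \<times> l2) set" where
  "adjoint_operator A = {(v, g). \<forall>(u, f)\<in>A. cinner f v = cinner u g}"

definition selfadjoint :: "(l2 \<times> l2) set \<Rightarrow> bool" where
  "selfadjoint A \<longleftrightarrow>
     linear_operator A \<and> closure (Domain A) = UNIV \<and> adjoint_operator A = A"

definition operator_bounded_below :: "(l2 \<times> l2) set \<Rightarrow> bool" where
  "operator_bounded_below A \<longleftrightarrow>
     (\<exists>c::real. \<forall>(u, f)\<in>A. cinner f u \<in> \<real> \<and> c * (norm u)\<^sup>2 \<le> Re (cinner f u))"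

text \<open>A form is given by its domain \<open>D\<close> and its sesquilinear form \<open>t\<close>; the quadratic form is
  \<open>t u u\<close>.\<close>

definition form_bounded_below :: "l2 set \<Rightarrow> (l2 \<Rightarrow> l2 \<Rightarrow> complex) \<Rightarrow> bool" where
  "form_bounded_below D t \<longleftrightarrow>
     (\<exists>c::real. \<forall>u\<in>D. t u u \<in> \<real> \<and> c * (norm u)\<^sup>2 \<le> Re (t u u))"

definition closed_form :: "l2 set \<Rightarrow> (l2 \<Rightarrow> l2 \<Rightarrow> complex) \<Rightarrow> bool" where
  "closed_form D t \<longleftrightarrow>
     (\<forall>X x. (\<forall>n. X n \<in> D) \<longrightarrow> X \<longlonglongrightarrow> x \<longrightarrow>
        (\<forall>e>0. \<exists>N. \<forall>m\<ge>N. \<forall>n\<ge>N. cmod (t (X m - X n) (X m - X n)) < e) \<longrightarrow>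
        x \<in> D \<and> (\<lambda>n. t (X n - x) (X n - x)) \<longlonglongrightarrow> 0)"

definition associated_operator ::
    "l2 set \<Rightarrow> (l2 \<Rightarrow> l2 \<Rightarrow> complex) \<Rightarrow> (l2 \<times> l2) set \<Rightarrow> bool" where
  "associated_operator D t A \<longleftrightarrow>
     selfadjoint A \<and> Domain A \<subseteq> D \<and> (\<forall>(u, f)\<in>A. \<forall>v\<in>D. cinner f v = t u v)"


section \<open>Distributional derivatives and function spaces\<close>

definition test_function :: "(real \<Rightarrow> complex) \<Rightarrow> bool" where
  "test_function \<phi> \<longleftrightarrow>
     (\<forall>n x. ((\<lambda>f y. vector_derivative f (at y)) ^^ n) \<phi> differentiable at x) \<and>
     compact (closure {x. \<phi> x \<noteq> 0})"

definition locally_integrable :: "(real \<Rightarrow> complex) \<Rightarrow> bool" where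
  "locally_integrable f \<longleftrightarrow> (\<forall>a b. set_integrable lebesgue {a..b} f)"

text \<open>The distribution \<open>f'\<close> is the regular distribution given by \<open>g\<close>.\<close>

definition has_distr_deriv :: "(real \<Rightarrow> complex) \<Rightarrow> (real \<Rightarrow> complex) \<Rightarrow> bool"
  (infix "has'_distr'_deriv" 50) where
  "f has_distr_deriv g \<longleftrightarrow> locally_integrable f \<and> locally_integrable g \<and>
     (\<forall>\<phi>. test_function \<phi> \<longrightarrow>
        (LINT x|lebesgue. g x * \<phi> x) = - (LINT x|lebesgue. f x * vector_derivative \<phi> (at x)))"

definition absolutely_continuous_on_interval ::
    "real \<Rightarrow> real \<Rightarrow> (real \<Rightarrow> complex) \<Rightarrow> bool" where
  "absolutely_continuous_on_interval a b f \<longleftrightarrow>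
     (\<forall>e>0. \<exists>d>0. \<forall>(n::nat) l r.
        (\<forall>i<n. a \<le> l i \<and> l i \<le> r i \<and> r i \<le> b) \<longrightarrow>
        disjoint_family_on (\<lambda>i. {l i<..<r i}) {..<n} \<longrightarrow>
        (\<Sum>i<n. r i - l i) < d \<longrightarrow> (\<Sum>i<n. cmod (f (r i) - f (l i))) < e)"

definition W11_loc :: "(real \<Rightarrow> complex) set" where
  "W11_loc = {f. \<forall>a b. absolutely_continuous_on_interval a b f}"

definition L2_unif :: "(real \<Rightarrow> real) set" where
  "L2_unif = {\<sigma> \<in> borel_measurable lebesgue.
     (SUP t. \<integral>\<^sup>+ s\<in>{t..t+1}. ennreal (\<bar>\<sigma> s\<bar>\<^sup>2) \<partial>lebesgue) < \<infinity>}"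

definition L1_unif :: "(real \<Rightarrow> real) set" where
  "L1_unif = {\<tau> \<in> borel_measurable lebesgue.
     (SUP t. \<integral>\<^sup>+ s\<in>{t..t+1}. ennreal \<bar>\<tau> s\<bar> \<partial>lebesgue) < \<infinity>}"

text \<open>Distributional derivatives do not depend on the representatives, and the derivative is unique
  as an element of \<^typ>\<open>l2\<close>.\<close>

definition W12 :: "l2 set" where
  "W12 = {u. \<exists>v. rep_l2 u has_distr_deriv rep_l2 v}"

definition l2_deriv :: "l2 \<Rightarrow> l2" where
  "l2_deriv u = (THE v. rep_l2 u has_distr_deriv rep_l2 v)"


section \<open>The form and the operator\<close>

definition form_t :: "(real \<Rightarrow> real) \<Rightarrow> (real \<Rightarrow> real) \<Rightarrow> l2 \<Rightarrow> l2 \<Rightarrow> complex" where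
  "form_t \<sigma> \<tau> u v =
     (let y = rep_l2 u; y' = rep_l2 (l2_deriv u); z = rep_l2 v; z' = rep_l2 (l2_deriv v) in
        pairing y' z'
        - pairing (\<lambda>x. of_real (\<sigma> x) * y' x) z
        - pairing (\<lambda>x. of_real (\<sigma> x) * y x) z'
        + pairing (\<lambda>x. of_real (\<tau> x) * y x) z)"

text \<open>\<open>y\<close> is the locally absolutely continuous representative of the element \<open>u\<close> of the domain,
  \<open>w\<close> that of the quasi-derivative \<open>y' - \<sigma> y\<close>, which is itself only defined up to a null set, and
  \<open>y'\<close>, \<open>w'\<close> are the derivatives of \<open>y\<close>, \<open>w\<close>.\<close>

definition op_S :: "(real \<Rightarrow> real) \<Rightarrow> (real \<Rightarrow> real) \<Rightarrow> (l2 \<times> l2) set" where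
  "op_S \<sigma> \<tau> = {(u, f). \<exists>y y' w w'.
     y \<in> W11_loc \<and> square_integrable y \<and> u = abs_l2 y \<and> y has_distr_deriv y' \<and>
     w \<in> W11_loc \<and> (AE x in lebesgue. w x = y' x - of_real (\<sigma> x) * y x) \<and>
     w has_distr_deriv w' \<and>
     (let ly = (\<lambda>x. - w' x - of_real (\<sigma> x) * y' x + of_real (\<tau> x) * y x) in
        square_integrable ly \<and> f = abs_l2 ly)}"

end

theory Submission
  imports Defs
begin

text \<open>
  Distributional derivatives are handled through primitives: \<open>f\<close> has the derivative \<open>g\<close> iff it agrees almost
  everywhere with an indefinite integral of \<open>g\<close>, which is locally absolutely continuous, so no
  differentiation theorem for absolutely continuous functions is needed.

  For \<open>y \<in> W\<^sup>1\<^sub>2\<close>, averaging the derivative of \<open>\<bar>y\<bar>\<^sup>2\<close> over \<open>[x, x + 1]\<close> and Tonelli's theorem give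
  \<open>\<integral>p\<bar>y\<bar>\<^sup>2 \<le> M((1 + 1/\<epsilon>)\<parallel>y\<parallel>\<^sup>2 + \<epsilon>\<parallel>y'\<parallel>\<^sup>2)\<close> for every uniformly locally integrable weight \<open>p\<close>. With
  \<open>p = 4\<sigma>\<^sup>2 + \<bar>\<tau>\<bar>\<close> the form differs from \<open>\<parallel>y'\<parallel>\<^sup>2\<close> by at most \<open>\<parallel>y'\<parallel>\<^sup>2/2 + c\<parallel>y\<parallel>\<^sup>2\<close>, hence is closed and bounded below,
  and its operator \<open>T = {(u, f). \<forall>v. (f, v) = t(u, v)}\<close> is selfadjoint by the Riesz representation theorem.

  Testing with smooth \<open>v\<close> gives \<open>T \<subseteq> S\<close>. For \<open>S \<subseteq> T\<close> the crucial point is that \<open>y' \<in> L\<^sub>2\<close> for \<open>y\<close> in the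
  domain of \<open>S\<close>. For a cutoff \<open>\<eta>\<close> the cross terms in \<open>t(\<eta>y)\<close> cancel, so that
  \<open>t(\<eta>y) = Re (Sy, \<eta>\<^sup>2y) + \<parallel>\<eta>'y\<parallel>\<^sup>2\<close>; the lower bound of the form then bounds \<open>\<parallel>(\<eta>y)'\<parallel>\<close> independently of \<open>\<eta>\<close>.
\<close>

section \<open>Primitives of locally integrable functions\<close>

text \<open>The two inclusions are of unequal difficulty. An element of the domain of
  \<open>S\<close> brings \<open>y\<close> and \<open>Sy\<close> in L2 but no global information on
  \<open>y'\<close>, so integrating by parts over the whole line would leave uncontrolled boundary
  terms. Locally there is no problem: \<open>w = y' - \<sigma> y\<close> is continuous, hence
  \<open>y' = w + \<sigma> y\<close> is square integrable on bounded intervals, and \<eta> y lies in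
  \<open>W12\<close> for every compactly supported C1 cutoff \<eta>. One identity for compactly
  supported multipliers \<zeta> therefore serves twice: with \<zeta> = \<eta>^2 cnj y for the energy
  bound, and with \<zeta> = \<eta> cnj z, for arbitrary z in \<open>W12\<close>, for the inclusion
  itself. Neither \<open>y'\<close> nor \<open>\<sigma> y\<close> need have a function as weak
  derivative; only their difference does. The product rule is therefore applied to \<open>w\<close>
  alone, and the terms containing \<sigma> are recombined pointwise afterwards.\<close>

definition primitive :: "(real \<Rightarrow> complex) \<Rightarrow> (real \<Rightarrow> complex) \<Rightarrow> bool" where
  "primitive F f \<longleftrightarrow> locally_integrable f \<and>
     (\<forall>a b. a \<le> b \<longrightarrow> F b - F a = (LINT t:{a..b}|lebesgue. f t))"

section \<open>Closure properties of local integrability\<close>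

lemma borel_measurable_cnj [measurable (raw)]:
  "f \<in> borel_measurable M \<Longrightarrow> (\<lambda>x. cnj (f x)) \<in> borel_measurable M"
  by (rule borel_measurable_continuous_on[of cnj]) (auto intro: continuous_intros)

lemma locally_integrableD: "locally_integrable f \<Longrightarrow> set_integrable lebesgue {a..b} f"
  by (simp add: locally_integrable_def)

lemma locally_integrable_measurable:
  assumes "locally_integrable f"
  shows "f \<in> borel_measurable lebesgue"
proof (rule borel_measurable_LIMSEQ_metric)
  show "(\<lambda>x. indicator {- real n..real n} x *\<^sub>R f x) \<in> borel_measurable lebesgue" for n
    using locally_integrableD[OF assms, of "- real n" "real n"] unfolding set_integrable_def
    by (rule borel_measurable_integrable)
  fix x
  obtain N where "\<bar>x\<bar> \<le> real N"
    using real_arch_simple by blast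
  then have "\<forall>\<^sub>F n in sequentially. f x = indicator {- real n..real n} x *\<^sub>R f x"
    by (intro eventually_sequentiallyI[of N]) (auto simp: indicator_def)
  then show "(\<lambda>n. indicator {- real n..real n} x *\<^sub>R f x) \<longlonglongrightarrow> f x"
    by (rule Lim_transform_eventually[OF tendsto_const])
qed

lemma borel_measurable_indicator_interval [measurable]:
  fixes f :: "real \<Rightarrow> 'a::{real_normed_vector, second_countable_topology}"
  assumes "f \<in> borel_measurable lebesgue"
  shows "(\<lambda>x. indicat_real {a..b} x *\<^sub>R f x) \<in> borel_measurable lebesgue"
    "(\<lambda>x. indicat_real {a<..<b} x *\<^sub>R f x) \<in> borel_measurable lebesgue"
  using assms by (intro borel_measurable_scaleR borel_measurable_indicator; simp)+

lemma locally_integrableI_bound: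
  assumes "f \<in> borel_measurable lebesgue"
    and "\<And>a b. \<exists>g :: real \<Rightarrow> real. set_integrable lebesgue {a..b} g \<and>
           (AE x in lebesgue. x \<in> {a..b} \<longrightarrow> cmod (f x) \<le> g x)"
  shows "locally_integrable f"
  unfolding locally_integrable_def
proof (intro allI)
  fix a b :: real
  obtain g :: "real \<Rightarrow> real" where g: "set_integrable lebesgue {a..b} g"
      "AE x in lebesgue. x \<in> {a..b} \<longrightarrow> cmod (f x) \<le> g x"
    using assms(2) by blast
  show "set_integrable lebesgue {a..b} f"
  proof (rule set_integrable_bound[OF g(1)])
    show "set_borel_measurable lebesgue {a..b} f"
      unfolding set_borel_measurable_def using assms(1) by (rule borel_measurable_indicator_interval)
    show "AE x in lebesgue. x \<in> {a..b} \<longrightarrow> cmod (f x) \<le> norm (g x)"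
      using g(2) by eventually_elim auto
  qed
qed

lemma locally_integrable_add:
  "locally_integrable f \<Longrightarrow> locally_integrable g \<Longrightarrow> locally_integrable (\<lambda>x. f x + g x)"
  by (simp add: locally_integrable_def)

lemma locally_integrable_diff:
  "locally_integrable f \<Longrightarrow> locally_integrable g \<Longrightarrow> locally_integrable (\<lambda>x. f x - g x)"
  by (simp add: locally_integrable_def)

lemma locally_integrable_cmult:
  "locally_integrable f \<Longrightarrow> locally_integrable (\<lambda>x. c * f x)"
  by (simp add: locally_integrable_def)

lemma locally_integrable_uminus:
  "locally_integrable f \<Longrightarrow> locally_integrable (\<lambda>x. - f x)"
  using locally_integrable_cmult[of f "-1"] by simp

lemma set_integrable_cnj:
  "set_integrable M A f \<Longrightarrow> set_integrable M A (\<lambda>x. cnj (f x))"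
  unfolding set_integrable_def
  by (simp only: complex_cnj_scaleR[symmetric] complex_integrable_cnj)

lemma locally_integrable_cnj:
  "locally_integrable f \<Longrightarrow> locally_integrable (\<lambda>x. cnj (f x))"
  by (simp add: locally_integrable_def set_integrable_cnj)

lemma locally_integrable_mult_continuous:
  assumes f: "locally_integrable f" and h: "continuous_on UNIV h"
  shows "locally_integrable (\<lambda>x. h x * f x)"
proof (rule locally_integrableI_bound)
  have "h \<in> borel_measurable lebesgue"
    using borel_measurable_continuous_onI[OF h] by (simp add: measurable_completion)
  then show "(\<lambda>x. h x * f x) \<in> borel_measurable lebesgue"
    using locally_integrable_measurable[OF f] by measurable
  fix a b :: real
  have "compact (h ` {a..b})"
    by (rule compact_continuous_image) (auto intro: continuous_on_subset[OF h])
  then obtain B where B: "\<And>x. x \<in> {a..b} \<Longrightarrow> cmod (h x) \<le> B"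
    by (metis compact_imp_bounded bounded_iff imageI)
  have "set_integrable lebesgue {a..b} (\<lambda>x. B * cmod (f x))"
    using set_integrable_norm[OF locally_integrableD[OF f]] by simp
  moreover have "cmod (h x * f x) \<le> B * cmod (f x)" if "x \<in> {a..b}" for x
    using B[OF that] by (simp add: norm_mult mult_right_mono)
  ultimately show "\<exists>g. set_integrable lebesgue {a..b} g \<and>
      (AE x in lebesgue. x \<in> {a..b} \<longrightarrow> cmod (h x * f x) \<le> (g x :: real))"
    by (intro exI[of _ "\<lambda>x. B * cmod (f x)"]) auto
qed

lemma locally_integrable_mult_continuous':
  "locally_integrable f \<Longrightarrow> continuous_on UNIV h \<Longrightarrow> locally_integrable (\<lambda>x. f x * h x)"
  using locally_integrable_mult_continuous[of f h] by (simp add: mult.commute)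

lemma locally_integrable_continuous:
  assumes "continuous_on UNIV h"
  shows "locally_integrable h"
  unfolding locally_integrable_def
  using continuous_on_subset[OF assms] absolutely_integrable_continuous_real by blast

text \<open>Lebesgue measure is complete, so a set that differs from a measurable one by a null set
  is measurable. Nothing is presupposed about \<open>g\<close>, which allows properties to be
  carried over to a function known only up to null sets.\<close>

lemma borel_measurable_lebesgue_cong_AE:
  fixes f g :: "real \<Rightarrow> 'b::topological_space"
  assumes f: "f \<in> borel_measurable lebesgue" and eq: "AE x in lebesgue. f x = g x"
  shows "g \<in> borel_measurable lebesgue"
proof (rule measurableI)
  fix A :: "'b set" assume "A \<in> sets borel"
  then have S: "f -` A \<inter> space lebesgue \<in> sets lebesgue"
    using measurable_sets[OF f] by blast
  have "AE x in lebesgue. x \<in> f -` A \<inter> space lebesgue \<longleftrightarrow> x \<in> g -` A \<inter> space lebesgue"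
    using eq by eventually_elim auto
  then show "g -` A \<inter> space lebesgue \<in> sets lebesgue"
    by (rule completion.in_sets_AE[OF _ S]) auto
qed auto

lemma locally_integrable_cong_AE:
  assumes "locally_integrable f" "AE x in lebesgue. f x = g x"
  shows "locally_integrable g"
proof -
  have [measurable]: "f \<in> borel_measurable lebesgue"
    by (rule locally_integrable_measurable[OF assms(1)])
  have [measurable]: "g \<in> borel_measurable lebesgue"
    by (rule borel_measurable_lebesgue_cong_AE[OF _ assms(2)]) measurable
  have "integrable lebesgue (\<lambda>x. indicat_real {a..b} x *\<^sub>R g x)" for a b
  proof (rule integrable_cong_AE_imp)
    show "integrable lebesgue (\<lambda>x. indicat_real {a..b} x *\<^sub>R f x)"
      using locally_integrableD[OF assms(1)] by (simp add: set_integrable_def)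
    show "AE x in lebesgue. indicat_real {a..b} x *\<^sub>R f x = indicat_real {a..b} x *\<^sub>R g x"
      using assms(2) by eventually_elim simp
  qed measurable
  then show ?thesis
    by (simp add: locally_integrable_def set_integrable_def)
qed

section \<open>Indefinite integrals and their algebra\<close>

lemma set_integral_combine:
  assumes "locally_integrable f" "a \<le> b" "b \<le> c"
  shows "(LINT t:{a..c}|lebesgue. f t) =
    (LINT t:{a..b}|lebesgue. f t) + (LINT t:{b..c}|lebesgue. f t)"
  using Henstock_Kurzweil_Integration.integral_combine[OF assms(2,3), of f]
    set_lebesgue_integral_eq_integral[OF locally_integrableD[OF assms(1)]]
  by simp

lemma primitive_exists:
  assumes f: "locally_integrable f"
  obtains F where "primitive F f"
proof
  \<comment> \<open>Integrals over \<open>{a..b}\<close> carry no orientation, so the sign for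
    negative \<open>x\<close> is put in by hand; the possible positions of 0 relative to
    \<open>a\<close> and \<open>b\<close> are separate instances of additivity.\<close>
  define F where "F x = (if 0 \<le> x then (LINT t:{0..x}|lebesgue. f t)
    else - (LINT t:{x..0}|lebesgue. f t))" for x
  have "F b - F a = (LINT t:{a..b}|lebesgue. f t)" if "a \<le> b" for a b
    using set_integral_combine[OF f, of 0 a b] set_integral_combine[OF f, of a 0 b]
      set_integral_combine[OF f, of a b 0] that
    by (auto simp: F_def algebra_simps)
  then show "primitive F f"
    using f by (simp add: primitive_def)
qed

lemma primitiveD:
  assumes "primitive F f"
  shows "locally_integrable f" "\<And>a b. a \<le> b \<Longrightarrow> F b - F a = (LINT t:{a..b}|lebesgue. f t)"
  using assms by (auto simp: primitive_def)

lemma primitive_diff: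
  assumes "primitive F f" "primitive G g"
  shows "primitive (\<lambda>x. F x - G x) (\<lambda>x. f x - g x)"
  unfolding primitive_def
proof (intro conjI allI impI)
  note F = primitiveD[OF assms(1)] and G = primitiveD[OF assms(2)]
  show "locally_integrable (\<lambda>x. f x - g x)"
    using F(1) G(1) by (rule locally_integrable_diff)
  fix a b :: real assume "a \<le> b"
  have "F b - G b - (F a - G a) = (F b - F a) - (G b - G a)" by simp
  also have "\<dots> = (LINT t:{a..b}|lebesgue. f t - g t)"
    using F(1) G(1) \<open>a \<le> b\<close> by (simp add: F(2) G(2) locally_integrableD)
  finally show "F b - G b - (F a - G a) = (LINT t:{a..b}|lebesgue. f t - g t)" .
qed

lemma primitive_cnj:
  assumes "primitive F f"
  shows "primitive (\<lambda>x. cnj (F x)) (\<lambda>x. cnj (f x))"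
  unfolding primitive_def
proof (intro conjI allI impI)
  note F = primitiveD[OF assms(1)]
  show "locally_integrable (\<lambda>x. cnj (f x))"
    using F(1) by (rule locally_integrable_cnj)
  fix a b :: real assume "a \<le> b"
  have "cnj (F b) - cnj (F a) = cnj (F b - F a)" by simp
  also have "\<dots> = (LINT t:{a..b}|lebesgue. cnj (f t))"
    unfolding F(2)[OF \<open>a \<le> b\<close>] set_lebesgue_integral_def
    by (simp flip: Bochner_Integration.integral_cnj)
  finally show "cnj (F b) - cnj (F a) = (LINT t:{a..b}|lebesgue. cnj (f t))" .
qed

lemma primitive_cong_AE:
  assumes "primitive F f" "AE x in lebesgue. f x = g x"
  shows "primitive F g"
proof -
  note F = primitiveD[OF assms(1)]
  have g: "locally_integrable g"
    by (rule locally_integrable_cong_AE[OF F(1) assms(2)])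
  have "(LINT t:{a..b}|lebesgue. f t) = (LINT t:{a..b}|lebesgue. g t)" for a b
    unfolding set_lebesgue_integral_def
    using assms(2) locally_integrable_measurable[OF F(1)] locally_integrable_measurable[OF g]
    by (intro integral_cong_AE borel_measurable_indicator_interval) auto
  then show ?thesis
    using F g by (simp add: primitive_def)
qed

lemma primitive_add_const:
  "primitive F f \<Longrightarrow> primitive (\<lambda>x. F x + c) f"
  by (simp add: primitive_def)

lemma primitive_C1:
  assumes "\<And>x. (\<phi> has_vector_derivative \<phi>' x) (at x)" "continuous_on UNIV \<phi>'"
  shows "primitive \<phi> \<phi>'"
  unfolding primitive_def
proof (intro conjI allI impI)
  show l: "locally_integrable \<phi>'"
    using assms(2) by (rule locally_integrable_continuous)
  fix a b :: real assume "a \<le> b"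
  then have "(\<phi>' has_integral (\<phi> b - \<phi> a)) {a..b}"
    by (intro fundamental_theorem_of_calculus)
      (auto intro: has_vector_derivative_at_within assms(1))
  then show "\<phi> b - \<phi> a = (LINT t:{a..b}|lebesgue. \<phi>' t)"
    using locally_integrableD[OF l] by (simp add: set_lebesgue_integral_eq_integral integral_unique)
qed

subsection \<open>Absolute continuity\<close>

lemma W11_loc_continuous:
  assumes "f \<in> W11_loc"
  shows "continuous_on UNIV f"
proof -
  have "isCont f x" for x
    unfolding continuous_at_eps_delta
  proof (intro allI impI)
    fix e :: real assume "e > 0"
    moreover have "absolutely_continuous_on_interval (x - 1) (x + 1) f"
      using assms by (simp add: W11_loc_def)
    ultimately obtain d where "d > 0" and d: "\<And>(n::nat) l r.
        (\<forall>i<n. x - 1 \<le> l i \<and> l i \<le> r i \<and> r i \<le> x + 1) \<Longrightarrow>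
        disjoint_family_on (\<lambda>i. {l i<..<r i}) {..<n} \<Longrightarrow>
        (\<Sum>i<n. r i - l i) < d \<Longrightarrow> (\<Sum>i<n. cmod (f (r i) - f (l i))) < e"
      unfolding absolutely_continuous_on_interval_def by meson
    show "\<exists>d>0. \<forall>x'. dist x' x < d \<longrightarrow> dist (f x') (f x) < e"
    proof (intro exI[of _ "min d 1"] conjI allI impI)
      fix y assume y: "dist y x < min d 1"
      \<comment> \<open>Absolute continuity for a family of one interval, the one between
        \<open>x\<close> and \<open>y\<close>; the 1 in \<open>min d 1\<close> keeps it inside
        \<open>[x - 1, x + 1]\<close>.\<close>
      have "(\<Sum>i<1::nat. cmod (f (max x y) - f (min x y))) < e"
        using y by (intro d) (auto simp: dist_real_def disjoint_family_on_def)
      then show "dist (f y) (f x) < e"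
        by (cases "x \<le> y") (auto simp: dist_norm norm_minus_commute max_def min_def)
    qed (use \<open>d > 0\<close> in auto)
  qed
  then show ?thesis
    by (simp add: continuous_on_eq_continuous_at)
qed

text \<open>Truncating at height \<open>N\<close> leaves an excess that tends to 0 pointwise and is
  dominated by \<open>cmod (g x)\<close>. This isolates the unbounded part of a density, the only
  obstacle to absolute continuity of its integral.\<close>

lemma integrable_tail:
  fixes g :: "real \<Rightarrow> complex"
  assumes g: "integrable M g" and "e > 0"
  obtains N :: nat where "(LINT x|M. cmod (g x) - min (cmod (g x)) (real N)) < e"
proof -
  have [measurable]: "g \<in> borel_measurable M" using g by simp
  have "(\<lambda>N. LINT x|M. cmod (g x) - min (cmod (g x)) (real N)) \<longlonglongrightarrow> (LINT x|M. 0)"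
  proof (rule integral_dominated_convergence[where w="\<lambda>x. cmod (g x)"])
    show "AE x in M. (\<lambda>N. cmod (g x) - min (cmod (g x)) (real N)) \<longlonglongrightarrow> 0"
    proof (intro AE_I2)
      fix x
      obtain N where "cmod (g x) \<le> real N" using real_arch_simple by blast
      then have "\<forall>\<^sub>F n in sequentially. 0 = cmod (g x) - min (cmod (g x)) (real n)"
        by (intro eventually_sequentiallyI[of N]) auto
      then show "(\<lambda>N. cmod (g x) - min (cmod (g x)) (real N)) \<longlonglongrightarrow> 0"
        by (rule Lim_transform_eventually[OF tendsto_const])
    qed
  qed (use g in \<open>auto simp: min_def\<close>)
  then have "\<forall>\<^sub>F N in sequentially. (LINT x|M. cmod (g x) - min (cmod (g x)) (real N)) < e"
    using \<open>e > 0\<close> by (simp add: order_tendstoD(2))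
  then show ?thesis using that by (auto simp: eventually_sequentially)
qed

text \<open>On disjoint intervals of total length below \<open>d\<close>, the part of the density
  below height \<open>N\<close> contributes at most \<open>N * d\<close>, and the excess over
  \<open>N\<close> at most its whole integral, whatever the intervals are. Each of the two shares is
  kept within \<open>e / 2\<close>.\<close>

lemma primitive_W11_loc:
  assumes "primitive F f"
  shows "F \<in> W11_loc"
  unfolding W11_loc_def absolutely_continuous_on_interval_def
proof (intro CollectI allI impI)
  fix a b e :: real assume "e > 0"
  note F = primitiveD[OF assms(1)]
  define g where "g x = indicat_real {a..b} x *\<^sub>R f x" for x
  have g: "integrable lebesgue g"
    using locally_integrableD[OF F(1), of a b] by (simp add: g_def [abs_def] set_integrable_def)
  have [measurable]: "g \<in> borel_measurable lebesgue" using g by simp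
  obtain N :: nat where N: "(LINT x|lebesgue. cmod (g x) - min (cmod (g x)) (real N)) < e / 2"
    using integrable_tail[OF g, of "e/2"] \<open>e > 0\<close> by auto
  let ?t = "\<lambda>x. cmod (g x) - min (cmod (g x)) (real N)"
  have t: "integrable lebesgue ?t"
    using g by (rule Bochner_Integration.integrable_bound[OF integrable_norm]) (auto simp: min_def)
  \<comment> \<open>\<open>N + 1\<close> instead of \<open>N\<close>, because the truncation height
    may be 0.\<close>
  define d where "d = e / (2 * (real N + 1))"
  have "d > 0" using \<open>e > 0\<close> by (simp add: d_def)
  have main: "(\<Sum>i<n. cmod (F (r i) - F (l i))) < e"
    if lr: "\<forall>i<n. a \<le> l i \<and> l i \<le> r i \<and> r i \<le> b"
      and disj: "disjoint_family_on (\<lambda>i. {l i<..<r i}) {..<n}"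
      and len: "(\<Sum>i<n. r i - l i) < d" for n :: nat and l r
  proof -
    \<comment> \<open>Open intervals, since disjointness is assumed for those only; the endpoints
      form a null set.\<close>
    define I where "I i = {l i<..<r i}" for i
    have [simp]: "integrable lebesgue (indicat_real (I i))" for i
      using emeasure_lborel_box_finite[of "l i" "r i"]
      by (intro integrable_real_indicator) (auto simp: I_def box_real)
    have *: "cmod (F (r i) - F (l i)) \<le> real N * (r i - l i) + (LINT x|lebesgue. indicat_real (I i) x * ?t x)"
      if "i < n" for i
    proof -
      have lri: "a \<le> l i" "l i \<le> r i" "r i \<le> b" using lr that by auto
      have ne: "AE x in lebesgue. x \<noteq> l i" "AE x in lebesgue. x \<noteq> r i"
        using AE_completion[OF AE_lborel_singleton] by blast+
      have "F (r i) - F (l i) = (LINT x|lebesgue. indicat_real (I i) x *\<^sub>R g x)"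
        unfolding F(2)[OF lri(2)] set_lebesgue_integral_def
      proof (rule integral_cong_AE)
        show "AE x in lebesgue. indicat_real {l i..r i} x *\<^sub>R f x = indicat_real (I i) x *\<^sub>R g x"
          using ne by eventually_elim (use lri in \<open>auto simp: g_def I_def indicator_def\<close>)
      qed (use locally_integrable_measurable[OF F(1)] in \<open>auto simp: I_def intro: borel_measurable_indicator_interval\<close>)
      then have "cmod (F (r i) - F (l i)) \<le> (LINT x|lebesgue. norm (indicat_real (I i) x *\<^sub>R g x))"
        by (simp only: integral_norm_bound)
      also have "\<dots> \<le> (LINT x|lebesgue. real N * indicat_real (I i) x + indicat_real (I i) x * ?t x)"
      proof (rule integral_mono)
        show "integrable lebesgue (\<lambda>x. norm (indicat_real (I i) x *\<^sub>R g x))"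
          by (intro integrable_norm integrable_mult_indicator g) (auto simp: I_def)
        show "integrable lebesgue (\<lambda>x. real N * indicat_real (I i) x + indicat_real (I i) x * ?t x)"
          using integrable_mult_indicator[OF _ t, of "I i"]
            \<open>integrable lebesgue (indicat_real (I i))\<close>
          by (intro Bochner_Integration.integrable_add integrable_mult_right) (auto simp: I_def[of i])
        show "norm (indicat_real (I i) x *\<^sub>R g x) \<le> real N * indicat_real (I i) x + indicat_real (I i) x * ?t x" for x
          by (auto simp: indicator_def)
      qed
      also have "\<dots> = real N * (r i - l i) + (LINT x|lebesgue. indicat_real (I i) x * ?t x)"
        using integrable_mult_indicator[OF _ t, of "I i"] lri \<open>integrable lebesgue (indicat_real (I i))\<close>
        by (subst Bochner_Integration.integral_add) (auto simp: I_def)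
      finally show ?thesis .
    qed
    have "(\<Sum>i<n. cmod (F (r i) - F (l i))) \<le>
        (\<Sum>i<n. real N * (r i - l i) + (LINT x|lebesgue. indicat_real (I i) x * ?t x))"
      by (rule sum_mono) (use * in auto)
    also have "\<dots> = real N * (\<Sum>i<n. r i - l i) + (LINT x|lebesgue. (\<Sum>i<n. indicat_real (I i) x * ?t x))"
      using integrable_mult_indicator[OF _ t]
      by (subst Bochner_Integration.integral_sum) (auto simp: I_def sum.distrib sum_distrib_left)
    also have "(LINT x|lebesgue. (\<Sum>i<n. indicat_real (I i) x * ?t x)) \<le> (LINT x|lebesgue. ?t x)"
    proof (rule integral_mono[OF _ t])
      show "integrable lebesgue (\<lambda>x. \<Sum>i<n. indicat_real (I i) x * ?t x)"
        using integrable_mult_indicator[OF _ t]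
        by (intro Bochner_Integration.integrable_sum) (auto simp: I_def)
      show "(\<Sum>i<n. indicat_real (I i) x * ?t x) \<le> ?t x" for x
      proof -
        have "(\<Sum>i<n. indicat_real (I i) x) = indicat_real (\<Union>i<n. I i) x"
          using disj unfolding I_def
          by (subst indicator_UN_disjoint) auto
        also have "\<dots> \<le> 1" by (simp add: indicator_le_1)
        finally have "(\<Sum>i<n. indicat_real (I i) x) * ?t x \<le> 1 * ?t x"
          by (intro mult_right_mono) auto
        then show ?thesis by (simp add: sum_distrib_right)
      qed
    qed
    finally have "(\<Sum>i<n. cmod (F (r i) - F (l i))) < real N * (\<Sum>i<n. r i - l i) + e / 2"
      using N by linarith
    also have "real N * (\<Sum>i<n. r i - l i) \<le> real N * d"
      using len by (intro mult_left_mono) auto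
    also have "real N * d \<le> (real N + 1) * d"
      using \<open>d > 0\<close> by simp
    also have "\<dots> = e / 2" by (simp add: d_def field_simps)
    finally show ?thesis by simp
  qed
  show "\<exists>d>0. \<forall>(n::nat) l r. (\<forall>i<n. a \<le> l i \<and> l i \<le> r i \<and> r i \<le> b) \<longrightarrow>
        disjoint_family_on (\<lambda>i. {l i<..<r i}) {..<n} \<longrightarrow>
        (\<Sum>i<n. r i - l i) < d \<longrightarrow> (\<Sum>i<n. cmod (F (r i) - F (l i))) < e"
  proof (rule exI[of _ d], rule conjI)
    show "0 < d" by fact
  next
    show "\<forall>(n::nat) l r. (\<forall>i<n. a \<le> l i \<and> l i \<le> r i \<and> r i \<le> b) \<longrightarrow>
        disjoint_family_on (\<lambda>i. {l i<..<r i}) {..<n} \<longrightarrow>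
        (\<Sum>i<n. r i - l i) < d \<longrightarrow> (\<Sum>i<n. cmod (F (r i) - F (l i))) < e"
      by (intro allI impI) (rule main)
  qed
qed

lemmas primitive_continuous = W11_loc_continuous[OF primitive_W11_loc]

subsection \<open>The product rule\<close>

text \<open>Fubini's theorem will be used on the product of two copies of \<open>lborel\<close>, a
  measure on Borel sets. Lebesgue measurable integrands are therefore first replaced by Borel ones
  equal to them almost everywhere.\<close>

lemma borel_representative_complex:
  fixes f :: "'a \<Rightarrow> complex"
  assumes "f \<in> borel_measurable (completion M)"
  obtains g where "g \<in> borel_measurable M" "AE x in completion M. f x = g x"
proof -
  have "(\<lambda>x. Re (f x)) \<in> borel_measurable (completion M)" "(\<lambda>x. Im (f x)) \<in> borel_measurable (completion M)"
    using assms by auto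
  from this[THEN completion_ex_borel_measurable_real]
  obtain g1 g2 where g [measurable]: "g1 \<in> borel_measurable M" "g2 \<in> borel_measurable M"
    and eq: "AE x in M. Re (f x) = g1 x" "AE x in M. Im (f x) = g2 x"
    by auto
  show ?thesis
  proof
    show "(\<lambda>x. Complex (g1 x) (g2 x)) \<in> borel_measurable M"
      unfolding Complex_eq by measurable
    show "AE x in completion M. f x = Complex (g1 x) (g2 x)"
      using eq[THEN AE_completion] by eventually_elim (simp add: complex_eq_iff)
  qed
qed

lemma integrable_borel_representative:
  fixes f :: "'a \<Rightarrow> complex"
  assumes f: "integrable (completion M) f"
  obtains g where "integrable M g" "AE x in completion M. f x = g x"
proof -
  obtain g where g: "g \<in> borel_measurable M" "AE x in completion M. f x = g x"
    using borel_representative_complex[OF borel_measurable_integrable[OF f]] by blast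
  have "integrable (completion M) g"
    by (rule integrable_cong_AE_imp[OF f measurable_completion[OF g(1)] g(2)])
  then show ?thesis
    using that g integrable_completion by blast
qed

text \<open>The integral of \<open>f x * g s\<close> over the plane is cut along the diagonal into
  the half planes \<open>s \<le> x\<close> and \<open>x < s\<close>. In each of them one integration
  produces an indefinite integral, so this is integration by parts with base points at
  infinity.\<close>

lemma lborel_double_integral_split:
  fixes f g :: "real \<Rightarrow> complex"
  assumes f: "integrable lborel f" and g: "integrable lborel g"
  shows "(LINT x|lborel. f x * (LINT s|lborel. indicat_real {..x} s *\<^sub>R g s)) +
      (LINT s|lborel. (LINT x|lborel. indicat_real {..<s} x *\<^sub>R f x) * g s) =
      integral\<^sup>L lborel f * integral\<^sup>L lborel g"
proof -
  have [measurable]: "f \<in> borel_measurable borel" "g \<in> borel_measurable borel"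
    using f g by auto
  have ifg: "integrable (lborel \<Otimes>\<^sub>M lborel) (\<lambda>(x, s). f x * g s)"
  proof (rule lborel_pair.Fubini_integrable)
    show "integrable lborel (\<lambda>x. LINT y|lborel. norm (case (x, y) of (x, s) \<Rightarrow> f x * g s))"
      using f by (simp add: norm_mult)
  qed (use f g in auto)
  define P where "P x s = indicat_real {..x} s *\<^sub>R (f x * g s)" for x s
  define Q where "Q x s = indicat_real {..<s} x *\<^sub>R (f x * g s)" for x s
  have [measurable]: "{(x, s). s \<le> x} \<in> sets (lborel \<Otimes>\<^sub>M (lborel :: real measure))"
    "{(x, s). x < s} \<in> sets (lborel \<Otimes>\<^sub>M (lborel :: real measure))"
  proof -
    have "{z \<in> space (lborel \<Otimes>\<^sub>M (lborel :: real measure)). snd z \<le> fst z} \<in> sets (lborel \<Otimes>\<^sub>M (lborel :: real measure))"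
      "{z \<in> space (lborel \<Otimes>\<^sub>M (lborel :: real measure)). fst z < snd z} \<in> sets (lborel \<Otimes>\<^sub>M (lborel :: real measure))"
      by measurable
    then show "{(x, s). s \<le> x} \<in> sets (lborel \<Otimes>\<^sub>M (lborel :: real measure))"
      "{(x, s). x < s} \<in> sets (lborel \<Otimes>\<^sub>M (lborel :: real measure))"
      by (simp_all add: space_pair_measure case_prod_unfold)
  qed
  have iP: "integrable (lborel \<Otimes>\<^sub>M lborel) (\<lambda>(x, s). P x s)"
  proof -
    have "integrable (lborel \<Otimes>\<^sub>M lborel) (\<lambda>z. indicat_real {(x, s). s \<le> x} z *\<^sub>R (case z of (x, s) \<Rightarrow> f x * g s))"
      by (rule integrable_mult_indicator[OF _ ifg]) measurable
    also have "(\<lambda>z. indicat_real {(x, s). s \<le> x} z *\<^sub>R (case z of (x, s) \<Rightarrow> f x * g s)) = (\<lambda>(x, s). P x s)"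
      by (auto simp: P_def indicator_def)
    finally show ?thesis .
  qed
  have iQ: "integrable (lborel \<Otimes>\<^sub>M lborel) (\<lambda>(x, s). Q x s)"
  proof -
    have "integrable (lborel \<Otimes>\<^sub>M lborel) (\<lambda>z. indicat_real {(x, s). x < s} z *\<^sub>R (case z of (x, s) \<Rightarrow> f x * g s))"
      by (rule integrable_mult_indicator[OF _ ifg]) measurable
    also have "(\<lambda>z. indicat_real {(x, s). x < s} z *\<^sub>R (case z of (x, s) \<Rightarrow> f x * g s)) = (\<lambda>(x, s). Q x s)"
      by (auto simp: Q_def indicator_def)
    finally show ?thesis .
  qed
  have "(LINT x|lborel. f x * (LINT s|lborel. indicat_real {..x} s *\<^sub>R g s)) = (LINT x|lborel. LINT s|lborel. P x s)"
    unfolding P_def by (intro Bochner_Integration.integral_cong refl)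
      (simp flip: integral_mult_right_zero mult_scaleR_right)
  moreover have "(LINT s|lborel. (LINT x|lborel. indicat_real {..<s} x *\<^sub>R f x) * g s) = (LINT s|lborel. LINT x|lborel. Q x s)"
    unfolding Q_def by (intro Bochner_Integration.integral_cong refl)
      (simp flip: integral_mult_left_zero mult_scaleR_left)
  moreover have "(LINT s|lborel. LINT x|lborel. Q x s) = (LINT x|lborel. LINT s|lborel. Q x s)"
    using lborel_pair.Fubini_integral[OF iQ] .
  moreover have "(LINT x|lborel. LINT s|lborel. P x s) + (LINT x|lborel. LINT s|lborel. Q x s) =
      (LINT x|lborel. LINT s|lborel. f x * g s)"
  proof -
    have "(LINT z|(lborel \<Otimes>\<^sub>M lborel). (case z of (x, s) \<Rightarrow> P x s)) + (LINT z|(lborel \<Otimes>\<^sub>M lborel). (case z of (x, s) \<Rightarrow> Q x s)) =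
        (LINT z|(lborel \<Otimes>\<^sub>M lborel). (case z of (x, s) \<Rightarrow> f x * g s))"
      by (subst Bochner_Integration.integral_add[OF iP iQ, symmetric], rule Bochner_Integration.integral_cong)
        (auto simp: P_def Q_def indicator_def)
    then show ?thesis
      using lborel_pair.integral_fst[OF iP] lborel_pair.integral_fst[OF iQ] lborel_pair.integral_fst[OF ifg] by simp
  qed
  moreover have "(LINT x|lborel. LINT s|lborel. f x * g s) = integral\<^sup>L lborel f * integral\<^sup>L lborel g"
    by simp
  ultimately show ?thesis by simp
qed

text \<open>On \<open>[a, b]\<close> each factor equals its value at \<open>a\<close> plus an
  indefinite integral. Multiplying out leaves terms with constants and a pair of double integrals
  that the diagonal split evaluates; no pointwise derivative of \<open>F\<close> or \<open>G\<close>
  appears.\<close>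

lemma primitive_mult:
  assumes "primitive F f" "primitive G g"
  shows "primitive (\<lambda>x. F x * G x) (\<lambda>x. f x * G x + F x * g x)"
  unfolding primitive_def
proof (intro conjI allI impI)
  note F = primitiveD[OF assms(1)] and G = primitiveD[OF assms(2)]
  have lfG: "locally_integrable (\<lambda>x. f x * G x)"
    using locally_integrable_mult_continuous'[OF F(1) primitive_continuous[OF assms(2)]] .
  have lFg: "locally_integrable (\<lambda>x. F x * g x)"
    using locally_integrable_mult_continuous[OF G(1) primitive_continuous[OF assms(1)]] .
  show "locally_integrable (\<lambda>x. f x * G x + F x * g x)"
    using lfG lFg by (rule locally_integrable_add)
  have [measurable]: "F \<in> borel_measurable borel" "G \<in> borel_measurable borel"
    using assms[THEN primitive_continuous] by (auto intro: borel_measurable_continuous_onI)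
  have [measurable]: "F \<in> borel_measurable lebesgue" "G \<in> borel_measurable lebesgue"
    by (auto intro: measurable_completion)
  have [measurable]: "f \<in> borel_measurable lebesgue" "g \<in> borel_measurable lebesgue"
    using F(1) G(1) by (auto intro: locally_integrable_measurable)
  fix a b :: real assume "a \<le> b"
  \<comment> \<open>\<open>f1\<close> and \<open>g1\<close> represent the densities cut off outside
    \<open>[a, b]\<close>, so that integrals over \<open>{..x}\<close> really start at
    \<open>a\<close>.\<close>
  obtain f1 where f1: "integrable lborel f1" "AE x in lebesgue. indicat_real {a..b} x *\<^sub>R f x = f1 x"
    using integrable_borel_representative locally_integrableD[OF F(1), of a b]
    unfolding set_integrable_def by blast
  obtain g1 where g1: "integrable lborel g1" "AE x in lebesgue. indicat_real {a..b} x *\<^sub>R g x = g1 x"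
    using integrable_borel_representative locally_integrableD[OF G(1), of a b]
    unfolding set_integrable_def by blast
  have [measurable]: "f1 \<in> borel_measurable borel" "g1 \<in> borel_measurable borel"
    using f1(1) g1(1) by auto
  have to_lborel: "(LINT x|lebesgue. h x) = (LINT x|lborel. h' x)"
    if "h \<in> borel_measurable lebesgue" "h' \<in> borel_measurable borel" "AE x in lebesgue. h x = h' x"
    for h h' :: "real \<Rightarrow> complex"
    using integral_cong_AE[OF that(1) measurable_completion that(3)] integral_completion[of h' lborel] that(2)
    by simp
  have Gx: "G x = G a + (LINT s|lborel. indicat_real {..x} s *\<^sub>R g1 s)" if "x \<in> {a..b}" for x
  proof -
    have "AE s in lebesgue. indicat_real {a..x} s *\<^sub>R g s = indicat_real {..x} s *\<^sub>R g1 s"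
      using g1(2) by eventually_elim (use that in \<open>auto simp: indicator_def split: if_splits\<close>)
    then have "(LINT s:{a..x}|lebesgue. g s) = (LINT s|lborel. indicat_real {..x} s *\<^sub>R g1 s)"
      unfolding set_lebesgue_integral_def by (intro to_lborel) measurable
    with G(2)[of a x] that show ?thesis by (simp add: algebra_simps)
  qed
  \<comment> \<open>Strict \<open>{..<x}\<close> here against \<open>{..x}\<close> for
    \<open>G\<close>: the two half planes of the diagonal split must be disjoint.\<close>
  have Fx: "F x = F a + (LINT s|lborel. indicat_real {..<x} s *\<^sub>R f1 s)" if "x \<in> {a..b}" for x
  proof -
    have "AE s in lebesgue. s \<noteq> x"
      using AE_completion[OF AE_lborel_singleton] .
    with f1(2) have "AE s in lebesgue. indicat_real {a..x} s *\<^sub>R f s = indicat_real {..<x} s *\<^sub>R f1 s"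
      by eventually_elim (use that in \<open>auto simp: indicator_def split: if_splits\<close>)
    then have "(LINT s:{a..x}|lebesgue. f s) = (LINT s|lborel. indicat_real {..<x} s *\<^sub>R f1 s)"
      unfolding set_lebesgue_integral_def by (intro to_lborel) measurable
    with F(2)[of a x] that show ?thesis by (simp add: algebra_simps)
  qed
  have m1: "(\<lambda>x. LINT s|lborel. indicat_real {..x} s *\<^sub>R g1 s) \<in> borel_measurable borel" (is "?g2 \<in> _")
    unfolding indicator_def atMost_def mem_Collect_eq
    by (rule lborel.borel_measurable_lebesgue_integral) measurable
  have m2: "(\<lambda>x. LINT s|lborel. indicat_real {..<x} s *\<^sub>R f1 s) \<in> borel_measurable borel" (is "?f2 \<in> _")
    unfolding indicator_def lessThan_def mem_Collect_eq
    by (rule lborel.borel_measurable_lebesgue_integral) measurable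
  have e1: "(LINT x:{a..b}|lebesgue. f x * G x) = (LINT x|lborel. f1 x * (G a + ?g2 x))"
    unfolding set_lebesgue_integral_def
  proof (rule to_lborel)
    show "AE x in lebesgue. indicat_real {a..b} x *\<^sub>R (f x * G x) = f1 x * (G a + ?g2 x)"
      using f1(2)
    proof eventually_elim
      case (elim x)
      show ?case
        using elim Gx[of x] by (cases "x \<in> {a..b}") auto
    qed
    show "(\<lambda>x. indicat_real {a..b} x *\<^sub>R (f x * G x)) \<in> borel_measurable lebesgue"
      by (intro borel_measurable_indicator_interval borel_measurable_times; measurable)
    show "(\<lambda>x. f1 x * (G a + ?g2 x)) \<in> borel_measurable borel"
      by (intro borel_measurable_times borel_measurable_add m1; measurable)
  qed
  have e2: "(LINT x:{a..b}|lebesgue. F x * g x) = (LINT x|lborel. (F a + ?f2 x) * g1 x)"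
    unfolding set_lebesgue_integral_def
  proof (rule to_lborel)
    show "AE x in lebesgue. indicat_real {a..b} x *\<^sub>R (F x * g x) = (F a + ?f2 x) * g1 x"
      using g1(2)
    proof eventually_elim
      case (elim x)
      show ?case
        using elim Fx[of x] by (cases "x \<in> {a..b}") auto
    qed
    show "(\<lambda>x. indicat_real {a..b} x *\<^sub>R (F x * g x)) \<in> borel_measurable lebesgue"
      by (intro borel_measurable_indicator_interval borel_measurable_times; measurable)
    show "(\<lambda>x. (F a + ?f2 x) * g1 x) \<in> borel_measurable borel"
      by (intro borel_measurable_times borel_measurable_add m2; measurable)
  qed
  have If: "integral\<^sup>L lborel f1 = F b - F a" and Ig: "integral\<^sup>L lborel g1 = G b - G a"
    using \<open>a \<le> b\<close> F(2) G(2) f1(2) g1(2)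
    by (auto simp: set_lebesgue_integral_def intro!: to_lborel[symmetric])
  \<comment> \<open>The inner integrals are bounded by the L1 norms of the densities, uniformly in
    the outer variable. This makes the products integrable, so that the sums below may be
    split.\<close>
  have b: "cmod (LINT s|lborel. indicat_real (A x) s *\<^sub>R h s) \<le> (LINT s|lborel. cmod (h s))"
    if "integrable lborel h" "\<And>x. A x \<in> sets borel" for h :: "real \<Rightarrow> complex" and A :: "real \<Rightarrow> real set" and x
    using that by (intro order_trans[OF integral_norm_bound] integral_mono integrable_norm integrable_mult_indicator)
      (auto simp: indicator_def)
  have i1: "integrable lborel (\<lambda>x. f1 x * ?g2 x)"
    by (rule Bochner_Integration.integrable_bound[OF integrable_mult_right[OF f1(1), of "of_real (LINT s|lborel. cmod (g1 s))"]])
      (use m1 b[OF g1(1), of "\<lambda>x. {..x}"] in \<open>auto intro!: AE_I2 simp: norm_mult mult.commute intro!: mult_right_mono mult_left_mono order_trans[OF _ abs_ge_self]\<close>)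
  have i2: "integrable lborel (\<lambda>x. ?f2 x * g1 x)"
    by (rule Bochner_Integration.integrable_bound[OF integrable_mult_right[OF g1(1), of "of_real (LINT s|lborel. cmod (f1 s))"]])
      (use m2 b[OF f1(1), of "\<lambda>x. {..<x}"] in \<open>auto intro!: AE_I2 simp: norm_mult mult.commute intro!: mult_right_mono mult_left_mono order_trans[OF _ abs_ge_self]\<close>)
  have "(LINT x:{a..b}|lebesgue. f x * G x + F x * g x) =
      (LINT x|lborel. f1 x * (G a + ?g2 x)) + (LINT x|lborel. (F a + ?f2 x) * g1 x)"
    using locally_integrableD[OF lfG] locally_integrableD[OF lFg] e1 e2 by simp
  also have "\<dots> = G a * integral\<^sup>L lborel f1 + F a * integral\<^sup>L lborel g1 +
      ((LINT x|lborel. f1 x * ?g2 x) + (LINT x|lborel. ?f2 x * g1 x))"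
    using f1(1) g1(1) i1 i2 by (simp add: distrib_left distrib_right mult.commute)
  also have "\<dots> = F b * G b - F a * G a"
    unfolding lborel_double_integral_split[OF f1(1) g1(1)] If Ig by (simp add: algebra_simps)
  finally show "F b * G b - F a * G a = (LINT x:{a..b}|lebesgue. f x * G x + F x * g x)" ..
qed

section \<open>Test functions and the fundamental lemma\<close>

abbreviation vderiv :: "(real \<Rightarrow> complex) \<Rightarrow> real \<Rightarrow> complex" where
  "vderiv f \<equiv> (\<lambda>y. vector_derivative f (at y))"

section \<open>Smooth functions\<close>

definition smooth :: "(real \<Rightarrow> complex) \<Rightarrow> bool" where
  "smooth f \<longleftrightarrow> (\<forall>n x. ((\<lambda>f. vderiv f) ^^ n) f differentiable at x)"

lemma test_function_iff: "test_function \<phi> \<longleftrightarrow> smooth \<phi> \<and> bounded {x. \<phi> x \<noteq> 0}"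
  by (simp add: test_function_def smooth_def compact_closure)

text \<open>Membership in a class closed under differentiation yields all iterated derivatives at
  once, so a smoothness proof only has to name such a class and never computes a higher
  derivative.\<close>

lemma smooth_coinduct:
  assumes "f \<in> S" and step: "\<And>f. f \<in> S \<Longrightarrow> \<exists>f'\<in>S. \<forall>x. (f has_vector_derivative f' x) (at x)"
  shows "smooth f"
proof -
  have "((\<lambda>f. vderiv f) ^^ n) f \<in> S" if "f \<in> S" for n
    using that
  proof (induction n)
    case (Suc n)
    then obtain f' where "f' \<in> S" "\<And>x. (((\<lambda>f. vderiv f) ^^ n) f has_vector_derivative f' x) (at x)"
      using step by blast
    moreover from this have "vderiv (((\<lambda>f. vderiv f) ^^ n) f) = f'"
      by (auto simp: vector_derivative_at)
    ultimately show ?case by simp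
  qed simp
  then show ?thesis
    unfolding smooth_def using step \<open>f \<in> S\<close> differentiableI_vector by blast
qed

lemma smooth_has_vector_derivative:
  assumes "smooth f"
  shows "(f has_vector_derivative vderiv f x) (at x)"
proof -
  have "((\<lambda>f. vderiv f) ^^ 0) f differentiable at x"
    using assms unfolding smooth_def by blast
  then show ?thesis by (simp add: vector_derivative_works)
qed

lemma smooth_vderiv:
  assumes "smooth f"
  shows "smooth (vderiv f)"
  unfolding smooth_def
proof (intro allI)
  fix n x
  have "((\<lambda>f. vderiv f) ^^ Suc n) f differentiable at x"
    using assms unfolding smooth_def by blast
  then show "((\<lambda>f. vderiv f) ^^ n) (vderiv f) differentiable at x"
    by (simp only: funpow_Suc_right comp_def)
qed

lemma smooth_continuous: "smooth f \<Longrightarrow> continuous_on S f"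
  using smooth_has_vector_derivative
  by (intro continuous_at_imp_continuous_on ballI has_vector_derivative_continuous) blast

lemma smooth_lincomb:
  assumes "smooth f" "smooth g"
  shows "smooth (\<lambda>x. a * f x + b * g x)"
proof (rule smooth_coinduct[where S="{\<lambda>x. a * f x + b * g x | f g. smooth f \<and> smooth g}"])
  fix h assume "h \<in> {\<lambda>x. a * f x + b * g x | f g. smooth f \<and> smooth g}"
  then obtain f g where h: "h = (\<lambda>x. a * f x + b * g x)" and fg: "smooth f" "smooth g" by blast
  show "\<exists>h'\<in>{\<lambda>x. a * f x + b * g x | f g. smooth f \<and> smooth g}. \<forall>x. (h has_vector_derivative h' x) (at x)"
  proof (intro bexI allI)
    show "(h has_vector_derivative a * vderiv f x + b * vderiv g x) (at x)" for x
      unfolding h using fg by (intro has_vector_derivative_add has_vector_derivative_mult_right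
          smooth_has_vector_derivative)
    show "(\<lambda>x. a * vderiv f x + b * vderiv g x) \<in> {\<lambda>x. a * f x + b * g x | f g. smooth f \<and> smooth g}"
      by (intro CollectI exI[of _ "vderiv f"] exI[of _ "vderiv g"] conjI refl fg[THEN smooth_vderiv])
  qed
qed (use assms in blast)

lemma smooth_cnj:
  assumes "smooth f"
  shows "smooth (\<lambda>x. cnj (f x))"
proof (rule smooth_coinduct[where S="{\<lambda>x. cnj (f x) | f. smooth f}"])
  fix h assume "h \<in> {\<lambda>x. cnj (f x) | f. smooth f}"
  then obtain f where h: "h = (\<lambda>x. cnj (f x))" and f: "smooth f" by blast
  show "\<exists>h'\<in>{\<lambda>x. cnj (f x) | f. smooth f}. \<forall>x. (h has_vector_derivative h' x) (at x)"
  proof (intro bexI allI)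
    show "(h has_vector_derivative cnj (vderiv f x)) (at x)" for x
      unfolding h using f by (intro has_vector_derivative_cnj smooth_has_vector_derivative)
    show "(\<lambda>x. cnj (vderiv f x)) \<in> {\<lambda>x. cnj (f x) | f. smooth f}"
      by (intro CollectI exI[of _ "vderiv f"] conjI refl f[THEN smooth_vderiv])
  qed
qed (use assms in blast)

section \<open>Smooth bump functions built from exp(-1/x)\<close>

definition flat :: "nat \<Rightarrow> real \<Rightarrow> real" where
  "flat k x = (if 0 < x then exp (- inverse x) * inverse x ^ k else 0)"

lemma flat_tendsto_0: "(flat k \<longlongrightarrow> 0) (at 0)"
proof (rule filterlim_split_at)
  show "(flat k \<longlongrightarrow> 0) (at_left 0)"
    by (rule Lim_transform_eventually[OF tendsto_const])
      (auto simp: eventually_at_filter flat_def)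
  have "((\<lambda>x::real. (inverse x) ^ k / exp (inverse x)) \<longlongrightarrow> 0) (at_right 0)"
    by (rule filterlim_compose[OF tendsto_power_div_exp_0 filterlim_inverse_at_top_right])
  then show "(flat k \<longlongrightarrow> 0) (at_right 0)"
    by (rule Lim_transform_eventually)
      (auto simp: eventually_at_filter flat_def exp_minus field_simps)
qed

text \<open>The powers of \<open>inverse x\<close> close the family under differentiation:
  differentiating the exponential adds two powers, differentiating the power adds one. For
  \<open>k = 0\<close> this is the classical smooth function that vanishes to infinite order at
  0.\<close>

lemma flat_has_derivative:
  "(flat k has_real_derivative flat (k + 2) x - real k * flat (k + 1) x) (at x)"
proof -
  consider "x > 0" | "x < 0" | "x = 0" by linarith
  then show ?thesis
  proof cases
    case 1
    have "((\<lambda>x. exp (- inverse x) * inverse x ^ k) has_real_derivative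
        (exp (- inverse x) * (inverse x * inverse x)) * inverse x ^ k
        + exp (- inverse x) * (real k * inverse x ^ (k - 1) * (- (inverse x * inverse x)))) (at x)"
      using 1 by (auto intro!: derivative_eq_intros simp: power2_eq_square)
    also have "(exp (- inverse x) * (inverse x * inverse x)) * inverse x ^ k
        + exp (- inverse x) * (real k * inverse x ^ (k - 1) * (- (inverse x * inverse x))) =
        flat (k + 2) x - real k * flat (k + 1) x"
      using 1 by (cases k) (simp_all add: flat_def algebra_simps)
    finally show ?thesis
      by (rule has_field_derivative_transform_within_open[of _ _ _ "{0<..}"])
        (use 1 in \<open>auto simp: flat_def\<close>)
  next
    case 2
    have "((\<lambda>_. 0) has_real_derivative 0) (at x)" by simp
    then have "(flat k has_real_derivative 0) (at x)"
      by (rule has_field_derivative_transform_within_open[of _ _ _ "{..<0}"])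
        (use 2 in \<open>auto simp: flat_def\<close>)
    then show ?thesis using 2 by (simp add: flat_def)
  next
    case 3
    \<comment> \<open>At 0 the difference quotient stays in the family: division by \<open>h\<close>
      raises the index by one, and every \<open>flat\<close> tends to 0.\<close>
    have "(\<lambda>h. (flat k (0 + h) - flat k 0) / h) = flat (k + 1)"
      by (auto simp: flat_def field_simps)
    then have "(flat k has_real_derivative 0) (at 0)"
      using flat_tendsto_0 unfolding DERIV_def by simp
    then show ?thesis using 3 by (simp add: flat_def)
  qed
qed

text \<open>Sums and products are included so that the product rule stays inside the class; it is
  the invariant class handed to \<open>smooth_coinduct\<close>.\<close>

inductive_set flat_algebra :: "(real \<Rightarrow> complex) set" where
  flat: "(\<lambda>x. of_real (flat k (c * x + d))) \<in> flat_algebra"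
| const: "(\<lambda>x. z) \<in> flat_algebra"
| add: "f \<in> flat_algebra \<Longrightarrow> g \<in> flat_algebra \<Longrightarrow> (\<lambda>x. f x + g x) \<in> flat_algebra"
| mult: "f \<in> flat_algebra \<Longrightarrow> g \<in> flat_algebra \<Longrightarrow> (\<lambda>x. f x * g x) \<in> flat_algebra"

lemma flat_algebra_smooth:
  assumes "f \<in> flat_algebra"
  shows "smooth f"
  using assms
proof (rule smooth_coinduct)
  fix f assume "f \<in> flat_algebra"
  then show "\<exists>f'\<in>flat_algebra. \<forall>x. (f has_vector_derivative f' x) (at x)"
  proof induction
    case (flat k c d)
    let ?f' = "\<lambda>x. complex_of_real c * (of_real (flat (k + 2) (c * x + d)) + of_real (- real k) * of_real (flat (k + 1) (c * x + d)))"
    have "((\<lambda>x. complex_of_real (flat k (c * x + d))) has_vector_derivative ?f' x) (at x)" for x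
    proof -
      have "((\<lambda>x. flat k (c * x + d)) has_real_derivative
          (flat (k + 2) (c * x + d) - real k * flat (k + 1) (c * x + d)) * c) (at x)"
        by (rule DERIV_chain2[OF flat_has_derivative]) (auto intro!: derivative_eq_intros)
      then have "((\<lambda>x. complex_of_real (flat k (c * x + d))) has_vector_derivative
          of_real ((flat (k + 2) (c * x + d) - real k * flat (k + 1) (c * x + d)) * c)) (at x)"
        by (intro has_vector_derivative_of_real) (simp add: has_real_derivative_iff_has_vector_derivative)
      then show ?thesis by (simp add: mult.commute)
    qed
    moreover have "?f' \<in> flat_algebra"
      by (intro flat_algebra.intros)
    ultimately show ?case by (intro bexI[of _ ?f'] allI)
  next
    case (const z)
    then show ?case by (intro bexI[of _ "\<lambda>x. 0"]) (auto intro: flat_algebra.intros)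
  next
    case (add f g)
    then obtain f' g' where "f' \<in> flat_algebra" "g' \<in> flat_algebra"
      "\<And>x. (f has_vector_derivative f' x) (at x)" "\<And>x. (g has_vector_derivative g' x) (at x)"
      by blast
    then show ?case
      by (intro bexI[of _ "\<lambda>x. f' x + g' x"])
        (auto intro: flat_algebra.intros has_vector_derivative_add)
  next
    case (mult f g)
    then obtain f' g' where "f' \<in> flat_algebra" "g' \<in> flat_algebra"
      "\<And>x. (f has_vector_derivative f' x) (at x)" "\<And>x. (g has_vector_derivative g' x) (at x)"
      by blast
    with mult show ?case
      by (intro bexI[of _ "\<lambda>x. f x * g' x + f' x * g x"])
        (auto intro: flat_algebra.intros has_vector_derivative_mult)
  qed
qed

text \<open>A product of flat functions of \<open>c * (x - a)\<close> and
  \<open>c * (b - x)\<close>, hence positive exactly on the open interval when \<open>c > 0\<close>.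
  As \<open>c\<close> grows both factors tend to 1 there, so the bumps approximate the indicator
  from below.\<close>

definition bump :: "real \<Rightarrow> real \<Rightarrow> real \<Rightarrow> real \<Rightarrow> real" where
  "bump a b c x = flat 0 (c * x + - c * a) * flat 0 (- c * x + c * b)"

lemma bump_test_function:
  assumes "c > 0"
  shows "test_function (\<lambda>x. of_real (bump a b c x))"
  unfolding test_function_iff
proof
  have "(\<lambda>x. of_real (flat 0 (c * x + - c * a)) * of_real (flat 0 (- c * x + c * b))) \<in> flat_algebra"
    by (intro flat_algebra.intros)
  then show "smooth (\<lambda>x. of_real (bump a b c x))"
    unfolding bump_def of_real_mult by (rule flat_algebra_smooth)
  have "{x. complex_of_real (bump a b c x) \<noteq> 0} \<subseteq> {a..b}"
    using assms by (auto simp: bump_def flat_def field_simps split: if_splits)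
  then show "bounded {x. complex_of_real (bump a b c x) \<noteq> 0}"
    using bounded_closed_interval bounded_subset by blast
qed

lemma bump_nonneg: "0 \<le> bump a b c x"
  and bump_le_1: "bump a b c x \<le> 1"
  and bump_eq_0: "c > 0 \<Longrightarrow> x \<notin> {a<..<b} \<Longrightarrow> bump a b c x = 0"
  and bump_pos: "c > 0 \<Longrightarrow> x \<in> {a<..<b} \<Longrightarrow> 0 < bump a b c x"
proof -
  have *: "0 \<le> flat 0 y" "flat 0 y \<le> 1" for y by (auto simp: flat_def)
  show "0 \<le> bump a b c x" "bump a b c x \<le> 1"
    using * by (auto simp: bump_def intro: mult_le_one)
  show "c > 0 \<Longrightarrow> x \<notin> {a<..<b} \<Longrightarrow> bump a b c x = 0" "c > 0 \<Longrightarrow> x \<in> {a<..<b} \<Longrightarrow> 0 < bump a b c x"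
    by (auto simp: bump_def flat_def)
qed

lemma bump_tendsto_indicator:
  "(\<lambda>n. bump a b (real n + 1) x) \<longlonglongrightarrow> indicator {a<..<b} x"
proof (cases "x \<in> {a<..<b}")
  case False
  then show ?thesis by (simp add: bump_eq_0)
next
  case True
  have *: "(\<lambda>n. flat 0 ((real n + 1) * y)) \<longlonglongrightarrow> 1" if "y > 0" for y
  proof -
    have "(\<lambda>n. exp (- (inverse (real (Suc n)) * inverse y))) \<longlonglongrightarrow> exp (- (0 * inverse y))"
      by (intro tendsto_intros LIMSEQ_inverse_real_of_nat)
    then show ?thesis using that by (simp add: flat_def add.commute)
  qed
  have "(\<lambda>n. flat 0 ((real n + 1) * (x - a)) * flat 0 ((real n + 1) * (b - x))) \<longlonglongrightarrow> 1 * 1"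
    using True by (intro tendsto_mult *) auto
  then show ?thesis using True by (simp add: bump_def algebra_simps)
qed

section \<open>Functions determined by their integrals\<close>

lemma integrable_bounded_support:
  assumes f: "locally_integrable f" and supp: "\<And>x. x \<notin> {a..b} \<Longrightarrow> f x = 0"
  shows "integrable lebesgue f"
proof -
  have "(\<lambda>x. indicat_real {a..b} x *\<^sub>R f x) = f" using supp by (auto simp: indicator_def)
  then show ?thesis using locally_integrableD[OF f, of a b] by (simp add: set_integrable_def)
qed

text \<open>Intervals are stable under intersection and generate the Borel sets, so vanishing
  integrals spread to all Borel sets by Dynkin's argument. The complement step needs the integral
  over the whole line, obtained as a limit over \<open>[-n, n]\<close>.\<close>

lemma integrable_zero_intervals:
  fixes f :: "real \<Rightarrow> complex"
  assumes f: "integrable lebesgue f" and z: "\<And>a b. (LINT x:{a..b}|lebesgue. f x) = 0"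
  shows "AE x in lebesgue. f x = 0"
proof -
  obtain g where g: "integrable lborel g" "AE x in lebesgue. f x = g x"
    using integrable_borel_representative[OF f] by blast
  have [measurable]: "g \<in> borel_measurable borel" using g(1) by simp
  have gint: "set_integrable lborel A g" if "A \<in> sets borel" for A
    using g(1) that unfolding set_integrable_def by (intro integrable_mult_indicator) auto
  have box: "(LINT x:{a..b}|lborel. g x) = 0" for a b
  proof -
    have "(LINT x:{a..b}|lborel. g x) = (LINT x:{a..b}|lebesgue. g x)"
      unfolding set_lebesgue_integral_def by (rule integral_completion[symmetric]) simp
    also have "\<dots> = (LINT x:{a..b}|lebesgue. f x)"
      unfolding set_lebesgue_integral_def
      using f g(2) by (intro integral_cong_AE borel_measurable_indicator_interval) (auto intro: measurable_completion)
    finally show ?thesis using z by simp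
  qed
  have UN: "(LINT x:(\<Union>i::nat. A i)|lborel. g x) = 0"
    if "disjoint_family A" "\<And>i. A i \<in> sets borel" "\<And>i. (LINT x:A i|lborel. g x) = 0" for A
    using that by (subst lebesgue_integral_countable_add) (auto intro!: gint simp: disjoint_family_on_def)
  have total: "(LINT x:UNIV|lborel. g x) = 0"
  proof -
    have "(\<lambda>n. (LINT x:{- real n..real n}|lborel. g x)) \<longlonglongrightarrow> (LINT x:(\<Union>n. {- real n..real n})|lborel. g x)"
      by (rule set_integral_cont_up) (auto intro!: gint simp: incseq_def)
    moreover have "(\<Union>n. {- real n..real n}) = UNIV"
    proof (intro set_eqI iffI UNIV_I)
      fix x :: real
      obtain n where "\<bar>x\<bar> \<le> real n" using real_arch_simple by blast
      then show "x \<in> (\<Union>n. {- real n..real n})" by (auto intro!: exI[of _ n])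
    qed
    ultimately show ?thesis by (simp only: box LIMSEQ_const_iff)
  qed
  have "(LINT x:A|lborel. g x) = 0" if "A \<in> sets borel" for A
  proof -
    have "Int_stable (range (\<lambda>(a, b). {a..b::real}))"
      by (auto simp: Int_stable_def)
    moreover have "range (\<lambda>(a, b). {a..b::real}) \<subseteq> Pow UNIV" by simp
    moreover have "A \<in> sigma_sets UNIV (range (\<lambda>(a, b). {a..b::real}))"
      using that unfolding borel_eq_atLeastAtMost by simp
    ultimately show ?thesis
    proof (induction rule: sigma_sets_induct_disjoint)
      case (compl A)
      have A: "A \<in> sets borel" using compl(1) unfolding borel_eq_atLeastAtMost by simp
      have "(LINT x:A \<union> (UNIV - A)|lborel. g x) = (LINT x:A|lborel. g x) + (LINT x:UNIV - A|lborel. g x)"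
        using A by (intro set_integral_Un gint) auto
      then show ?case using compl total by simp
    next
      case (union A)
      then show ?case
        by (intro UN) (auto simp: borel_eq_atLeastAtMost)
    qed (use box in \<open>auto simp: set_lebesgue_integral_def\<close>)
  qed
  then have "AE x in lborel. g x = 0"
    by (intro sigma_finite_measure.density_zero[OF sigma_finite_lborel] g(1)) auto
  then have "AE x in lebesgue. g x = 0" by (rule AE_completion)
  with g(2) show ?thesis by eventually_elim simp
qed

lemma locally_integrable_zero_intervals:
  assumes f: "locally_integrable f" and z: "\<And>a b. (LINT x:{a..b}|lebesgue. f x) = 0"
  shows "AE x in lebesgue. f x = 0"
proof -
  have "AE x in lebesgue. indicat_real {- real n..real n} x *\<^sub>R f x = 0" for n :: nat
  proof (rule integrable_zero_intervals)
    show "integrable lebesgue (\<lambda>x. indicat_real {- real n..real n} x *\<^sub>R f x)"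
      using locally_integrableD[OF f] by (simp add: set_integrable_def)
    \<comment> \<open>Cutting off at \<open>n\<close> turns an interval into another interval, so
      the hypothesis still applies.\<close>
    have "indicat_real {a..b} x *\<^sub>R indicat_real {- real n..real n} x *\<^sub>R f x =
        indicat_real {max a (- real n)..min b (real n)} x *\<^sub>R f x" for a b x
      by (auto simp: indicator_def)
    then show "(LINT x:{a..b}|lebesgue. indicat_real {- real n..real n} x *\<^sub>R f x) = 0" for a b
      using z unfolding set_lebesgue_integral_def by presburger
  qed
  then have "AE x in lebesgue. \<forall>n::nat. indicat_real {- real n..real n} x *\<^sub>R f x = 0"
    by (intro AE_all_countable[THEN iffD2] allI)
  then show ?thesis
  proof eventually_elim
    case (elim x)
    obtain N where "\<bar>x\<bar> \<le> real N" using real_arch_simple by blast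
    then show ?case using elim[rule_format, of N] by (auto simp: indicator_def)
  qed
qed

text \<open>Bumps over a fixed interval stay below 1 and converge pointwise to the indicator of its
  interior, so dominated convergence turns vanishing against test functions into vanishing over
  intervals.\<close>

lemma fundamental_lemma:
  assumes f: "locally_integrable f"
    and z: "\<And>\<phi>. test_function \<phi> \<Longrightarrow> (LINT x|lebesgue. f x * \<phi> x) = 0"
  shows "AE x in lebesgue. f x = 0"
proof (rule locally_integrable_zero_intervals[OF f])
  fix a b
  have [measurable]: "f \<in> borel_measurable lebesgue"
    by (rule locally_integrable_measurable[OF f])
  have m: "(\<lambda>x. complex_of_real (bump a b (real n + 1) x)) \<in> borel_measurable lebesgue" for n
  proof -
    have "continuous_on UNIV (\<lambda>x. complex_of_real (bump a b (real n + 1) x))"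
      using bump_test_function[of "real n + 1" a b]
      by (intro smooth_continuous) (simp only: test_function_iff of_nat_0_le_iff add_nonneg_pos zero_less_one)
    then show ?thesis
      by (intro measurable_completion) (simp add: borel_measurable_continuous_onI)
  qed
  have "(\<lambda>n. LINT x|lebesgue. f x * of_real (bump a b (real n + 1) x)) \<longlonglongrightarrow>
      (LINT x|lebesgue. indicat_real {a<..<b} x *\<^sub>R f x)"
  proof (rule integral_dominated_convergence[where w="\<lambda>x. cmod (indicat_real {a..b} x *\<^sub>R f x)"])
    show "(\<lambda>x. f x * of_real (bump a b (real n + 1) x)) \<in> borel_measurable lebesgue" for n
      using m[of n] by measurable
    show "integrable lebesgue (\<lambda>x. cmod (indicat_real {a..b} x *\<^sub>R f x))"
      using locally_integrableD[OF f] unfolding set_integrable_def by (rule integrable_norm)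
    show "AE x in lebesgue. (\<lambda>n. f x * of_real (bump a b (real n + 1) x)) \<longlonglongrightarrow> indicat_real {a<..<b} x *\<^sub>R f x"
    proof (intro AE_I2)
      fix x
      have "(\<lambda>n. f x * of_real (bump a b (real n + 1) x)) \<longlonglongrightarrow> f x * of_real (indicator {a<..<b} x)"
        by (intro tendsto_intros bump_tendsto_indicator)
      then show "(\<lambda>n. f x * of_real (bump a b (real n + 1) x)) \<longlonglongrightarrow> indicat_real {a<..<b} x *\<^sub>R f x"
        by (simp add: scaleR_conv_of_real mult.commute)
    qed
    show "AE x in lebesgue. cmod (f x * of_real (bump a b (real n + 1) x)) \<le> cmod (indicat_real {a..b} x *\<^sub>R f x)" for n
    proof (intro AE_I2)
      fix x
      show "cmod (f x * of_real (bump a b (real n + 1) x)) \<le> cmod (indicat_real {a..b} x *\<^sub>R f x)"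
        using bump_nonneg[of a b "real n + 1" x] bump_le_1[of a b "real n + 1" x] bump_eq_0[of "real n + 1" x a b]
        by (cases "x \<in> {a<..<b}") (auto simp: norm_mult intro: mult_left_le)
    qed
  qed (measurable)
  moreover have "(LINT x|lebesgue. f x * of_real (bump a b (real n + 1) x)) = 0" for n
    by (intro z bump_test_function) simp
  ultimately have "(LINT x|lebesgue. indicat_real {a<..<b} x *\<^sub>R f x) = 0"
    by (simp add: LIMSEQ_const_iff)
  moreover have "(LINT x|lebesgue. indicat_real {a<..<b} x *\<^sub>R f x) = (LINT x|lebesgue. indicat_real {a..b} x *\<^sub>R f x)"
  proof (rule integral_cong_AE)
    have "AE x in lebesgue. x \<noteq> a" "AE x in lebesgue. x \<noteq> b"
      using AE_completion[OF AE_lborel_singleton] by blast+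
    then show "AE x in lebesgue. indicat_real {a<..<b} x *\<^sub>R f x = indicat_real {a..b} x *\<^sub>R f x"
      by eventually_elim (auto simp: indicator_def)
  qed measurable
  ultimately show "(LINT x:{a..b}|lebesgue. f x) = 0"
    by (simp add: set_lebesgue_integral_def)
qed

text \<open>A continuous density gives a derivative at every point. The purpose is to show that
  antiderivatives of test functions are smooth.\<close>

lemma primitive_has_vector_derivative:
  assumes F: "primitive F f" and f: "continuous_on UNIV f"
  shows "(F has_vector_derivative f x) (at x)"
proof -
  have "((\<lambda>u. integral {x - 1..u} f) has_vector_derivative f x) (at x within {x - 1..x + 1})"
    by (rule integral_has_vector_derivative) (auto intro: continuous_on_subset[OF f])
  then have "((\<lambda>u. F (x - 1) + integral {x - 1..u} f) has_vector_derivative f x) (at x)"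
    using has_vector_derivative_add[OF has_vector_derivative_const]
    by (simp add: at_within_Icc_at) fastforce
  then show ?thesis
  proof (rule has_vector_derivative_transform_within_open[of _ _ _ "{x - 1<..<x + 1}"])
    fix y assume "y \<in> {x - 1<..<x + 1}"
    then show "F (x - 1) + integral {x - 1..y} f = F y"
      using primitiveD(2)[OF F, of "x - 1" y] locally_integrableD[OF primitiveD(1)[OF F], of "x - 1" y]
      by (simp add: set_lebesgue_integral_eq_integral algebra_simps)
  qed auto
qed

section \<open>Calculus of test functions\<close>

lemma test_function_bound:
  assumes "test_function \<phi>"
  obtains R where "R > 0" "\<forall>x. \<bar>x\<bar> \<ge> R \<longrightarrow> \<phi> x = 0 \<and> vderiv \<phi> x = 0"
proof -
  obtain R where R: "R > 0" "\<And>x. \<phi> x \<noteq> 0 \<Longrightarrow> \<bar>x\<bar> \<le> R"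
    using assms by (auto simp: test_function_iff bounded_pos)
  show ?thesis
  \<comment> \<open>From \<open>R + 1\<close> on every point has a neighbourhood on which \<phi>
    vanishes, so the derivative vanishes there as well; at \<open>R\<close> itself this would not be
    immediate.\<close>
  proof (rule that[of "R + 1"], goal_cases)
    case 1
    show ?case using R(1) by simp
  next
    case 2
    show ?case
    proof (intro allI impI conjI)
      fix x :: real assume x: "\<bar>x\<bar> \<ge> R + 1"
      then show "\<phi> x = 0" using R(2)[of x] by fastforce
      have "(\<phi> has_vector_derivative 0) (at x)"
      proof (rule has_vector_derivative_transform_within_open[of "\<lambda>_. 0" _ _ "- {- R..R}"])
        show "0 = \<phi> y" if "y \<in> - {- R..R}" for y
          using R(2)[of y] that by (cases "\<phi> y = 0") (auto simp: abs_le_iff)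
      qed (use x in auto)
      then show "vderiv \<phi> x = 0" by (rule vector_derivative_at)
    qed
  qed
qed

lemma test_function_vderiv:
  assumes "test_function \<phi>"
  shows "test_function (vderiv \<phi>)"
proof -
  obtain R where "R > 0" "\<forall>x. \<bar>x\<bar> \<ge> R \<longrightarrow> \<phi> x = 0 \<and> vderiv \<phi> x = 0"
    using test_function_bound[OF assms] .
  then have "\<bar>x\<bar> \<le> R" if "vderiv \<phi> x \<noteq> 0" for x
    using that linorder_le_cases by blast
  then have "{x. vderiv \<phi> x \<noteq> 0} \<subseteq> {- R..R}" by (auto simp: abs_le_iff minus_le_iff)
  then have "bounded {x. vderiv \<phi> x \<noteq> 0}"
    by (rule bounded_subset[OF bounded_closed_interval])
  then show ?thesis
    using assms smooth_vderiv unfolding test_function_iff by blast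
qed

lemma test_function_lincomb:
  assumes "test_function \<phi>" "test_function \<psi>"
  shows "test_function (\<lambda>x. a * \<phi> x + b * \<psi> x)"
proof -
  have "{x. a * \<phi> x + b * \<psi> x \<noteq> 0} \<subseteq> {x. \<phi> x \<noteq> 0} \<union> {x. \<psi> x \<noteq> 0}" by auto
  then have "bounded {x. a * \<phi> x + b * \<psi> x \<noteq> 0}"
    using assms unfolding test_function_iff by (intro bounded_subset[OF bounded_Un[THEN iffD2]]) auto
  then show ?thesis
    using assms smooth_lincomb unfolding test_function_iff by blast
qed

lemma test_function_cnj:
  "test_function \<phi> \<Longrightarrow> test_function (\<lambda>x. cnj (\<phi> x))"
  by (simp add: test_function_iff smooth_cnj)

lemma test_function_continuous: "test_function \<phi> \<Longrightarrow> continuous_on S \<phi>"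
  by (simp add: test_function_iff smooth_continuous)

lemma test_function_primitive: "test_function \<phi> \<Longrightarrow> primitive \<phi> (vderiv \<phi>)"
  by (intro primitive_C1 smooth_has_vector_derivative test_function_continuous test_function_vderiv)
    (simp_all add: test_function_iff)

lemma integrable_mult_test_function:
  assumes "locally_integrable f" "test_function \<phi>"
  shows "integrable lebesgue (\<lambda>x. f x * \<phi> x)"
proof -
  obtain R where "R > 0" "\<forall>x. \<bar>x\<bar> \<ge> R \<longrightarrow> \<phi> x = 0 \<and> vderiv \<phi> x = 0"
    using test_function_bound[OF assms(2)] .
  then show ?thesis
    using assms test_function_continuous
    by (intro integrable_bounded_support[of _ "- R" R] locally_integrable_mult_continuous') auto
qed

lemma integral_primitive_eq_0:
  assumes F: "primitive F f" and zero: "\<And>x. \<bar>x\<bar> \<ge> R \<Longrightarrow> F x = 0 \<and> f x = 0" and "R > 0"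
  shows "(LINT x|lebesgue. f x) = 0"
proof -
  have "(LINT x|lebesgue. f x) = (LINT x:{- R..R}|lebesgue. f x)"
    unfolding set_lebesgue_integral_def
    using zero by (intro Bochner_Integration.integral_cong) (auto simp: indicator_def abs_le_iff)
  also have "\<dots> = F R - F (- R)" using primitiveD(2)[OF F, of "- R" R] \<open>R > 0\<close> by simp
  also have "\<dots> = 0" using zero[of R] zero[of "- R"] \<open>R > 0\<close> by simp
  finally show ?thesis .
qed

text \<open>Vanishing of the total integral is exactly what makes the antiderivative that is 0 to
  the left of the support return to 0 on the right.\<close>

lemma test_function_integral_zero:
  assumes \<eta>: "test_function \<eta>" and z: "(LINT x|lebesgue. \<eta> x) = 0"
  obtains \<Phi> where "test_function \<Phi>" "vderiv \<Phi> = \<eta>"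
proof -
  obtain R where R: "R > 0" "\<forall>x. \<bar>x\<bar> \<ge> R \<longrightarrow> \<eta> x = 0 \<and> vderiv \<eta> x = 0"
    using test_function_bound[OF \<eta>] .
  have c: "continuous_on UNIV \<eta>" using \<eta> by (rule test_function_continuous)
  obtain F where F: "primitive F \<eta>"
    using primitive_exists[OF locally_integrable_continuous[OF c]] .
  define \<Phi> where "\<Phi> x = F x + - F (- R)" for x
  have \<Phi>: "primitive \<Phi> \<eta>"
    unfolding \<Phi>_def using F by (rule primitive_add_const)
  have d: "(\<Phi> has_vector_derivative \<eta> x) (at x)" for x
    using \<Phi> c by (rule primitive_has_vector_derivative)
  have "smooth \<Phi>"
  \<comment> \<open>The antiderivative is the only function to be added to the class of smooth
    functions; its derivative \<eta> is already in it.\<close>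
  proof (rule smooth_coinduct[where S="insert \<Phi> (Collect smooth)"])
    fix f assume "f \<in> insert \<Phi> (Collect smooth)"
    then show "\<exists>f'\<in>insert \<Phi> (Collect smooth). \<forall>x. (f has_vector_derivative f' x) (at x)"
    proof
      assume "f = \<Phi>"
      then show ?thesis using d \<eta> by (intro bexI[of _ \<eta>]) (auto simp: test_function_iff)
    next
      assume "f \<in> Collect smooth"
      then show ?thesis
        by (intro bexI[of _ "vderiv f"]) (auto intro: smooth_has_vector_derivative smooth_vderiv)
    qed
  qed simp
  moreover have "\<Phi> x = 0" if "x \<notin> {- R..R}" for x
  proof (cases "x < - R")
    case True
    have "\<Phi> (- R) - \<Phi> x = (LINT t:{x..- R}|lebesgue. \<eta> t)"
      using primitiveD(2)[OF \<Phi>] True by simp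
    also have "\<dots> = (LINT t:{x..- R}|lebesgue. 0)"
      using R by (intro set_lebesgue_integral_cong) auto
    finally show ?thesis by (simp add: \<Phi>_def)
  next
    case False
    then have "x > R" using that by auto
    then have "\<Phi> x - \<Phi> (- R) = (LINT t:{- R..x}|lebesgue. \<eta> t)"
      using primitiveD(2)[OF \<Phi>] R(1) by simp
    also have "\<dots> = (LINT x|lebesgue. \<eta> x)"
      unfolding set_lebesgue_integral_def
      using R \<open>x > R\<close> by (intro Bochner_Integration.integral_cong) (auto simp: indicator_def abs_le_iff)
    finally show ?thesis using z by (simp add: \<Phi>_def)
  qed
  then have "{x. \<Phi> x \<noteq> 0} \<subseteq> {- R..R}" by blast
  ultimately have "test_function \<Phi>"
    unfolding test_function_iff using bounded_closed_interval bounded_subset by blast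
  moreover have "vderiv \<Phi> = \<eta>" using d by (auto intro: vector_derivative_at)
  ultimately show ?thesis by (rule that)
qed

text \<open>A bump is positive on an interval of positive measure, so its integral is nonzero and
  can be normalised.\<close>

lemma test_function_integral_one:
  obtains \<theta> where "test_function \<theta>" "(LINT x|lebesgue. \<theta> x) = 1"
proof -
  let ?b = "bump 0 1 1"
  have t: "test_function (\<lambda>x. complex_of_real (?b x))" by (rule bump_test_function) simp
  have i: "integrable lebesgue (\<lambda>x. complex_of_real (?b x))"
    using integrable_mult_test_function[OF locally_integrable_continuous t, of "\<lambda>x. 1"] by simp
  have "(LINT x|lebesgue. ?b x) \<noteq> 0"
  proof
    assume "(LINT x|lebesgue. ?b x) = 0"
    then have "AE x in lebesgue. ?b x = 0"
      using i by (subst (asm) integral_nonneg_eq_0_iff_AE)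
        (auto simp: bump_nonneg complex_of_real_integrable_eq)
    then have "AE x in lebesgue. x \<notin> {0<..<1::real}"
      by eventually_elim (use bump_pos[of 1 _ 0 1] in fastforce)
    then have "{0<..<1::real} \<in> null_sets lebesgue"
      by (simp add: completion.null_sets_iff_AE)
    then show False
      by (simp add: null_sets_def)
  qed
  moreover have "(LINT x|lebesgue. complex_of_real (?b x)) = of_real (LINT x|lebesgue. ?b x)"
    by (rule integral_complex_of_real)
  ultimately show ?thesis
    using test_function_lincomb[OF t t, of "1 / of_real (LINT x|lebesgue. ?b x)" 0]
    by (intro that[of "\<lambda>x. 1 / of_real (LINT x|lebesgue. ?b x) * of_real (?b x)"]) auto
qed

text \<open>Subtracting from a test function \<psi> the multiple of a fixed \<theta> that has the
  same integral leaves the derivative of a test function. The hypothesis then says that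
  \<open>f\<close> and the constant \<open>c\<close>, the integral of \<open>f\<close> against
  \<theta>, act alike on every \<psi>.\<close>

lemma du_Bois_Reymond:
  assumes f: "locally_integrable f"
    and z: "\<And>\<phi>. test_function \<phi> \<Longrightarrow> (LINT x|lebesgue. f x * vderiv \<phi> x) = 0"
  obtains c where "AE x in lebesgue. f x = c"
proof -
  obtain \<theta> where \<theta>: "test_function \<theta>" "(LINT x|lebesgue. \<theta> x) = 1"
    using test_function_integral_one .
  define c where "c = (LINT x|lebesgue. f x * \<theta> x)"
  have l1: "locally_integrable (\<lambda>x. c)" for c by (rule locally_integrable_continuous) simp
  have i: "integrable lebesgue \<phi>" if "test_function \<phi>" for \<phi>
    using integrable_mult_test_function[OF l1[of 1] that] by simp
  have "AE x in lebesgue. f x - c = 0"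
  proof (rule fundamental_lemma)
    show "locally_integrable (\<lambda>x. f x - c)" using f l1 by (rule locally_integrable_diff)
    fix \<psi> assume \<psi>: "test_function \<psi>"
    define m where "m = (LINT x|lebesgue. \<psi> x)"
    have \<eta>: "test_function (\<lambda>x. 1 * \<psi> x + - m * \<theta> x)" (is "test_function ?\<eta>")
      using \<psi> \<theta>(1) by (rule test_function_lincomb)
    have "(LINT x|lebesgue. ?\<eta> x) = 0"
      using i[OF \<psi>] i[OF \<theta>(1)] \<theta>(2) by (simp add: m_def)
    then obtain \<Phi> where \<Phi>: "test_function \<Phi>" "vderiv \<Phi> = ?\<eta>"
      using test_function_integral_zero[OF \<eta>] by blast
    have "0 = (LINT x|lebesgue. f x * ?\<eta> x)"
      using z[OF \<Phi>(1)] by (simp only: fun_cong[OF \<Phi>(2)])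
    also have "\<dots> = (LINT x|lebesgue. f x * \<psi> x - m * (f x * \<theta> x))"
      by (simp add: algebra_simps)
    also have "\<dots> = (LINT x|lebesgue. f x * \<psi> x) - c * m"
      using integrable_mult_test_function[OF f \<psi>] integrable_mult_test_function[OF f \<theta>(1)]
      by (simp add: c_def mult.commute)
    also have "\<dots> = (LINT x|lebesgue. f x * \<psi> x - c * \<psi> x)"
      using integrable_mult_test_function[OF f \<psi>] i[OF \<psi>] by (simp add: m_def)
    finally show "(LINT x|lebesgue. (f x - c) * \<psi> x) = 0"
      by (simp add: algebra_simps)
  qed
  then show ?thesis by (intro that[of c]) simp
qed

section \<open>Weak derivatives and primitives\<close>

lemma primitive_imp_distr_deriv:
  assumes F: "primitive F g" and eq: "AE x in lebesgue. f x = F x"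
  shows "f has_distr_deriv g"
  unfolding has_distr_deriv_def
proof (intro conjI allI impI)
  show g: "locally_integrable g" using F by (rule primitiveD)
  have lF: "locally_integrable F" using F by (intro locally_integrable_continuous primitive_continuous)
  have eq': "AE x in lebesgue. F x = f x" using eq by eventually_elim simp
  show f: "locally_integrable f" by (rule locally_integrable_cong_AE[OF lF eq'])
  fix \<phi> assume \<phi>: "test_function \<phi>"
  obtain R where R: "R > 0" "\<forall>x. \<bar>x\<bar> \<ge> R \<longrightarrow> \<phi> x = 0 \<and> vderiv \<phi> x = 0"
    using test_function_bound[OF \<phi>] .
  have "(LINT x|lebesgue. g x * \<phi> x + F x * vderiv \<phi> x) = 0"
    by (rule integral_primitive_eq_0[OF primitive_mult[OF F test_function_primitive[OF \<phi>]] _ R(1)])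
      (use R in auto)
  moreover have "(LINT x|lebesgue. F x * vderiv \<phi> x) = (LINT x|lebesgue. f x * vderiv \<phi> x)"
    using integrable_mult_test_function[OF lF test_function_vderiv[OF \<phi>]]
      integrable_mult_test_function[OF f test_function_vderiv[OF \<phi>]] eq
    by (intro integral_cong_AE) (auto elim!: eventually_mono)
  ultimately show "(LINT x|lebesgue. g x * \<phi> x) = - (LINT x|lebesgue. f x * vderiv \<phi> x)"
    using integrable_mult_test_function[OF g \<phi>] integrable_mult_test_function[OF lF test_function_vderiv[OF \<phi>]]
    by (simp add: eq_neg_iff_add_eq_0)
qed

text \<open>Any primitive of \<open>g\<close> has the same weak derivative as \<open>f\<close>, so
  the two differ by a constant almost everywhere, and the constant is absorbed into the
  primitive.\<close>

lemma distr_deriv_imp_primitive: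
  assumes "f has_distr_deriv g"
  obtains F where "primitive F g" "AE x in lebesgue. f x = F x"
proof -
  have f: "locally_integrable f" and g: "locally_integrable g"
    using assms by (auto simp: has_distr_deriv_def)
  obtain F where F: "primitive F g" using primitive_exists[OF g] .
  then have F': "F has_distr_deriv g" by (rule primitive_imp_distr_deriv) simp
  then have lF: "locally_integrable F" by (simp add: has_distr_deriv_def)
  obtain c where c: "AE x in lebesgue. f x - F x = c"
  proof (rule du_Bois_Reymond)
    show "locally_integrable (\<lambda>x. f x - F x)" using f lF by (rule locally_integrable_diff)
    fix \<phi> assume \<phi>: "test_function \<phi>"
    note i = integrable_mult_test_function[OF f test_function_vderiv[OF \<phi>]]
      integrable_mult_test_function[OF lF test_function_vderiv[OF \<phi>]]
    have "- (LINT x|lebesgue. f x * vderiv \<phi> x) = - (LINT x|lebesgue. F x * vderiv \<phi> x)"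
      using assms[unfolded has_distr_deriv_def, THEN conjunct2, THEN conjunct2, rule_format, OF \<phi>]
        F'[unfolded has_distr_deriv_def, THEN conjunct2, THEN conjunct2, rule_format, OF \<phi>]
      by (rule trans[OF sym])
    then show "(LINT x|lebesgue. (f x - F x) * vderiv \<phi> x) = 0"
      using i by (simp add: left_diff_distrib)
  qed
  show ?thesis
  proof
    show "primitive (\<lambda>x. F x + c) g" using F by (rule primitive_add_const)
    show "AE x in lebesgue. f x = F x + c" using c by eventually_elim (simp add: algebra_simps)
  qed
qed

text \<open>Two continuous functions differ on an open set, and a nonempty open set is not
  null.\<close>

lemma continuous_AE_eq:
  fixes f g :: "real \<Rightarrow> complex"
  assumes "continuous_on UNIV f" "continuous_on UNIV g" "AE x in lebesgue. f x = g x"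
  shows "f = g"
proof (rule ccontr)
  assume "f \<noteq> g"
  let ?S = "{x. f x - g x \<noteq> 0}"
  have "open ?S"
    using assms(1,2) by (intro open_Collect_neq continuous_intros)
  moreover have "?S \<noteq> {}" using \<open>f \<noteq> g\<close> by auto
  moreover have "?S \<in> null_sets lebesgue"
    using assms(3) by (simp add: completion.null_sets_iff_AE)
  ultimately show False
    by (metis negligible_iff_null_sets open_not_negligible)
qed

text \<open>This is how the data in \<open>op_S\<close>, given by \<open>W11_loc\<close> and weak
  derivatives, enter the calculus of primitives: continuity upgrades equality almost everywhere to
  equality.\<close>

lemma continuous_distr_deriv_imp_primitive:
  assumes "f has_distr_deriv g" "continuous_on UNIV f"
  shows "primitive f g"
proof -
  obtain F where F: "primitive F g" "AE x in lebesgue. f x = F x"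
    using distr_deriv_imp_primitive[OF assms(1)] .
  have "f = F"
    using assms(2) primitive_continuous[OF F(1)] F(2) by (rule continuous_AE_eq)
  with F show ?thesis by simp
qed

lemma primitive_unique:
  assumes "primitive F f" "primitive G g" "AE x in lebesgue. F x = G x"
  shows "AE x in lebesgue. f x = g x"
proof -
  have "F = G" using assms by (intro continuous_AE_eq primitive_continuous)
  then have FG: "primitive (\<lambda>x. 0) (\<lambda>x. f x - g x)"
    using primitive_diff[OF assms(1,2)] by simp
  have "AE x in lebesgue. f x - g x = 0"
  proof (rule locally_integrable_zero_intervals)
    show "locally_integrable (\<lambda>x. f x - g x)" using FG by (rule primitiveD)
    show "(LINT x:{a..b}|lebesgue. f x - g x) = 0" for a b
      using primitiveD(2)[OF FG, of a b] by (cases "a \<le> b") (auto simp: set_lebesgue_integral_def)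
  qed
  then show ?thesis by eventually_elim simp
qed

section \<open>Calculus and completeness of the space of square integrable functions\<close>

lemma mult_le_sum_squares:
  fixes a b :: real
  assumes "0 \<le> a" "0 \<le> b"
  shows "a * b \<le> a\<^sup>2 + b\<^sup>2"
proof -
  have "2 * (a * b) \<le> a\<^sup>2 + b\<^sup>2" using sum_squares_bound[of a b] by (simp add: mult.assoc)
  then show ?thesis using mult_nonneg_nonneg[OF assms] by linarith
qed

section \<open>Classes and representatives\<close>

lemma l2_rel_refl_iff: "l2_rel f f \<longleftrightarrow> square_integrable f"
  by (simp add: l2_rel_def)

lemma square_integrable_rep: "square_integrable (rep_l2 u)"
  using Quotient3_rep_reflp[OF Quotient3_l2, of u] by (simp add: l2_rel_refl_iff)

lemma abs_rep_l2: "abs_l2 (rep_l2 u) = u"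
  by (rule Quotient3_abs_rep[OF Quotient3_l2])

lemma abs_l2_eq_iff:
  assumes "square_integrable f" "square_integrable g"
  shows "abs_l2 f = abs_l2 g \<longleftrightarrow> (AE x in lebesgue. f x = g x)"
  using Quotient3_rel[OF Quotient3_l2, of f g] assms by (simp add: l2_rel_def)

lemma rep_abs_l2:
  assumes "square_integrable f"
  shows "AE x in lebesgue. rep_l2 (abs_l2 f) x = f x"
  using abs_l2_eq_iff[OF square_integrable_rep[of "abs_l2 f"] assms] by (simp add: abs_rep_l2)

lemma cinner_abs:
  "square_integrable f \<Longrightarrow> square_integrable g \<Longrightarrow> cinner (abs_l2 f) (abs_l2 g) = pairing f g"
  by (simp add: cinner.abs_eq l2_rel_refl_iff)

lemma add_abs_l2:
  "square_integrable f \<Longrightarrow> square_integrable g \<Longrightarrow> abs_l2 f + abs_l2 g = abs_l2 (\<lambda>x. f x + g x)"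
  by (simp add: plus_l2.abs_eq l2_rel_refl_iff)

lemma scaleC_abs_l2:
  "square_integrable f \<Longrightarrow> scaleC c (abs_l2 f) = abs_l2 (\<lambda>x. c * f x)"
  by (simp add: scaleC.abs_eq l2_rel_refl_iff)

lemma square_integrable_uminus: "square_integrable f \<Longrightarrow> square_integrable (\<lambda>x. - f x)"
  using square_integrable_cmult[of f "-1"] by simp

lemma square_integrable_diff:
  "square_integrable f \<Longrightarrow> square_integrable g \<Longrightarrow> square_integrable (\<lambda>x. f x - g x)"
  using square_integrable_add[OF _ square_integrable_uminus, of f g] by simp

lemma diff_abs_l2:
  assumes "square_integrable f" "square_integrable g"
  shows "abs_l2 f - abs_l2 g = abs_l2 (\<lambda>x. f x - g x)"
  unfolding minus_l2_def uminus_l2_def using assms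
  by (simp add: scaleC_abs_l2 add_abs_l2 square_integrable_uminus)

lemma norm_abs_l2:
  assumes "square_integrable f"
  shows "(norm (abs_l2 f))\<^sup>2 = (LINT x|lebesgue. (cmod (f x))\<^sup>2)"
proof -
  have "(norm (abs_l2 f))\<^sup>2 = Re (cinner (abs_l2 f) (abs_l2 f))"
    by (simp add: power2_norm_eq_inner inner_l2_def)
  then show ?thesis
    using assms by (simp add: cinner_abs pairing_self)
qed

lemma square_integrable_measurable: "square_integrable f \<Longrightarrow> f \<in> borel_measurable lebesgue"
  by (simp add: square_integrable_def)

lemma square_integrable_bound:
  assumes "square_integrable g" "f \<in> borel_measurable lebesgue"
    and "AE x in lebesgue. cmod (f x) \<le> cmod (g x)"
  shows "square_integrable f"
  unfolding square_integrable_def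
proof
  show "f \<in> borel_measurable lebesgue" by fact
  show "integrable lebesgue (\<lambda>x. (cmod (f x))\<^sup>2)"
  proof (rule Bochner_Integration.integrable_bound)
    show "integrable lebesgue (\<lambda>x. (cmod (g x))\<^sup>2)"
      using assms(1) by (simp add: square_integrable_def)
    show "(\<lambda>x. (cmod (f x))\<^sup>2) \<in> borel_measurable lebesgue"
      using assms(2) by measurable
    show "AE x in lebesgue. norm ((cmod (f x))\<^sup>2) \<le> norm ((cmod (g x))\<^sup>2)"
      using assms(3) by eventually_elim (simp add: power_mono)
  qed
qed

lemma square_integrable_cong_AE:
  assumes "square_integrable f" "AE x in lebesgue. f x = g x"
  shows "square_integrable g"
  using assms(1)
proof (rule square_integrable_bound)
  show "g \<in> borel_measurable lebesgue"
    using square_integrable_measurable[OF assms(1)] assms(2) by (rule borel_measurable_lebesgue_cong_AE)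
  show "AE x in lebesgue. cmod (g x) \<le> cmod (f x)"
    using assms(2) by eventually_elim simp
qed

lemma square_integrable_cnj: "square_integrable f \<Longrightarrow> square_integrable (\<lambda>x. cnj (f x))"
  by (simp add: square_integrable_def borel_measurable_cnj)

lemma square_integrable_locally_integrable:
  assumes "square_integrable f"
  shows "locally_integrable f"
proof (rule locally_integrableI_bound)
  show "f \<in> borel_measurable lebesgue"
    using assms by (rule square_integrable_measurable)
  fix a b :: real
  have "set_integrable lebesgue {a..b} (\<lambda>x. (cmod (f x))\<^sup>2)"
    using assms unfolding square_integrable_def set_integrable_def
    by (intro integrable_mult_indicator) auto
  moreover have "set_integrable lebesgue {a..b} (\<lambda>x. 1 :: real)"
    by (intro absolutely_integrable_continuous_real continuous_intros)
  ultimately have "set_integrable lebesgue {a..b} (\<lambda>x. (cmod (f x))\<^sup>2 + 1)"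
    by simp
  moreover have "cmod (f x) \<le> (cmod (f x))\<^sup>2 + 1" for x
    using mult_le_sum_squares[of "cmod (f x)" 1] by simp
  ultimately show "\<exists>g. set_integrable lebesgue {a..b} g \<and>
      (AE x in lebesgue. x \<in> {a..b} \<longrightarrow> cmod (f x) \<le> (g x :: real))"
    by blast
qed

section \<open>Sesquilinearity of the inner product\<close>

lemma cinner_add_left: "cinner (u + v) w = cinner u w + cinner v w"
  by transfer (simp add: pairing_def distrib_right l2_rel_def square_integrable_mult)

lemma cinner_scaleC_left: "cinner (scaleC c u) w = c * cinner u w"
  by transfer (simp add: pairing_def mult.assoc)

lemma cinner_commute: "cinner u v = cnj (cinner v u)"
  by transfer (simp add: pairing_def mult.commute flip: Bochner_Integration.integral_cnj)

lemma cinner_add_right: "cinner u (v + w) = cinner u v + cinner u w"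
  by (metis cinner_add_left cinner_commute complex_cnj_add)

lemma cinner_scaleC_right: "cinner u (scaleC c w) = cnj c * cinner u w"
  by (metis cinner_scaleC_left cinner_commute complex_cnj_mult)

lemma cinner_self: "cinner u u = of_real ((norm u)\<^sup>2)"
proof -
  have "Im (cinner u u) = 0"
    using cinner_commute[of u u] by (simp add: complex_eq_iff)
  then show ?thesis
    by (simp add: complex_eq_iff power2_norm_eq_inner inner_l2_def)
qed

lemma Re_cinner: "Re (cinner u v) = inner u v"
  by (simp add: inner_l2_def)

lemma scaleC_minus1: "scaleC (-1) u = - u"
  by (simp add: uminus_l2_def)

lemma scaleC_of_real: "scaleC (of_real r) u = r *\<^sub>R u"
  by (simp add: scaleR_l2_def)

lemma cinner_minus_left: "cinner (- u) v = - cinner u v"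
  using cinner_scaleC_left[of "-1" u v] by (simp add: scaleC_minus1)

lemma cinner_diff_left: "cinner (u - v) w = cinner u w - cinner v w"
  using cinner_add_left[of u "- v" w] by (simp add: cinner_minus_left)

lemma cinner_minus_right: "cinner u (- v) = - cinner u v"
  using cinner_scaleC_right[of u "-1" v] by (simp add: scaleC_minus1)

lemma cinner_diff_right: "cinner u (v - w) = cinner u v - cinner u w"
  using cinner_add_right[of u v "- w"] by (simp add: cinner_minus_right)

text \<open>Lets a complex identity be recovered from its real part, tested with \<open>v\<close>
  and with \<open>scaleC \<i> v\<close>.\<close>

lemma cinner_ii_right: "Re (cinner u (scaleC \<i> v)) = Im (cinner u v)"
  by (simp add: cinner_scaleC_right)

text \<open>\<open>arctan\<close> is an antiderivative with finite limits at both ends. The function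
  serves below as a strictly positive weight of finite integral.\<close>

lemma integrable_inverse_square_plus_1: "integrable lebesgue (\<lambda>x::real. inverse (1 + x\<^sup>2))"
proof -
  have "set_integrable lborel (einterval (-\<infinity>) \<infinity>) (\<lambda>x::real. inverse (1 + x\<^sup>2))"
  proof (rule interval_integral_FTC_nonneg(1)[where F=arctan])
    show "DERIV arctan x :> inverse (1 + x\<^sup>2)" for x by (rule DERIV_arctan)
    show "isCont (\<lambda>x. inverse (1 + x\<^sup>2)) x" for x :: real
      by (intro continuous_intros) (simp add: add_nonneg_eq_0_iff)
    show "((arctan \<circ> real_of_ereal) \<longlongrightarrow> - (pi / 2)) (at_right (-\<infinity>))"
      "((arctan \<circ> real_of_ereal) \<longlongrightarrow> pi / 2) (at_left \<infinity>)"
      by (simp_all add: ereal_tendsto_simps tendsto_arctan_at_bot tendsto_arctan_at_top)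
  qed auto
  then show ?thesis by (simp add: set_integrable_def integrable_completion)
qed

text \<open>Riesz-Fischer. On a space of infinite measure the L2 norm does not control the L1 norm,
  so the sequence is multiplied by a square integrable weight \<open>h\<close>: by Cauchy-Schwarz
  the products are Cauchy in L1, and a subsequence converges almost everywhere. Division by
  \<open>h > 0\<close> gives a pointwise limit, and Fatou's lemma makes it an L2 limit of the whole
  sequence.\<close>

instance l2 :: complete_space
proof
  fix X :: "nat \<Rightarrow> l2" assume X: "Cauchy X"
  define f where "f n = rep_l2 (X n)" for n
  have f: "square_integrable (f n)" "X n = abs_l2 (f n)" for n
    by (simp_all add: f_def square_integrable_rep abs_rep_l2)
  have [measurable]: "f n \<in> borel_measurable lebesgue" for n
    using f(1) by (rule square_integrable_measurable)
  have d: "(norm (X m - X n))\<^sup>2 = (LINT x|lebesgue. (cmod (f m x - f n x))\<^sup>2)" for m n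
    using f by (simp add: diff_abs_l2 norm_abs_l2 square_integrable_diff)
  define h :: "real \<Rightarrow> real" where "h x = inverse (1 + x\<^sup>2)" for x
  have h: "0 < h x" "h x \<le> 1" for x
    using inverse_le_1_iff[of "1 + x\<^sup>2"] by (auto simp: h_def add_pos_nonneg)
  have hm [measurable]: "h \<in> borel_measurable lebesgue"
    using integrable_inverse_square_plus_1 unfolding h_def [abs_def] by (rule borel_measurable_integrable)
  have sh: "square_integrable (\<lambda>x. of_real (h x))"
    unfolding square_integrable_def
  proof
    show "integrable lebesgue (\<lambda>x. (cmod (of_real (h x)))\<^sup>2)"
    proof (rule Bochner_Integration.integrable_bound[OF integrable_inverse_square_plus_1])
      have "(cmod (of_real (h x)))\<^sup>2 \<le> h x" for x
        using h[of x] by (auto simp: power2_eq_square intro!: mult_left_le)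
      then show "AE x in lebesgue. norm ((cmod (of_real (h x)))\<^sup>2) \<le> norm (inverse (1 + x\<^sup>2))"
        using h by (intro AE_I2) (simp add: h_def)
    qed measurable
  qed measurable
  define H where "H = abs_l2 (\<lambda>x. of_real (h x))"
  have hint: "integrable lebesgue (\<lambda>x. h x *\<^sub>R g x)" if "square_integrable g" for g
    using square_integrable_mult[OF that sh] by (simp add: scaleR_conv_of_real mult.commute)
  have hb: "(LINT x|lebesgue. norm (h x *\<^sub>R f m x - h x *\<^sub>R f n x)) \<le> norm (X m - X n) * norm H" for m n
  proof -
    \<comment> \<open>The modulus is taken before pairing with \<open>H\<close>, so that the pairing
      is the weighted L1 norm, without cancellation.\<close>
    have s: "square_integrable (\<lambda>x. of_real (cmod (f m x - f n x)))"
      by (rule square_integrable_bound[OF square_integrable_diff[OF f(1) f(1), of m n]]) auto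
    have "norm (h x *\<^sub>R f m x - h x *\<^sub>R f n x) = cmod (f m x - f n x) * h x" for x
      using h(1)[of x] by (simp flip: scaleR_diff_right)
    then have "of_real (LINT x|lebesgue. norm (h x *\<^sub>R f m x - h x *\<^sub>R f n x)) =
        pairing (\<lambda>x. of_real (cmod (f m x - f n x))) (\<lambda>x. of_real (h x))"
      by (simp add: pairing_def flip: of_real_mult integral_complex_of_real)
    also have "\<dots> = cinner (abs_l2 (\<lambda>x. of_real (cmod (f m x - f n x)))) H"
      unfolding H_def using s sh by (simp add: cinner_abs)
    finally have "(LINT x|lebesgue. norm (h x *\<^sub>R f m x - h x *\<^sub>R f n x)) =
        inner (abs_l2 (\<lambda>x. of_real (cmod (f m x - f n x)))) H"
      by (metis Re_complex_of_real Re_cinner)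
    also have "\<dots> \<le> norm (abs_l2 (\<lambda>x. complex_of_real (cmod (f m x - f n x)))) * norm H"
      by (rule norm_cauchy_schwarz)
    also have "norm (abs_l2 (\<lambda>x. complex_of_real (cmod (f m x - f n x)))) = norm (X m - X n)"
      by (rule power2_eq_imp_eq) (simp_all only: d norm_abs_l2[OF s] norm_of_real abs_norm_cancel norm_ge_zero)
    finally show ?thesis .
  qed
  obtain r where r: "strict_mono r" "AE x in lebesgue. Cauchy (\<lambda>i. h x *\<^sub>R f (r i) x)"
  proof (rule cauchy_L1_AE_cauchy_subseq)
    show "integrable lebesgue (\<lambda>x. h x *\<^sub>R f n x)" for n by (intro hint f)
    fix e :: real assume "e > 0"
    then have "e / (norm H + 1) > 0" by (simp add: add_nonneg_pos)
    then obtain N where N: "\<And>m n. m \<ge> N \<Longrightarrow> n \<ge> N \<Longrightarrow> norm (X m - X n) < e / (norm H + 1)"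
      using X unfolding Cauchy_def dist_norm by meson
    have "(LINT x|lebesgue. norm (h x *\<^sub>R f m x - h x *\<^sub>R f n x)) < e" if "m \<ge> N" "n \<ge> N" for m n
    proof -
      have "norm (X m - X n) * norm H \<le> norm (X m - X n) * (norm H + 1)"
        by (intro mult_left_mono) auto
      also have "\<dots> < e" using N[OF that] by (simp add: pos_less_divide_eq add_nonneg_pos)
      finally show ?thesis using hb[of m n] by simp
    qed
    then show "\<exists>N. \<forall>i\<ge>N. \<forall>j\<ge>N. (LINT x|lebesgue. norm (h x *\<^sub>R f i x - h x *\<^sub>R f j x)) < e"
      by (intro exI[of _ N]) simp
  qed
  define g where "g x = lim (\<lambda>i. f (r i) x)" for x
  have [measurable]: "g \<in> borel_measurable lebesgue"
    unfolding g_def [abs_def] by measurable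
  have lim: "AE x in lebesgue. (\<lambda>i. f (r i) x) \<longlonglongrightarrow> g x"
    using r(2)
  proof eventually_elim
    case (elim x)
    then obtain l where "(\<lambda>i. h x *\<^sub>R f (r i) x) \<longlonglongrightarrow> l"
      using Cauchy_convergent convergent_def by blast
    then have "(\<lambda>i. inverse (h x) *\<^sub>R (h x *\<^sub>R f (r i) x)) \<longlonglongrightarrow> inverse (h x) *\<^sub>R l"
      by (intro tendsto_intros)
    then have "convergent (\<lambda>i. f (r i) x)"
      using h(1)[of x] by (auto simp: convergent_def)
    then show ?case unfolding g_def by (rule convergent_LIMSEQ_iff[THEN iffD1])
  qed
  have nn: "(\<integral>\<^sup>+x. ennreal ((cmod (f n x - f m x))\<^sup>2) \<partial>lebesgue) = ennreal ((norm (X n - X m))\<^sup>2)" for m n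
    unfolding d using square_integrable_diff[OF f(1) f(1), of n m]
    by (intro nn_integral_eq_integral) (auto simp: square_integrable_def)
  have fatou: "(\<integral>\<^sup>+x. ennreal ((cmod (f n x - g x))\<^sup>2) \<partial>lebesgue) \<le> ennreal (e\<^sup>2)"
    if e: "\<And>m. m \<ge> N \<Longrightarrow> norm (X n - X m) \<le> e" for n N e
  proof -
    have "(\<integral>\<^sup>+x. ennreal ((cmod (f n x - g x))\<^sup>2) \<partial>lebesgue) =
        (\<integral>\<^sup>+x. liminf (\<lambda>i. ennreal ((cmod (f n x - f (r i) x))\<^sup>2)) \<partial>lebesgue)"
    proof (rule nn_integral_cong_AE)
      show "AE x in lebesgue. ennreal ((cmod (f n x - g x))\<^sup>2) = liminf (\<lambda>i. ennreal ((cmod (f n x - f (r i) x))\<^sup>2))"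
        using lim
      proof eventually_elim
        case (elim x)
        have "(\<lambda>i. ennreal ((cmod (f n x - f (r i) x))\<^sup>2)) \<longlonglongrightarrow> ennreal ((cmod (f n x - g x))\<^sup>2)"
          by (intro tendsto_intros elim)
        then show ?case by (intro lim_imp_Liminf[symmetric]) auto
      qed
    qed
    also have "\<dots> \<le> liminf (\<lambda>i. \<integral>\<^sup>+x. ennreal ((cmod (f n x - f (r i) x))\<^sup>2) \<partial>lebesgue)"
      by (rule nn_integral_liminf) measurable
    also have "\<dots> \<le> liminf (\<lambda>i. ennreal (e\<^sup>2))"
    proof (rule Liminf_mono)
      have "r i \<ge> N" if "i \<ge> N" for i using seq_suble[OF r(1), of i] that by linarith
      then show "\<forall>\<^sub>F i in sequentially. (\<integral>\<^sup>+x. ennreal ((cmod (f n x - f (r i) x))\<^sup>2) \<partial>lebesgue) \<le> ennreal (e\<^sup>2)"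
        unfolding nn by (intro eventually_sequentiallyI[of N] ennreal_leI power_mono e) auto
    qed
    also have "\<dots> = ennreal (e\<^sup>2)" by (simp add: Liminf_const)
    finally show ?thesis .
  qed
  have key: "square_integrable (\<lambda>x. f n x - g x) \<and> norm (abs_l2 (\<lambda>x. f n x - g x)) \<le> e"
    if "\<And>m. m \<ge> N \<Longrightarrow> norm (X n - X m) \<le> e" "e \<ge> 0" for n N e
  proof
    have b: "(\<integral>\<^sup>+x. ennreal ((cmod (f n x - g x))\<^sup>2) \<partial>lebesgue) \<le> ennreal (e\<^sup>2)"
      by (rule fatou) (rule that)
    then have "(\<integral>\<^sup>+x. ennreal (norm ((cmod (f n x - g x))\<^sup>2)) \<partial>lebesgue) < \<infinity>"
      by (auto intro: le_less_trans)
    then have i: "integrable lebesgue (\<lambda>x. (cmod (f n x - g x))\<^sup>2)"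
      by (intro integrableI_bounded) auto
    then show s: "square_integrable (\<lambda>x. f n x - g x)" by (simp add: square_integrable_def)
    have "ennreal ((norm (abs_l2 (\<lambda>x. f n x - g x)))\<^sup>2) \<le> ennreal (e\<^sup>2)"
      unfolding norm_abs_l2[OF s] using b i by (subst (asm) nn_integral_eq_integral) auto
    then show "norm (abs_l2 (\<lambda>x. f n x - g x)) \<le> e"
      using \<open>e \<ge> 0\<close> by (simp add: power2_le_iff_abs_le)
  qed
  have C: "\<exists>N. \<forall>n\<ge>N. \<forall>m\<ge>N. norm (X n - X m) \<le> e" if "e > 0" for e
    using X that unfolding Cauchy_def dist_norm by (meson less_imp_le)
  have g: "square_integrable g"
  proof -
    obtain N where "\<forall>n\<ge>N. \<forall>m\<ge>N. norm (X n - X m) \<le> 1" using C[of 1] by auto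
    then have "square_integrable (\<lambda>x. f N x - g x)" using key[of N N 1] by auto
    from square_integrable_diff[OF f(1) this, of N] show ?thesis by simp
  qed
  have "X \<longlonglongrightarrow> abs_l2 g"
    unfolding LIMSEQ_iff
  proof (intro allI impI)
    fix e :: real assume "e > 0"
    then obtain N where N: "\<forall>n\<ge>N. \<forall>m\<ge>N. norm (X n - X m) \<le> e / 2" using C[of "e/2"] by auto
    have "norm (X n - abs_l2 g) \<le> e / 2" if "n \<ge> N" for n
    proof -
      have "norm (abs_l2 (\<lambda>x. f n x - g x)) \<le> e / 2"
        using key[of N n "e / 2"] N that \<open>e > 0\<close> by auto
      then show ?thesis using f g by (simp add: diff_abs_l2)
    qed
    then show "\<exists>N. \<forall>n\<ge>N. norm (X n - abs_l2 g) < e"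
      using \<open>e > 0\<close> by (intro exI[of _ N]) fastforce
  qed
  then show "convergent X" by (auto simp: convergent_def)
qed

section \<open>Closed semibounded forms\<close>

lemma quadratic_nonneg_imp_discriminant:
  fixes a b c :: real
  assumes "\<And>s. 0 \<le> a + 2 * s * b + s\<^sup>2 * c" and "0 \<le> c"
  shows "b\<^sup>2 \<le> a * c"
proof (cases "c = 0")
  case True
  have "b = 0"
  proof (rule ccontr)
    assume "b \<noteq> 0"
    \<comment> \<open>This value of \<open>s\<close> makes \<open>a + 2 * s * b\<close> equal to
      -1.\<close>
    then show False
      using assms(1)[of "- (a + 1) / (2 * b)"] True by (simp add: field_simps)
  qed
  then show ?thesis using True by simp
next
  case False
  with assms(2) have "c > 0" by simp
  then show ?thesis
    using assms(1)[of "- b / c"] by (simp add: field_simps power2_eq_square)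
qed

lemma subspace_closure:
  fixes S :: "'a::real_normed_vector set"
  assumes "subspace S"
  shows "subspace (closure S)"
  unfolding subspace_def
proof (intro conjI ballI allI)
  show "0 \<in> closure S"
    using subspace_0[OF assms] closure_subset by blast
next
  fix x y assume "x \<in> closure S" "y \<in> closure S"
  then obtain u v where uv: "\<And>n. u n \<in> S" "u \<longlonglongrightarrow> x" "\<And>n. v n \<in> S" "v \<longlonglongrightarrow> y"
    unfolding closure_sequential by blast
  then have "\<And>n. u n + v n \<in> S" "(\<lambda>n. u n + v n) \<longlonglongrightarrow> x + y"
    by (simp_all add: subspace_add[OF assms] tendsto_add)
  then show "x + y \<in> closure S"
    unfolding closure_sequential by (intro exI[of _ "\<lambda>n. u n + v n"]) simp
next
  fix r x assume "x \<in> closure S"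
  then obtain u where u: "\<And>n. u n \<in> S" "u \<longlonglongrightarrow> x"
    unfolding closure_sequential by blast
  then have "\<And>n. r *\<^sub>R u n \<in> S" "(\<lambda>n. r *\<^sub>R u n) \<longlonglongrightarrow> r *\<^sub>R x"
    by (simp_all add: subspace_scale[OF assms] tendsto_scaleR)
  then show "r *\<^sub>R x \<in> closure S"
    unfolding closure_sequential by (intro exI[of _ "\<lambda>n. r *\<^sub>R u n"]) simp
qed

text \<open>Completeness is required with respect to \<open>B\<close> and on \<open>V\<close>, so
  that one statement covers a closed subspace of \<open>l2\<close> with its inner product and the
  form domain with the shifted form. The proof minimises \<open>B v v - 2 * L v\<close> over
  \<open>V\<close>: the parallelogram identity makes a minimising sequence Cauchy, and the vanishing
  of the first variation at its limit is the claim.\<close>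

lemma riesz_representation:
  fixes V :: "'a::real_vector set" and B :: "'a \<Rightarrow> 'a \<Rightarrow> real" and L :: "'a \<Rightarrow> real"
  assumes V: "subspace V"
    and add: "\<And>u v w. u \<in> V \<Longrightarrow> v \<in> V \<Longrightarrow> w \<in> V \<Longrightarrow> B (u + v) w = B u w + B v w"
    and scale: "\<And>r u w. u \<in> V \<Longrightarrow> w \<in> V \<Longrightarrow> B (r *\<^sub>R u) w = r * B u w"
    and sym: "\<And>u v. u \<in> V \<Longrightarrow> v \<in> V \<Longrightarrow> B u v = B v u"
    and pos: "\<And>u. u \<in> V \<Longrightarrow> 0 \<le> B u u"
    and complete: "\<And>X. (\<And>n. X n \<in> V) \<Longrightarrow>
        (\<And>e. e > 0 \<Longrightarrow> \<exists>N. \<forall>m\<ge>N. \<forall>n\<ge>N. B (X m - X n) (X m - X n) < e) \<Longrightarrow>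
        \<exists>x\<in>V. (\<lambda>n. B (X n - x) (X n - x)) \<longlonglongrightarrow> 0"
    and Ladd: "\<And>u v. u \<in> V \<Longrightarrow> v \<in> V \<Longrightarrow> L (u + v) = L u + L v"
    and Lscale: "\<And>r u. u \<in> V \<Longrightarrow> L (r *\<^sub>R u) = r * L u"
    and Lbound: "\<And>u. u \<in> V \<Longrightarrow> (L u)\<^sup>2 \<le> C * B u u" and "C \<ge> 0"
  obtains u where "u \<in> V" "\<And>v. v \<in> V \<Longrightarrow> B u v = L v"
proof -
  note closed = subspace_add[OF V] subspace_scale[OF V] subspace_diff[OF V] subspace_0[OF V]
  have quad: "B (u + s *\<^sub>R v) (u + s *\<^sub>R v) = B u u + 2 * s * B u v + s\<^sup>2 * B v v" if "u \<in> V" "v \<in> V" for u v s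
  proof -
    have sv: "s *\<^sub>R v \<in> V" and usv: "u + s *\<^sub>R v \<in> V"
      using closed(1)[OF that(1) closed(2)[OF that(2)]] closed(2)[OF that(2)] by auto
    have *: "B (u + s *\<^sub>R v) w = B u w + s * B v w" if "w \<in> V" for w
      unfolding add[OF \<open>u \<in> V\<close> sv that] scale[OF \<open>v \<in> V\<close> that] ..
    have "B (u + s *\<^sub>R v) (u + s *\<^sub>R v) = B (u + s *\<^sub>R v) u + s * B (u + s *\<^sub>R v) v"
      unfolding *[OF usv] sym[OF that(1) usv] sym[OF that(2) usv] ..
    also have "\<dots> = B u u + 2 * s * B u v + s\<^sup>2 * B v v"
      unfolding *[OF that(1)] *[OF that(2)] sym[OF that(2,1)]
      by (simp add: algebra_simps power2_eq_square)
    finally show ?thesis .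
  qed
  have CS: "(B u v)\<^sup>2 \<le> B u u * B v v" if "u \<in> V" "v \<in> V" for u v
  proof (rule quadratic_nonneg_imp_discriminant)
    show "0 \<le> B u u + 2 * s * B u v + s\<^sup>2 * B v v" for s
    proof -
      have "u + s *\<^sub>R v \<in> V" by (rule closed(1)[OF that(1) closed(2)[OF that(2)]])
      from pos[OF this] show ?thesis unfolding quad[OF that] .
    qed
    show "0 \<le> B v v" by (rule pos) fact
  qed
  define J where "J v = B v v - 2 * L v" for v
  have Jquad: "J (u + s *\<^sub>R v) = J u + 2 * s * (B u v - L v) + s\<^sup>2 * B v v" if "u \<in> V" "v \<in> V" for u v s
    unfolding J_def quad[OF that] Ladd[OF that(1) closed(2)[OF that(2)]] Lscale[OF that(2)]
    by (simp add: algebra_simps)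
  have Jbound: "- C \<le> J v" if "v \<in> V" for v
  proof -
    \<comment> \<open>By the bound on \<open>L\<close> and the inequality between geometric and
      arithmetic mean, \<open>2 * L v\<close> is at most \<open>B v v + C\<close>.\<close>
    have "(2 * L v)\<^sup>2 \<le> 4 * (C * B v v)" using Lbound[OF that] by (simp add: power_mult_distrib)
    also have "\<dots> \<le> (B v v + C)\<^sup>2"
      using zero_le_power2[of "B v v - C"] by (simp add: power2_sum power2_diff algebra_simps)
    finally have "\<bar>2 * L v\<bar> \<le> \<bar>B v v + C\<bar>" by (simp only: abs_le_square_iff)
    then show ?thesis using pos[OF that] \<open>C \<ge> 0\<close> by (simp add: J_def)
  qed
  define m where "m = Inf (J ` V)"
  have bdd: "bdd_below (J ` V)" using Jbound by (intro bdd_belowI[of _ "- C"]) auto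
  have m: "m \<le> J v" if "v \<in> V" for v unfolding m_def using bdd that by (simp add: cInf_lower)
  have "\<exists>v\<in>V. J v < m + inverse (real (Suc n))" for n
  proof -
    have "J ` V \<noteq> {}" using closed(4) by auto
    moreover have "Inf (J ` V) < m + inverse (real (Suc n))" unfolding m_def by simp
    ultimately obtain z where "z \<in> J ` V" "z < m + inverse (real (Suc n))"
      by (rule cInf_lessD[THEN bexE])
    then show ?thesis by (elim imageE) (intro bexI, simp_all)
  qed
  then have "\<forall>n. \<exists>v. v \<in> V \<and> J v < m + inverse (real (Suc n))" by blast
  from choice[OF this] obtain X
    where X: "\<And>n. X n \<in> V" "\<And>n. J (X n) < m + inverse (real (Suc n))" by blast
  \<comment> \<open>Parallelogram identity; the third point is the midpoint of \<open>u\<close> and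
    \<open>v\<close>, so the linear parts of \<open>J\<close> cancel.\<close>
  have par: "B (u - v) (u - v) = 2 * J u + 2 * J v - 4 * J (v + (1/2) *\<^sub>R (u - v))" if "u \<in> V" "v \<in> V" for u v
  proof -
    have d: "u - v \<in> V" using that by (rule closed)
    have "J u = J (v + 1 *\<^sub>R (u - v))" by simp
    also have "\<dots> = J v + 2 * (B v (u - v) - L (u - v)) + B (u - v) (u - v)"
      unfolding Jquad[OF that(2) d] by simp
    finally have "J u = J v + 2 * (B v (u - v) - L (u - v)) + B (u - v) (u - v)" .
    then show ?thesis unfolding Jquad[OF that(2) d] by (simp add: power2_eq_square)
  qed
  have "\<exists>x\<in>V. (\<lambda>n. B (X n - x) (X n - x)) \<longlonglongrightarrow> 0"
  proof (rule complete[OF X(1)])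
    fix e :: real assume "e > 0"
    \<comment> \<open>Each of the two points exceeds the infimum by less than
      \<open>inverse (real (Suc N))\<close> and counts twice in the identity, while the midpoint
      lies above \<open>m\<close>: four such terms in all.\<close>
    then obtain N where N: "inverse (real (Suc N)) < e / 4" using reals_Archimedean[of "e/4"] by auto
    have "B (X k - X n) (X k - X n) < e" if "k \<ge> N" "n \<ge> N" for k n
    proof -
      have "inverse (real (Suc k)) \<le> inverse (real (Suc N))" "inverse (real (Suc n)) \<le> inverse (real (Suc N))"
        using that by (auto intro!: le_imp_inverse_le)
      moreover have "m \<le> J (X n + (1/2) *\<^sub>R (X k - X n))"
        by (intro m closed X)
      ultimately show ?thesis
        using par[OF X(1) X(1), of k n] X(2)[of k] X(2)[of n] N by linarith
    qed
    then show "\<exists>N. \<forall>m\<ge>N. \<forall>n\<ge>N. B (X m - X n) (X m - X n) < e" by (intro exI[of _ N]) simp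
  qed
  then obtain x where x: "x \<in> V" "(\<lambda>n. B (X n - x) (X n - x)) \<longlonglongrightarrow> 0" by blast
  show ?thesis
  proof
    show "x \<in> V" by fact
    fix v assume v: "v \<in> V"
    have "(\<lambda>n. B (X n - x) v) \<longlonglongrightarrow> 0"
    proof (rule tendsto_rabs_zero_cancel, rule tendsto_sandwich[OF _ _ tendsto_const])
      show "\<forall>\<^sub>F n in sequentially. 0 \<le> \<bar>B (X n - x) v\<bar>" by simp
      show "\<forall>\<^sub>F n in sequentially. \<bar>B (X n - x) v\<bar> \<le> sqrt (B (X n - x) (X n - x) * B v v)"
        using CS[OF closed(3)[OF X(1) x(1)] v] by (intro always_eventually allI real_le_rsqrt) simp
      have "(\<lambda>n. sqrt (B (X n - x) (X n - x) * B v v)) \<longlonglongrightarrow> sqrt (0 * B v v)"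
        by (intro tendsto_intros x)
      then show "(\<lambda>n. sqrt (B (X n - x) (X n - x) * B v v)) \<longlonglongrightarrow> 0" by simp
    qed
    then have "(\<lambda>n. B (X n - x) v + B x v) \<longlonglongrightarrow> 0 + B x v" by (intro tendsto_intros)
    moreover have "B (X n - x) v + B x v = B (X n) v" for n
      using add[OF closed(3)[OF X(1) x(1)] x(1) v, of n] by simp
    ultimately have lim: "(\<lambda>n. B (X n) v) \<longlonglongrightarrow> B x v" by simp
    \<comment> \<open>\<open>J\<close> at \<open>X n + s *\<^sub>R v\<close> is at least the
      infimum, which \<open>J (X n)\<close> exceeds by less than
      \<open>inverse (real (Suc n))\<close>. In the limit a quadratic in \<open>s\<close> without
      constant term is nonnegative, so its linear coefficient vanishes.\<close>
    have "0 \<le> 0 + 2 * s * (B x v - L v) + s\<^sup>2 * B v v" for s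
    proof (rule tendsto_le[OF sequentially_bot])
      show "(\<lambda>n. inverse (real (Suc n)) + 2 * s * (B (X n) v - L v) + s\<^sup>2 * B v v) \<longlonglongrightarrow>
          0 + 2 * s * (B x v - L v) + s\<^sup>2 * B v v"
        by (intro tendsto_intros LIMSEQ_inverse_real_of_nat lim)
      show "(\<lambda>n. 0) \<longlonglongrightarrow> (0::real)" by simp
      show "\<forall>\<^sub>F n in sequentially. 0 \<le> inverse (real (Suc n)) + 2 * s * (B (X n) v - L v) + s\<^sup>2 * B v v"
      proof (intro always_eventually allI)
        fix n
        have "m \<le> J (X n + s *\<^sub>R v)" by (intro m closed X v)
        then show "0 \<le> inverse (real (Suc n)) + 2 * s * (B (X n) v - L v) + s\<^sup>2 * B v v"
          using X(2)[of n] unfolding Jquad[OF X(1) v] by linarith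
      qed
    qed
    then have "(B x v - L v)\<^sup>2 \<le> 0 * B v v"
      using pos[OF v] by (rule quadratic_nonneg_imp_discriminant)
    then show "B x v = L v" by simp
  qed
qed

text \<open>The Riesz lemma on the closure yields the orthogonal projection \<open>u\<close> of
  \<open>f\<close>. It works with the real inner product; invariance of \<open>S\<close> under
  multiplication by \<open>\<i>\<close> turns real into complex orthogonality of
  \<open>f - u\<close>.\<close>

lemma orthogonal_zero_imp_dense:
  assumes S: "subspace S" and i: "\<And>u. u \<in> S \<Longrightarrow> scaleC \<i> u \<in> S"
    and orth: "\<And>h. (\<And>u. u \<in> S \<Longrightarrow> cinner h u = 0) \<Longrightarrow> h = 0"
  shows "closure S = UNIV"
proof (intro set_eqI iffI UNIV_I)
  fix f :: l2
  obtain u where u: "u \<in> closure S" "\<And>v. v \<in> closure S \<Longrightarrow> inner u v = inner f v"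
  proof (rule riesz_representation[of "closure S" inner "inner f" "(norm f)\<^sup>2"])
    show "subspace (closure S)" using S by (rule subspace_closure)
    show "(inner f u)\<^sup>2 \<le> (norm f)\<^sup>2 * inner u u" for u
      using Cauchy_Schwarz_ineq[of f u] by (simp add: power2_norm_eq_inner)
    fix X :: "nat \<Rightarrow> l2"
    assume X: "\<And>n. X n \<in> closure S"
      and C: "\<And>e. e > 0 \<Longrightarrow> \<exists>N. \<forall>m\<ge>N. \<forall>n\<ge>N. inner (X m - X n) (X m - X n) < e"
    have "Cauchy X"
      unfolding Cauchy_def dist_norm
    proof (intro allI impI)
      fix e :: real assume "e > 0"
      then obtain N where "\<forall>m\<ge>N. \<forall>n\<ge>N. (norm (X m - X n))\<^sup>2 < e\<^sup>2"
        using C[of "e\<^sup>2"] by (auto simp: power2_norm_eq_inner)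
      then show "\<exists>M. \<forall>m\<ge>M. \<forall>n\<ge>M. norm (X m - X n) < e"
        using \<open>e > 0\<close> by (meson less_imp_le power2_less_imp_less)
    qed
    then obtain x where x: "X \<longlonglongrightarrow> x" using Cauchy_convergent convergent_def by blast
    then have "x \<in> closure S" using X by (meson closed_closure closed_sequentially)
    moreover have "(\<lambda>n. inner (X n - x) (X n - x)) \<longlonglongrightarrow> inner (x - x) (x - x)"
      by (intro tendsto_intros x)
    ultimately show "\<exists>x\<in>closure S. (\<lambda>n. inner (X n - x) (X n - x)) \<longlonglongrightarrow> 0" by auto
  qed (auto simp: inner_add_left inner_add_right inner_commute)
  have "f - u = 0"
  proof (rule orth)
    fix v assume v: "v \<in> S"
    have "Re (cinner (f - u) v) = 0" "Re (cinner (f - u) (scaleC \<i> v)) = 0"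
      unfolding Re_cinner using u(2)[of v] u(2)[of "scaleC \<i> v"] v i[OF v] closure_subset[of S]
      by (auto simp: inner_diff_left)
    then show "cinner (f - u) v = 0" by (simp add: cinner_ii_right complex_eq_iff)
  qed
  then show "f \<in> closure S" using u(1) by simp
qed

text \<open>Passing to adjoints reverses inclusions, so a selfadjoint operator is maximal among
  selfadjoint ones.\<close>

lemma selfadjoint_extension_eq:
  assumes "selfadjoint T" "selfadjoint A" "T \<subseteq> A"
  shows "T = A"
proof
  have "A \<subseteq> adjoint_operator A" using assms(2) by (simp add: selfadjoint_def)
  also have "\<dots> \<subseteq> adjoint_operator T" using assms(3) by (auto simp: adjoint_operator_def)
  also have "\<dots> = T" using assms(1) by (simp add: selfadjoint_def)
  finally show "A \<subseteq> T" .
qed fact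

section \<open>The selfadjoint operator of a closed semibounded form\<close>

locale closed_semibounded_form =
  fixes V :: "l2 set" and t :: "l2 \<Rightarrow> l2 \<Rightarrow> complex"
  assumes V_0: "0 \<in> V"
    and V_add: "\<And>u v. u \<in> V \<Longrightarrow> v \<in> V \<Longrightarrow> u + v \<in> V"
    and V_scaleC: "\<And>c u. u \<in> V \<Longrightarrow> scaleC c u \<in> V"
    and t_add: "\<And>u v w. u \<in> V \<Longrightarrow> v \<in> V \<Longrightarrow> w \<in> V \<Longrightarrow> t (u + v) w = t u w + t v w"
    and t_scaleC: "\<And>c u w. u \<in> V \<Longrightarrow> w \<in> V \<Longrightarrow> t (scaleC c u) w = c * t u w"
    and t_commute: "\<And>u v. u \<in> V \<Longrightarrow> v \<in> V \<Longrightarrow> t u v = cnj (t v u)"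
    and closed_t: "closed_form V t"
    and bounded_t: "form_bounded_below V t"
    and dense_V: "\<And>h. (\<And>v. v \<in> V \<Longrightarrow> cinner h v = 0) \<Longrightarrow> h = 0"
begin

text \<open>The defining identity itself, used as a graph. It is single valued by density of
  \<open>V\<close>, and it is large enough by the surjectivity in
  \<open>resolvent_exists\<close>.\<close>

definition form_operator :: "(l2 \<times> l2) set" where
  "form_operator = {(u, f). u \<in> V \<and> (\<forall>v\<in>V. cinner f v = t u v)}"

lemma subspace_V: "subspace V"
  unfolding subspace_def using V_0 V_add V_scaleC by (auto simp flip: scaleC_of_real)

lemmas V_closed = subspace_add[OF subspace_V] subspace_scale[OF subspace_V]
  subspace_diff[OF subspace_V] subspace_0[OF subspace_V]

lemma t_scaleR: "u \<in> V \<Longrightarrow> w \<in> V \<Longrightarrow> t (r *\<^sub>R u) w = of_real r * t u w"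
  using t_scaleC[of u w "of_real r"] by (simp add: scaleC_of_real)

lemma t_0: "w \<in> V \<Longrightarrow> t 0 w = 0"
  using t_scaleR[OF V_0, of w 0] by simp

lemma t_scaleC_right: "u \<in> V \<Longrightarrow> w \<in> V \<Longrightarrow> t u (scaleC c w) = cnj c * t u w"
  using t_commute[of u "scaleC c w"] t_commute[of u w] t_scaleC[of w u c] V_scaleC by simp

lemma Im_t_self: "u \<in> V \<Longrightarrow> Im (t u u) = 0"
  using t_commute[of u u] by (simp add: complex_eq_iff)

text \<open>With \<open>shift\<close> times the inner product added, the form dominates the squared
  norm, so a Cauchy condition in the shifted form implies one in \<open>l2\<close>.\<close>

definition shift :: real where
  "shift = (SOME l. l > 0 \<and> (\<forall>u\<in>V. (norm u)\<^sup>2 \<le> Re (t u u) + l * (norm u)\<^sup>2))"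

lemma shift: "shift > 0" "u \<in> V \<Longrightarrow> (norm u)\<^sup>2 \<le> Re (t u u) + shift * (norm u)\<^sup>2"
proof -
  obtain c where c: "\<And>u. u \<in> V \<Longrightarrow> c * (norm u)\<^sup>2 \<le> Re (t u u)"
    using bounded_t unfolding form_bounded_below_def by blast
  have "(norm u)\<^sup>2 \<le> Re (t u u) + (\<bar>c\<bar> + 1) * (norm u)\<^sup>2" if "u \<in> V" for u
  proof -
    have "0 \<le> (c + \<bar>c\<bar>) * (norm u)\<^sup>2" by simp
    then show ?thesis using c[OF that] by (simp add: algebra_simps)
  qed
  then have "\<exists>l. l > 0 \<and> (\<forall>u\<in>V. (norm u)\<^sup>2 \<le> Re (t u u) + l * (norm u)\<^sup>2)"
    by (intro exI[of _ "\<bar>c\<bar> + 1"]) auto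
  from someI_ex[OF this] show "shift > 0" "u \<in> V \<Longrightarrow> (norm u)\<^sup>2 \<le> Re (t u u) + shift * (norm u)\<^sup>2"
    unfolding shift_def by blast+
qed

text \<open>Says that \<open>form_operator\<close> plus \<open>shift\<close> is onto. The Riesz
  lemma is applied to the real part of the shifted form, and closedness of the form supplies the
  required completeness.\<close>

lemma resolvent_exists: "\<exists>u\<in>V. (u, f - shift *\<^sub>R u) \<in> form_operator"
proof -
  define B where "B u v = Re (t u v) + shift * inner u v" for u v
  have B: "(norm u)\<^sup>2 \<le> B u u" if "u \<in> V" for u
    using shift(2)[OF that] by (simp add: B_def power2_norm_eq_inner)
  obtain u where u: "u \<in> V" "\<And>v. v \<in> V \<Longrightarrow> B u v = inner f v"
  proof (rule riesz_representation[of V B "inner f" "(norm f)\<^sup>2"])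
    show "subspace V" by (rule subspace_V)
    show "0 \<le> B u u" if "u \<in> V" for u using B[OF that] zero_le_power2 order_trans by blast
    show "(inner f u)\<^sup>2 \<le> (norm f)\<^sup>2 * B u u" if "u \<in> V" for u
    proof -
      have "(inner f u)\<^sup>2 \<le> (norm f)\<^sup>2 * (norm u)\<^sup>2"
        using Cauchy_Schwarz_ineq[of f u] by (simp add: power2_norm_eq_inner)
      also have "\<dots> \<le> (norm f)\<^sup>2 * B u u" by (intro mult_left_mono B that) simp
      finally show ?thesis .
    qed
    show "B u v = B v u" if "u \<in> V" "v \<in> V" for u v
      using t_commute[OF that] by (simp add: B_def inner_commute)
    fix X :: "nat \<Rightarrow> l2"
    assume X: "\<And>n. X n \<in> V"
      and C: "\<And>e. e > 0 \<Longrightarrow> \<exists>N. \<forall>m\<ge>N. \<forall>n\<ge>N. B (X m - X n) (X m - X n) < e"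
    have Xd: "X m - X n \<in> V" for m n by (intro V_closed X)
    have "Cauchy X"
      unfolding Cauchy_def dist_norm
    proof (intro allI impI)
      fix e :: real assume "e > 0"
      then obtain N where N: "\<forall>m\<ge>N. \<forall>n\<ge>N. B (X m - X n) (X m - X n) < e\<^sup>2"
        using C[of "e\<^sup>2"] by auto
      have "norm (X m - X n) < e" if "m \<ge> N" "n \<ge> N" for m n
        using le_less_trans[OF B[OF Xd] N[rule_format, OF that]] \<open>e > 0\<close>
        by (meson less_imp_le power2_less_imp_less)
      then show "\<exists>M. \<forall>m\<ge>M. \<forall>n\<ge>M. norm (X m - X n) < e"
        by (intro exI[of _ N]) simp
    qed
    then obtain x where x: "X \<longlonglongrightarrow> x" using Cauchy_convergent convergent_def by blast
    \<comment> \<open>Closedness speaks of the unshifted form, which may be negative. Its modulus on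
      differences is at most \<open>(1 + shift) * B\<close>, because \<open>B\<close> dominates the
      squared norm.\<close>
    have "\<exists>N. \<forall>m\<ge>N. \<forall>n\<ge>N. cmod (t (X m - X n) (X m - X n)) < e" if "e > 0" for e
    proof -
      have e: "e / (1 + shift) > 0" using that shift(1) by simp
      obtain N where N: "\<forall>m\<ge>N. \<forall>n\<ge>N. B (X m - X n) (X m - X n) < e / (1 + shift)"
        using C[OF e] by blast
      have "cmod (t (X m - X n) (X m - X n)) < e" if "m \<ge> N" "n \<ge> N" for m n
      proof -
        let ?d = "X m - X n"
        have "cmod (t ?d ?d) = \<bar>Re (t ?d ?d)\<bar>"
          using Im_t_self[OF Xd] by (simp add: cmod_def)
        also have "\<dots> = \<bar>B ?d ?d - shift * (norm ?d)\<^sup>2\<bar>"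
          by (simp add: B_def power2_norm_eq_inner)
        also have "\<dots> \<le> B ?d ?d + shift * (norm ?d)\<^sup>2"
        proof -
          have "0 \<le> B ?d ?d" "0 \<le> shift * (norm ?d)\<^sup>2"
            using B[OF Xd[of m n]] shift(1) zero_le_power2 order_trans by (blast, simp)
          then show ?thesis by linarith
        qed
        also have "\<dots> \<le> B ?d ?d + shift * B ?d ?d"
          using B[OF Xd] shift(1) by (intro add_left_mono mult_left_mono) auto
        also have "\<dots> = (1 + shift) * B ?d ?d" by (simp add: algebra_simps)
        also have "\<dots> < e"
          using N that shift(1) by (simp add: pos_less_divide_eq mult.commute)
        finally show ?thesis .
      qed
      then show ?thesis by (intro exI[of _ N]) simp
    qed
    then have "x \<in> V \<and> (\<lambda>n. t (X n - x) (X n - x)) \<longlonglongrightarrow> 0"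
      using closed_t X x unfolding closed_form_def by blast
    moreover from this have "(\<lambda>n. B (X n - x) (X n - x)) \<longlonglongrightarrow> Re 0 + shift * inner (x - x) (x - x)"
      unfolding B_def by (intro tendsto_intros x) auto
    ultimately show "\<exists>x\<in>V. (\<lambda>n. B (X n - x) (X n - x)) \<longlonglongrightarrow> 0" by auto
  qed (auto simp: B_def t_add t_scaleR inner_add_left inner_add_right algebra_simps)
  have "cinner (f - shift *\<^sub>R u) v = t u v" if v: "v \<in> V" for v
  proof -
    \<comment> \<open>The Riesz lemma only determines real parts; testing with
      \<open>scaleC \<i> v\<close> supplies the imaginary part.\<close>
    have *: "Re (cinner (f - shift *\<^sub>R u) w) = Re (t u w)" if "w \<in> V" for w
      unfolding Re_cinner using u(2)[OF that] by (simp add: B_def inner_diff_left)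
    have "Im (cinner (f - shift *\<^sub>R u) v) = Im (t u v)"
      using *[OF V_scaleC[OF v], of \<i>] t_scaleC_right[OF u(1) v] by (simp add: cinner_ii_right)
    with *[OF v] show ?thesis by (simp add: complex_eq_iff)
  qed
  with u(1) show ?thesis by (auto simp: form_operator_def)
qed

lemma form_operator_symmetric:
  "(u, f) \<in> form_operator \<Longrightarrow> (v, g) \<in> form_operator \<Longrightarrow> cinner f v = cinner u g"
  unfolding form_operator_def using t_commute[of u v] cinner_commute[of u g] by auto

lemma linear_form_operator: "linear_operator form_operator"
  unfolding linear_operator_def
proof (intro conjI allI impI)
  show "single_valued form_operator"
  proof (rule single_valuedI)
    fix u f g assume "(u, f) \<in> form_operator" "(u, g) \<in> form_operator"
    then have "f - g = 0" by (intro dense_V) (auto simp: form_operator_def cinner_diff_left)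
    then show "f = g" by simp
  qed
  have "cinner 0 v = 0" for v using cinner_diff_left[of 0 0 v] by simp
  then show "(0, 0) \<in> form_operator" by (auto simp: form_operator_def V_0 t_0)
next
  fix u f v g assume "(u, f) \<in> form_operator" "(v, g) \<in> form_operator"
  then show "(u + v, f + g) \<in> form_operator"
    by (auto simp: form_operator_def V_add cinner_add_left t_add)
next
  fix c u f assume "(u, f) \<in> form_operator"
  then show "(scaleC c u, scaleC c f) \<in> form_operator"
    by (auto simp: form_operator_def V_scaleC cinner_scaleC_left t_scaleC)
qed

text \<open>Solving the shifted equation with right side \<open>h\<close> gives some
  \<open>u\<close> in the domain. Pairing with \<open>u\<close> shows that the shifted form vanishes
  at \<open>u\<close>, so \<open>u = 0\<close> and then \<open>h = 0\<close>.\<close>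

lemma orthogonal_Domain_form_operator:
  assumes "\<And>u. u \<in> Domain form_operator \<Longrightarrow> cinner h u = 0"
  shows "h = 0"
proof -
  obtain u where u: "u \<in> V" "(u, h - shift *\<^sub>R u) \<in> form_operator"
    using resolvent_exists by blast
  then have "cinner h u = 0" by (intro assms) auto
  moreover have "cinner (h - shift *\<^sub>R u) u = t u u"
    using u by (auto simp: form_operator_def)
  ultimately have "Re (t u u) + shift * (norm u)\<^sup>2 = 0"
    by (simp add: cinner_diff_left cinner_scaleC_left cinner_self complex_eq_iff flip: scaleC_of_real)
  then have "u = 0" using shift(2)[OF u(1)] by simp
  with u have "(0, h) \<in> form_operator" by simp
  then show ?thesis by (intro dense_V) (auto simp: form_operator_def t_0)
qed

lemma selfadjoint_form_operator: "selfadjoint form_operator"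
  unfolding selfadjoint_def
proof (intro conjI)
  show lin: "linear_operator form_operator" by (rule linear_form_operator)
  have scaleC: "scaleC c u \<in> Domain form_operator" if "u \<in> Domain form_operator" for c u
    using that lin unfolding linear_operator_def by blast
  show "closure (Domain form_operator) = UNIV"
  proof (rule orthogonal_zero_imp_dense)
    show "subspace (Domain form_operator)"
      unfolding subspace_def
    proof (intro conjI ballI allI)
      show "0 \<in> Domain form_operator" using lin unfolding linear_operator_def by blast
      show "u + v \<in> Domain form_operator"
        if "u \<in> Domain form_operator" "v \<in> Domain form_operator" for u v
        using that lin unfolding linear_operator_def by blast
      show "r *\<^sub>R u \<in> Domain form_operator" if "u \<in> Domain form_operator" for r u
        using scaleC[OF that, of "of_real r"] by (simp add: scaleC_of_real)
    qed
  qed (auto intro: scaleC orthogonal_Domain_form_operator)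
  show "adjoint_operator form_operator = form_operator"
  proof (intro subset_antisym subrelI)
    fix v g assume "(v, g) \<in> form_operator"
    then show "(v, g) \<in> adjoint_operator form_operator"
      unfolding adjoint_operator_def using form_operator_symmetric by blast
  next
    fix v g assume vg: "(v, g) \<in> adjoint_operator form_operator"
    \<comment> \<open>The shifted operator is onto, so \<open>g + shift *\<^sub>R v\<close> is its
      value at some \<open>w\<close> in the domain. Then \<open>d = v - w\<close> is orthogonal to
      its range; as \<open>d\<close> itself belongs to the range, \<open>d = 0\<close>.\<close>
    obtain w where w: "(w, g + shift *\<^sub>R v - shift *\<^sub>R w) \<in> form_operator"
      using resolvent_exists by blast
    define d where "d = v - w"
    have g: "g + shift *\<^sub>R v - shift *\<^sub>R w = g + shift *\<^sub>R d"
      by (simp add: d_def scaleR_diff_right)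
    obtain u where u: "(u, d - shift *\<^sub>R u) \<in> form_operator"
      using resolvent_exists by blast
    have "cinner (d - shift *\<^sub>R u) v = cinner u g"
      using vg u unfolding adjoint_operator_def by blast
    moreover have "cinner (d - shift *\<^sub>R u) w = cinner u (g + shift *\<^sub>R d)"
      using form_operator_symmetric[OF u w] unfolding g .
    ultimately have "cinner (d - shift *\<^sub>R u) d = - of_real shift * cinner u d"
      unfolding d_def cinner_diff_right[of "v - w - shift *\<^sub>R u"]
      by (simp add: cinner_add_right cinner_scaleC_right flip: scaleC_of_real)
    then have "cinner d d = 0"
      by (simp add: cinner_diff_left cinner_scaleC_left flip: scaleC_of_real)
    then have "d = 0" by (simp add: cinner_self)
    then show "(v, g) \<in> form_operator" using w by (simp add: d_def)
  qed
qed

text \<open>Every associated operator is contained in \<open>form_operator\<close> by the defining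
  identity, and selfadjoint operators are maximal.\<close>

lemma associated_operator_iff: "associated_operator V t T \<longleftrightarrow> T = form_operator"
proof
  assume T: "associated_operator V t T"
  then have "T \<subseteq> form_operator"
    unfolding associated_operator_def form_operator_def by fast
  with T show "T = form_operator"
    by (intro selfadjoint_extension_eq selfadjoint_form_operator) (simp add: associated_operator_def)
next
  assume "T = form_operator"
  then show "associated_operator V t T"
    using selfadjoint_form_operator by (auto simp: associated_operator_def form_operator_def)
qed

lemma form_operator_bounded_below: "operator_bounded_below form_operator"
  using bounded_t unfolding operator_bounded_below_def form_bounded_below_def form_operator_def
  by fastforce

end

section \<open>The Sobolev space\<close>

text \<open>Function-level description of \<open>W12\<close>: \<open>y\<close> is the continuous
  representative and \<open>y'\<close> any representative of the derivative. Estimates are done on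
  such pairs and transferred to classes by \<open>sobolev_W12\<close> and
  \<open>W12E\<close>.\<close>

definition sobolev :: "(real \<Rightarrow> complex) \<Rightarrow> (real \<Rightarrow> complex) \<Rightarrow> bool" where
  "sobolev y y' \<longleftrightarrow> primitive y y' \<and> square_integrable y \<and> square_integrable y'"

lemma sobolevD:
  assumes "sobolev y y'"
  shows "primitive y y'" "square_integrable y" "square_integrable y'"
    "y \<in> borel_measurable lebesgue" "y' \<in> borel_measurable lebesgue"
  using assms by (auto simp: sobolev_def square_integrable_measurable)

text \<open>This gives the definite description in \<open>l2_deriv\<close> its meaning: continuous
  representatives coincide everywhere, hence their densities coincide almost everywhere.\<close>

lemma l2_deriv_unique:
  assumes "rep_l2 u has_distr_deriv rep_l2 v" "rep_l2 u has_distr_deriv rep_l2 w"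
  shows "v = w"
proof -
  obtain F where F: "primitive F (rep_l2 v)" "AE x in lebesgue. rep_l2 u x = F x"
    using distr_deriv_imp_primitive[OF assms(1)] .
  obtain G where G: "primitive G (rep_l2 w)" "AE x in lebesgue. rep_l2 u x = G x"
    using distr_deriv_imp_primitive[OF assms(2)] .
  have "AE x in lebesgue. F x = G x" using F(2) G(2) by eventually_elim simp
  then have "AE x in lebesgue. rep_l2 v x = rep_l2 w x" by (rule primitive_unique[OF F(1) G(1)])
  then show ?thesis
    using abs_l2_eq_iff[OF square_integrable_rep[of v] square_integrable_rep[of w]] by (simp add: abs_rep_l2)
qed

lemma l2_derivI:
  assumes "rep_l2 u has_distr_deriv rep_l2 v"
  shows "u \<in> W12" "l2_deriv u = v"
  using assms l2_deriv_unique unfolding W12_def l2_deriv_def by blast+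

lemma sobolev_W12:
  assumes "sobolev y y'"
  shows "abs_l2 y \<in> W12" "l2_deriv (abs_l2 y) = abs_l2 y'"
proof -
  note y = sobolevD[OF assms]
  have "AE x in lebesgue. y' x = rep_l2 (abs_l2 y') x"
    using rep_abs_l2[OF y(3)] by eventually_elim simp
  then have "primitive y (rep_l2 (abs_l2 y'))" by (rule primitive_cong_AE[OF y(1)])
  then have "rep_l2 (abs_l2 y) has_distr_deriv rep_l2 (abs_l2 y')"
    using rep_abs_l2[OF y(2)] by (rule primitive_imp_distr_deriv)
  then show "abs_l2 y \<in> W12" "l2_deriv (abs_l2 y) = abs_l2 y'" by (rule l2_derivI)+
qed

lemma W12E:
  assumes "u \<in> W12"
  obtains y y' where "sobolev y y'" "u = abs_l2 y" "l2_deriv u = abs_l2 y'"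
proof -
  obtain v where v: "rep_l2 u has_distr_deriv rep_l2 v" using assms by (auto simp: W12_def)
  obtain y where y: "primitive y (rep_l2 v)" "AE x in lebesgue. rep_l2 u x = y x"
    using distr_deriv_imp_primitive[OF v] .
  have s: "square_integrable y"
    by (rule square_integrable_cong_AE[OF square_integrable_rep y(2)])
  show ?thesis
  proof
    show "sobolev y (rep_l2 v)" using y(1) s square_integrable_rep by (simp add: sobolev_def)
    show "u = abs_l2 y"
      using abs_l2_eq_iff[OF square_integrable_rep s, of u] y(2) by (simp add: abs_rep_l2)
    show "l2_deriv u = abs_l2 (rep_l2 v)" using l2_derivI[OF v] by (simp add: abs_rep_l2)
  qed
qed

lemma primitive_cmult:
  assumes "primitive F f"
  shows "primitive (\<lambda>x. c * F x) (\<lambda>x. c * f x)"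
  using assms by (simp add: primitive_def locally_integrable_cmult flip: right_diff_distrib)

lemma primitive_add:
  assumes "primitive F f" "primitive G g"
  shows "primitive (\<lambda>x. F x + G x) (\<lambda>x. f x + g x)"
  using primitive_diff[OF assms(1) primitive_cmult[OF assms(2), of "-1"]] by simp

lemma sobolev_add: "sobolev y y' \<Longrightarrow> sobolev z z' \<Longrightarrow> sobolev (\<lambda>x. y x + z x) (\<lambda>x. y' x + z' x)"
  by (simp add: sobolev_def primitive_add square_integrable_add)

lemma sobolev_cmult: "sobolev y y' \<Longrightarrow> sobolev (\<lambda>x. c * y x) (\<lambda>x. c * y' x)"
  by (simp add: sobolev_def primitive_cmult square_integrable_cmult)

lemma test_function_square_integrable:
  assumes "test_function \<phi>"
  shows "square_integrable \<phi>"
proof -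
  have c: "continuous_on UNIV \<phi>" using assms by (rule test_function_continuous)
  have "integrable lebesgue (\<lambda>x. cnj (\<phi> x) * \<phi> x)"
    using assms c by (intro integrable_mult_test_function locally_integrable_continuous continuous_intros)
  moreover have "(\<lambda>x. cnj (\<phi> x) * \<phi> x) = (\<lambda>x. complex_of_real ((cmod (\<phi> x))\<^sup>2))"
    by (simp only: complex_norm_square mult.commute)
  ultimately have "integrable lebesgue (\<lambda>x. (cmod (\<phi> x))\<^sup>2)"
    by (simp only: complex_of_real_integrable_eq)
  then show ?thesis
    using borel_measurable_continuous_onI[OF c] by (simp add: square_integrable_def measurable_completion)
qed

lemma test_function_sobolev: "test_function \<phi> \<Longrightarrow> sobolev \<phi> (vderiv \<phi>)"
  by (simp add: sobolev_def test_function_primitive test_function_square_integrable test_function_vderiv)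

lemma W12_0: "0 \<in> W12"
proof -
  have "sobolev (\<lambda>x. 0) (\<lambda>x. 0)"
    by (simp add: sobolev_def primitive_def locally_integrable_def square_integrable_zero)
  then show ?thesis
    using sobolev_W12(1) by (simp add: zero_l2.abs_eq)
qed

lemma W12_add:
  assumes "u \<in> W12" "v \<in> W12"
  shows "u + v \<in> W12" "l2_deriv (u + v) = l2_deriv u + l2_deriv v"
proof -
  obtain y y' where y: "sobolev y y'" "u = abs_l2 y" "l2_deriv u = abs_l2 y'" using W12E[OF assms(1)] .
  obtain z z' where z: "sobolev z z'" "v = abs_l2 z" "l2_deriv v = abs_l2 z'" using W12E[OF assms(2)] .
  have uv: "u + v = abs_l2 (\<lambda>x. y x + z x)" "l2_deriv u + l2_deriv v = abs_l2 (\<lambda>x. y' x + z' x)"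
    using y z by (auto simp: add_abs_l2 sobolevD)
  show "u + v \<in> W12" "l2_deriv (u + v) = l2_deriv u + l2_deriv v"
    unfolding uv using sobolev_W12[OF sobolev_add[OF y(1) z(1)]] by auto
qed

lemma W12_scaleC:
  assumes "u \<in> W12"
  shows "scaleC c u \<in> W12" "l2_deriv (scaleC c u) = scaleC c (l2_deriv u)"
proof -
  obtain y y' where y: "sobolev y y'" "u = abs_l2 y" "l2_deriv u = abs_l2 y'" using W12E[OF assms(1)] .
  have u: "scaleC c u = abs_l2 (\<lambda>x. c * y x)" "scaleC c (l2_deriv u) = abs_l2 (\<lambda>x. c * y' x)"
    using y by (auto simp: scaleC_abs_l2 sobolevD)
  show "scaleC c u \<in> W12" "l2_deriv (scaleC c u) = scaleC c (l2_deriv u)"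
    unfolding u using sobolev_W12[OF sobolev_cmult[OF y(1)]] by auto
qed

lemma W12_diff:
  assumes "u \<in> W12" "v \<in> W12"
  shows "u - v \<in> W12" "l2_deriv (u - v) = l2_deriv u - l2_deriv v"
  using W12_add[OF assms(1) W12_scaleC(1)[OF assms(2), of "-1"]] W12_scaleC(2)[OF assms(2), of "-1"]
  by (simp_all add: scaleC_minus1)

text \<open>The conjugate compensates the conjugate linearity of \<open>cinner\<close> in its second
  argument, since distributions pair bilinearly with test functions.\<close>

lemma cinner_test_function:
  assumes "test_function \<phi>"
  shows "cinner u (abs_l2 (\<lambda>x. cnj (\<phi> x))) = (LINT x|lebesgue. rep_l2 u x * \<phi> x)"
  using cinner_abs[OF square_integrable_rep test_function_square_integrable[OF test_function_cnj[OF assms]], of u]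
  by (simp add: abs_rep_l2 pairing_def)

lemma W12_orthogonal:
  assumes "\<And>v. v \<in> W12 \<Longrightarrow> cinner h v = 0"
  shows "h = 0"
proof -
  have "AE x in lebesgue. rep_l2 h x = 0"
  proof (rule fundamental_lemma)
    show "locally_integrable (rep_l2 h)"
      by (intro square_integrable_locally_integrable square_integrable_rep)
    fix \<phi> assume \<phi>: "test_function \<phi>"
    then have "abs_l2 (\<lambda>x. cnj (\<phi> x)) \<in> W12"
      by (intro sobolev_W12(1)[OF test_function_sobolev] test_function_cnj)
    from assms[OF this] show "(LINT x|lebesgue. rep_l2 h x * \<phi> x) = 0"
      using \<phi> by (simp add: cinner_test_function)
  qed
  then have "abs_l2 (rep_l2 h) = abs_l2 (\<lambda>x. 0)"
    by (simp add: abs_l2_eq_iff square_integrable_rep square_integrable_zero)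
  then show ?thesis by (simp add: abs_rep_l2 zero_l2.abs_eq)
qed

lemma tendsto_cinner:
  assumes "X \<longlonglongrightarrow> x"
  shows "(\<lambda>n. cinner (X n) w) \<longlonglongrightarrow> cinner x w"
proof -
  have "cinner u w = Complex (inner u w) (inner u (scaleC \<i> w))" for u
    by (simp add: complex_eq_iff cinner_ii_right flip: Re_cinner)
  then show ?thesis
    by (simp only:) (intro tendsto_Complex tendsto_inner tendsto_const assms)
qed

text \<open>For a fixed test function both sides of the weak derivative identity are inner products
  in L2, hence pass to the limit.\<close>

lemma W12_closed:
  assumes X: "\<And>n. X n \<in> W12" and x: "X \<longlonglongrightarrow> x" and v: "(\<lambda>n. l2_deriv (X n)) \<longlonglongrightarrow> v"
  shows "x \<in> W12" "l2_deriv x = v"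
proof -
  have "rep_l2 x has_distr_deriv rep_l2 v"
    unfolding has_distr_deriv_def
  proof (intro conjI allI impI)
    show "locally_integrable (rep_l2 x)" "locally_integrable (rep_l2 v)"
      by (intro square_integrable_locally_integrable square_integrable_rep)+
    fix \<phi> assume \<phi>: "test_function \<phi>"
    let ?p = "abs_l2 (\<lambda>x. cnj (\<phi> x))" and ?q = "abs_l2 (\<lambda>x. cnj (vderiv \<phi> x))"
    have "cinner (l2_deriv (X n)) ?p = - cinner (X n) ?q" for n
    proof -
      have "rep_l2 (X n) has_distr_deriv rep_l2 (l2_deriv (X n))"
        using X[of n] l2_derivI(2) unfolding W12_def by blast
      then show ?thesis
        using \<phi> unfolding cinner_test_function[OF \<phi>] cinner_test_function[OF test_function_vderiv[OF \<phi>]]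
        by (simp add: has_distr_deriv_def)
    qed
    then have "(\<lambda>n. - cinner (X n) ?q) \<longlonglongrightarrow> cinner v ?p"
      using tendsto_cinner[OF v, of ?p] by simp
    moreover have "(\<lambda>n. - cinner (X n) ?q) \<longlonglongrightarrow> - cinner x ?q"
      by (intro tendsto_minus tendsto_cinner x)
    ultimately have "cinner v ?p = - cinner x ?q" by (rule LIMSEQ_unique)
    then show "(LINT t|lebesgue. rep_l2 v t * \<phi> t) = - (LINT t|lebesgue. rep_l2 x t * vderiv \<phi> t)"
      unfolding cinner_test_function[OF \<phi>] cinner_test_function[OF test_function_vderiv[OF \<phi>]] .
  qed
  then show "x \<in> W12" "l2_deriv x = v" by (rule l2_derivI)+
qed

section \<open>Uniformly locally integrable weights\<close>

definition unif_weight :: "(real \<Rightarrow> real) \<Rightarrow> real \<Rightarrow> bool" where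
  "unif_weight p M \<longleftrightarrow> p \<in> borel_measurable lebesgue \<and> (\<forall>x. 0 \<le> p x) \<and> 0 \<le> M \<and>
     (\<forall>t. (\<integral>\<^sup>+s\<in>{t..t + 1}. ennreal (p s) \<partial>lebesgue) \<le> ennreal M)"

lemma SUP_finite_imp_bound:
  fixes f :: "real \<Rightarrow> ennreal"
  assumes "(SUP t. f t) < \<infinity>"
  obtains M where "0 \<le> M" "\<And>t. f t \<le> ennreal M"
proof
  show "0 \<le> enn2real (SUP t. f t)" by simp
  show "f t \<le> ennreal (enn2real (SUP t. f t))" for t
    using assms SUP_upper[of t UNIV f] by (simp add: less_top)
qed

lemma unif_weight_exists:
  assumes "\<sigma> \<in> L2_unif" "\<tau> \<in> L1_unif"
  obtains M where "unif_weight (\<lambda>x. 4 * (\<sigma> x)\<^sup>2 + \<bar>\<tau> x\<bar>) M"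
proof -
  have [measurable]: "\<sigma> \<in> borel_measurable lebesgue" "\<tau> \<in> borel_measurable lebesgue"
    using assms by (auto simp: L2_unif_def L1_unif_def)
  obtain M1 where M1: "0 \<le> M1" "\<And>t. (\<integral>\<^sup>+ s\<in>{t..t+1}. ennreal (\<bar>\<sigma> s\<bar>\<^sup>2) \<partial>lebesgue) \<le> ennreal M1"
    using assms(1) SUP_finite_imp_bound unfolding L2_unif_def by blast
  obtain M2 where M2: "0 \<le> M2" "\<And>t. (\<integral>\<^sup>+ s\<in>{t..t+1}. ennreal \<bar>\<tau> s\<bar> \<partial>lebesgue) \<le> ennreal M2"
    using assms(2) SUP_finite_imp_bound unfolding L1_unif_def by blast
  have "(\<integral>\<^sup>+s\<in>{t..t + 1}. ennreal (4 * (\<sigma> s)\<^sup>2 + \<bar>\<tau> s\<bar>) \<partial>lebesgue) \<le> ennreal (4 * M1 + M2)" for t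
  proof -
    have [measurable]: "(indicator {t..t + 1} :: real \<Rightarrow> ennreal) \<in> borel_measurable lebesgue"
      by (intro borel_measurable_indicator) auto
    have "(\<integral>\<^sup>+s\<in>{t..t + 1}. ennreal (4 * (\<sigma> s)\<^sup>2 + \<bar>\<tau> s\<bar>) \<partial>lebesgue) =
        (\<integral>\<^sup>+s. 4 * (ennreal (\<bar>\<sigma> s\<bar>\<^sup>2) * indicator {t..t+1} s) + ennreal \<bar>\<tau> s\<bar> * indicator {t..t+1} s \<partial>lebesgue)"
      by (intro nn_integral_cong) (auto simp: ennreal_plus ennreal_mult indicator_def)
    also have "\<dots> = 4 * (\<integral>\<^sup>+ s\<in>{t..t+1}. ennreal (\<bar>\<sigma> s\<bar>\<^sup>2) \<partial>lebesgue) + (\<integral>\<^sup>+ s\<in>{t..t+1}. ennreal \<bar>\<tau> s\<bar> \<partial>lebesgue)"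
      by (subst nn_integral_add) (auto simp: nn_integral_cmult)
    also have "\<dots> \<le> 4 * ennreal M1 + ennreal M2"
      by (intro add_mono mult_left_mono M1 M2) auto
    also have "\<dots> = ennreal (4 * M1 + M2)" using M1(1) M2(1) by (simp add: ennreal_plus ennreal_mult)
    finally show ?thesis .
  qed
  then show ?thesis
    using M1(1) M2(1) by (intro that[of "4 * M1 + M2"]) (simp add: unif_weight_def)
qed

text \<open>Tonelli's theorem moves the window from \<open>h\<close> to \<open>p\<close>:
  \<open>t\<close> lies in \<open>[x, x + 1]\<close> exactly when \<open>x\<close> lies in
  \<open>[t - 1, t]\<close>, and over that window \<open>p\<close> has integral at most
  \<open>M\<close>.\<close>

lemma unif_weight_convolution_bound:
  assumes p: "unif_weight p M" and h: "h \<in> borel_measurable lebesgue"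
  shows "(\<integral>\<^sup>+x. ennreal (p x) * (\<integral>\<^sup>+t\<in>{x..x + 1}. h t \<partial>lebesgue) \<partial>lebesgue) \<le> ennreal M * (\<integral>\<^sup>+t. h t \<partial>lebesgue)"
proof -
  have pm: "(\<lambda>x. ennreal (p x)) \<in> borel_measurable lebesgue"
    and M: "\<And>t. (\<integral>\<^sup>+s\<in>{t..t + 1}. ennreal (p s) \<partial>lebesgue) \<le> ennreal M"
    using p by (auto simp: unif_weight_def)
  obtain q where q [measurable]: "q \<in> borel_measurable borel" and pq: "AE x in lborel. ennreal (p x) = q x"
    using completion_ex_borel_measurable[OF pm] by auto
  obtain g where g [measurable]: "g \<in> borel_measurable borel" and hg: "AE x in lborel. h x = g x"
    using completion_ex_borel_measurable[OF h] by auto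
  have hg': "(\<integral>\<^sup>+t\<in>{x..x + 1}. h t \<partial>lebesgue) = (\<integral>\<^sup>+t. g t * indicator {x..x + 1} t \<partial>lborel)" for x
    unfolding nn_integral_completion using hg by (intro nn_integral_cong_AE) (auto elim!: eventually_mono)
  have pq': "(\<integral>\<^sup>+s\<in>{t..t + 1}. ennreal (p s) \<partial>lebesgue) = (\<integral>\<^sup>+s. q s * indicator {t..t + 1} s \<partial>lborel)" for t
    unfolding nn_integral_completion using pq by (intro nn_integral_cong_AE) (auto elim!: eventually_mono)
  have [measurable]: "(\<lambda>(x, t). q x * g t * indicator {x..x + 1} t) \<in> borel_measurable (lborel \<Otimes>\<^sub>M lborel)"
  proof -
    have "(\<lambda>(x, t). q x * g t * (if x \<le> t \<and> t \<le> x + 1 then 1 else 0)) \<in> borel_measurable (lborel \<Otimes>\<^sub>M lborel)"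
      by measurable
    also have "(\<lambda>(x, t). q x * g t * (if x \<le> t \<and> t \<le> x + 1 then 1 else 0)) = (\<lambda>(x, t). q x * g t * indicator {x..x + 1} t)"
      by (auto simp: indicator_def)
    finally show ?thesis .
  qed
  have "(\<integral>\<^sup>+x. ennreal (p x) * (\<integral>\<^sup>+t\<in>{x..x + 1}. h t \<partial>lebesgue) \<partial>lebesgue) =
      (\<integral>\<^sup>+x. q x * (\<integral>\<^sup>+t. g t * indicator {x..x + 1} t \<partial>lborel) \<partial>lborel)"
    unfolding hg' unfolding nn_integral_completion using pq by (intro nn_integral_cong_AE) (auto elim!: eventually_mono)
  also have "\<dots> = (\<integral>\<^sup>+x. (\<integral>\<^sup>+t. q x * g t * indicator {x..x + 1} t \<partial>lborel) \<partial>lborel)"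
    by (intro nn_integral_cong) (simp add: mult.assoc flip: nn_integral_cmult)
  also have "\<dots> = (\<integral>\<^sup>+t. (\<integral>\<^sup>+x. q x * g t * indicator {x..x + 1} t \<partial>lborel) \<partial>lborel)"
    by (rule lborel_pair.Fubini'[symmetric]) simp
  \<comment> \<open>The upper end is left as \<open>t - 1 + 1\<close> so that the window has the
    shape \<open>{t..t + 1}\<close> of the uniform bound.\<close>
  also have "\<dots> = (\<integral>\<^sup>+t. g t * (\<integral>\<^sup>+x. q x * indicator {t - 1..t - 1 + 1} x \<partial>lborel) \<partial>lborel)"
  proof (rule nn_integral_cong)
    fix t
    have "q x * g t * indicator {x..x + 1} t = g t * (q x * indicator {t - 1..t - 1 + 1} x)" for x
      by (auto simp: indicator_def mult.commute)
    then show "(\<integral>\<^sup>+x. q x * g t * indicator {x..x + 1} t \<partial>lborel) = g t * (\<integral>\<^sup>+x. q x * indicator {t - 1..t - 1 + 1} x \<partial>lborel)"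
      by (simp only:) (rule nn_integral_cmult, measurable)
  qed
  also have "\<dots> \<le> (\<integral>\<^sup>+t. g t * ennreal M \<partial>lborel)"
    by (intro nn_integral_mono mult_left_mono M[unfolded pq']) simp
  also have "\<dots> = ennreal M * (\<integral>\<^sup>+t. h t \<partial>lebesgue)"
    unfolding nn_integral_completion using hg
    by (subst nn_integral_multc) (auto simp: mult.commute intro!: arg_cong[where f="\<lambda>x. _ * x"] nn_integral_cong_AE elim!: eventually_mono)
  finally show ?thesis .
qed

text \<open>Over the window the squared modulus departs from its value at \<open>x\<close> by at
  most \<open>K\<close>. Averaging this over \<open>s\<close> introduces no factor because the
  window has length 1.\<close>

lemma sobolev_pointwise_bound:
  assumes y: "sobolev y y'" and e: "e > 0"
  shows "(cmod (y x))\<^sup>2 \<le> (LINT t:{x..x + 1}|lebesgue. (1 + 1 / e) * (cmod (y t))\<^sup>2 + e * (cmod (y' t))\<^sup>2)"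
proof -
  note [measurable] = sobolevD(4,5)[OF y]
  have int: "integrable lebesgue (\<lambda>t. (cmod (y t))\<^sup>2)" "integrable lebesgue (\<lambda>t. (cmod (y' t))\<^sup>2)"
    using sobolevD[OF y] by (auto simp: square_integrable_def)
  have si: "set_integrable lebesgue A (\<lambda>t. a * (cmod (y t))\<^sup>2 + b * (cmod (y' t))\<^sup>2)" if "A \<in> sets lebesgue" for A a b
    unfolding set_integrable_def using int that by (intro integrable_mult_indicator) auto
  have P: "primitive (\<lambda>x. y x * cnj (y x)) (\<lambda>x. y' x * cnj (y x) + y x * cnj (y' x))"
    by (intro primitive_mult primitive_cnj sobolevD[OF y])
  define K where "K = (LINT t:{x..x + 1}|lebesgue. (1 / e) * (cmod (y t))\<^sup>2 + e * (cmod (y' t))\<^sup>2)"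
  have pw: "(cmod (y x))\<^sup>2 \<le> (cmod (y s))\<^sup>2 + K" if s: "s \<in> {x..x + 1}" for s
  proof -
    have "cmod (y s * cnj (y s) - y x * cnj (y x)) \<le> (LINT t:{x..s}|lebesgue. (1 / e) * (cmod (y t))\<^sup>2 + e * (cmod (y' t))\<^sup>2)"
      unfolding primitiveD(2)[OF P, of x s, simplified atLeastAtMost_iff, OF conjunct1[OF s[unfolded atLeastAtMost_iff]]]
        set_lebesgue_integral_def
    proof (rule Bochner_Integration.integral_norm_bound_integral)
      show "integrable lebesgue (\<lambda>t. indicat_real {x..s} t *\<^sub>R (y' t * cnj (y t) + y t * cnj (y' t)))"
        using locally_integrableD[OF primitiveD(1)[OF P]] by (simp add: set_integrable_def)
      show "integrable lebesgue (\<lambda>t. indicat_real {x..s} t *\<^sub>R ((1 / e) * (cmod (y t))\<^sup>2 + e * (cmod (y' t))\<^sup>2))"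
        using si[of "{x..s}" "1 / e" e] by (simp add: set_integrable_def)
      fix t
      have "cmod (y' t * cnj (y t) + y t * cnj (y' t)) \<le> 2 * (cmod (y t) * cmod (y' t))"
        using norm_triangle_ineq[of "y' t * cnj (y t)" "y t * cnj (y' t)"] by (simp add: norm_mult mult.commute)
      \<comment> \<open>This split of the product is the origin of the weights \<open>1 / e\<close>
        and \<open>e\<close>; it lets the coefficient of the derivative be made small.\<close>
      also have "\<dots> = 2 * (cmod (y t) / sqrt e) * (sqrt e * cmod (y' t))" using e by simp
      also have "\<dots> \<le> (cmod (y t) / sqrt e)\<^sup>2 + (sqrt e * cmod (y' t))\<^sup>2" by (rule sum_squares_bound)
      also have "\<dots> = (1 / e) * (cmod (y t))\<^sup>2 + e * (cmod (y' t))\<^sup>2"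
        using e by (simp add: power_divide power_mult_distrib)
      finally show "norm (indicat_real {x..s} t *\<^sub>R (y' t * cnj (y t) + y t * cnj (y' t))) \<le>
          indicat_real {x..s} t *\<^sub>R ((1 / e) * (cmod (y t))\<^sup>2 + e * (cmod (y' t))\<^sup>2)"
        by (simp add: indicator_def)
    qed
    also have "\<dots> \<le> K"
      unfolding K_def set_lebesgue_integral_def
      using si[of "{x..s}" "1 / e" e] si[of "{x..x+1}" "1 / e" e] s e
      by (intro integral_mono) (auto simp: set_integrable_def indicator_def)
    finally have "cmod (complex_of_real ((cmod (y s))\<^sup>2 - (cmod (y x))\<^sup>2)) \<le> K"
      by (simp only: of_real_diff complex_norm_square)
    then show ?thesis by (simp only: norm_of_real)
  qed
  have c: "set_integrable lebesgue {x..x + 1} (\<lambda>t. c)" for c :: real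
    by (intro absolutely_integrable_continuous_real continuous_intros)
  have lc: "(LINT t:{x..x+1}|lebesgue. c) = c" for c :: real
    unfolding set_lebesgue_integral_eq_integral(2)[OF c] by simp
  have "(cmod (y x))\<^sup>2 = (LINT t:{x..x+1}|lebesgue. (cmod (y x))\<^sup>2)" by (rule lc[symmetric])
  \<comment> \<open>The factors 1 and 0 bring the integrand to the shape covered by
    \<open>si\<close>.\<close>
  also have "\<dots> \<le> (LINT t:{x..x+1}|lebesgue. (1 * (cmod (y t))\<^sup>2 + 0 * (cmod (y' t))\<^sup>2) + K)"
    using pw by (intro set_integral_mono set_integral_add c si) auto
  also have "\<dots> = (LINT t:{x..x+1}|lebesgue. 1 * (cmod (y t))\<^sup>2 + 0 * (cmod (y' t))\<^sup>2) + K"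
    by (subst set_integral_add(2)[OF si c]) (simp_all only: lc sets_completionI_sets sets_lborel atLeastAtMost_borel)
  also have "\<dots> = (LINT t:{x..x + 1}|lebesgue. (1 + 1 / e) * (cmod (y t))\<^sup>2 + e * (cmod (y' t))\<^sup>2)"
    unfolding K_def by (subst set_integral_add(2)[OF si si, symmetric]) (auto simp: algebra_simps)
  finally show ?thesis .
qed

text \<open>The estimate is made first with extended nonnegative values, where integrability is not
  at issue; finiteness then yields integrability. The parameter \<open>e\<close> stays free so that
  the derivative can be absorbed later.\<close>

lemma sobolev_weight_bound:
  assumes y: "sobolev y y'" and p: "unif_weight p M" and e: "e > 0"
  shows "integrable lebesgue (\<lambda>x. p x * (cmod (y x))\<^sup>2)"
    and "(LINT x|lebesgue. p x * (cmod (y x))\<^sup>2) \<le>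
      M * ((1 + 1 / e) * (LINT x|lebesgue. (cmod (y x))\<^sup>2) + e * (LINT x|lebesgue. (cmod (y' x))\<^sup>2))"
proof -
  note [measurable] = sobolevD(4,5)[OF y]
  have pm [measurable]: "p \<in> borel_measurable lebesgue" and p0: "\<And>x. 0 \<le> p x" "0 \<le> M"
    using p by (auto simp: unif_weight_def)
  have int: "integrable lebesgue (\<lambda>t. (cmod (y t))\<^sup>2)" "integrable lebesgue (\<lambda>t. (cmod (y' t))\<^sup>2)"
    using sobolevD[OF y] by (auto simp: square_integrable_def)
  define h where "h t = (1 + 1 / e) * (cmod (y t))\<^sup>2 + e * (cmod (y' t))\<^sup>2" for t
  have h: "integrable lebesgue h" "\<And>t. 0 \<le> h t"
    using int e by (auto simp: h_def [abs_def])
  have [measurable]: "h \<in> borel_measurable lebesgue" using h(1) by simp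
  have "(\<integral>\<^sup>+x. ennreal (p x * (cmod (y x))\<^sup>2) \<partial>lebesgue) \<le>
      (\<integral>\<^sup>+x. ennreal (p x) * (\<integral>\<^sup>+t\<in>{x..x + 1}. ennreal (h t) \<partial>lebesgue) \<partial>lebesgue)"
  proof (rule nn_integral_mono)
    fix x
    have i: "integrable lebesgue (\<lambda>t. indicat_real {x..x + 1} t *\<^sub>R h t)"
      using h(1) by (intro integrable_mult_indicator) auto
    have "ennreal ((cmod (y x))\<^sup>2) \<le> ennreal (LINT t|lebesgue. indicat_real {x..x + 1} t *\<^sub>R h t)"
      using sobolev_pointwise_bound[OF y e, of x]
      by (intro ennreal_leI) (simp add: h_def set_lebesgue_integral_def)
    also have "\<dots> = (\<integral>\<^sup>+t. ennreal (indicat_real {x..x + 1} t *\<^sub>R h t) \<partial>lebesgue)"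
      using i h(2) by (intro nn_integral_eq_integral[symmetric]) auto
    also have "\<dots> = (\<integral>\<^sup>+t\<in>{x..x + 1}. ennreal (h t) \<partial>lebesgue)"
      by (intro nn_integral_cong) (auto simp: indicator_def)
    finally show "ennreal (p x * (cmod (y x))\<^sup>2) \<le> ennreal (p x) * (\<integral>\<^sup>+t\<in>{x..x + 1}. ennreal (h t) \<partial>lebesgue)"
      using p0 by (simp add: ennreal_mult mult_left_mono)
  qed
  also have "\<dots> \<le> ennreal M * (\<integral>\<^sup>+t. ennreal (h t) \<partial>lebesgue)"
    by (rule unif_weight_convolution_bound[OF p]) measurable
  also have "\<dots> = ennreal (M * (LINT t|lebesgue. h t))"
    using h p0(2) by (simp add: nn_integral_eq_integral ennreal_mult integral_nonneg_AE)
  finally have *: "(\<integral>\<^sup>+x. ennreal (p x * (cmod (y x))\<^sup>2) \<partial>lebesgue) \<le> ennreal (M * (LINT t|lebesgue. h t))" .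
  show i: "integrable lebesgue (\<lambda>x. p x * (cmod (y x))\<^sup>2)"
    using * p0 by (intro integrableI_bounded) (auto intro: le_less_trans)
  have "ennreal (LINT x|lebesgue. p x * (cmod (y x))\<^sup>2) \<le> ennreal (M * (LINT t|lebesgue. h t))"
    using * i p0 by (subst (asm) nn_integral_eq_integral) auto
  then have "(LINT x|lebesgue. p x * (cmod (y x))\<^sup>2) \<le> M * (LINT t|lebesgue. h t)"
    using h p0(2) by (simp add: ennreal_le_iff integral_nonneg_AE)
  also have "(LINT t|lebesgue. h t) = (1 + 1 / e) * (LINT x|lebesgue. (cmod (y x))\<^sup>2) + e * (LINT x|lebesgue. (cmod (y' x))\<^sup>2)"
    unfolding h_def using int by simp
  finally show "(LINT x|lebesgue. p x * (cmod (y x))\<^sup>2) \<le>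
      M * ((1 + 1 / e) * (LINT x|lebesgue. (cmod (y x))\<^sup>2) + e * (LINT x|lebesgue. (cmod (y' x))\<^sup>2))" .
qed

section \<open>The form\<close>

locale singular_potential =
  fixes \<sigma> \<tau> :: "real \<Rightarrow> real"
  assumes \<sigma>: "\<sigma> \<in> L2_unif" and \<tau>: "\<tau> \<in> L1_unif"
begin

lemma measurable_potential [measurable]:
  "\<sigma> \<in> borel_measurable lebesgue" "\<tau> \<in> borel_measurable lebesgue"
  using \<sigma> \<tau> by (auto simp: L2_unif_def L1_unif_def)

text \<open>One weight for both coefficients; the factor 4 is the price of spending only a quarter
  of the squared derivative in \<open>form_integrand_diag_bound\<close>.\<close>

definition weight :: "real \<Rightarrow> real" where
  "weight x = 4 * (\<sigma> x)\<^sup>2 + \<bar>\<tau> x\<bar>"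

text \<open>The four pairings under a single integral: algebraic identities between forms can then
  be checked pointwise.\<close>

definition form_integrand ::
    "(real \<Rightarrow> complex) \<Rightarrow> (real \<Rightarrow> complex) \<Rightarrow> (real \<Rightarrow> complex) \<Rightarrow> (real \<Rightarrow> complex) \<Rightarrow> real \<Rightarrow> complex" where
  "form_integrand y y' z z' x = y' x * cnj (z' x) - of_real (\<sigma> x) * y' x * cnj (z x)
     - of_real (\<sigma> x) * y x * cnj (z' x) + of_real (\<tau> x) * y x * cnj (z x)"

lemma integrable_weight:
  assumes "sobolev y y'"
  shows "integrable lebesgue (\<lambda>x. weight x * (cmod (y x))\<^sup>2)"
  using unif_weight_exists[OF \<sigma> \<tau>] sobolev_weight_bound(1)[OF assms _ zero_less_one]
  unfolding weight_def by blast

lemma square_integrable_sigma: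
  assumes "sobolev y y'"
  shows "square_integrable (\<lambda>x. of_real (\<sigma> x) * y x)"
  unfolding square_integrable_def
proof
  note [measurable] = sobolevD(4)[OF assms]
  show m: "(\<lambda>x. of_real (\<sigma> x) * y x) \<in> borel_measurable lebesgue" by measurable
  have "(cmod (of_real (\<sigma> x) * y x))\<^sup>2 \<le> weight x * (cmod (y x))\<^sup>2" for x
    unfolding weight_def norm_mult power_mult_distrib by (intro mult_right_mono) auto
  then show "integrable lebesgue (\<lambda>x. (cmod (of_real (\<sigma> x) * y x))\<^sup>2)"
    using m by (intro Bochner_Integration.integrable_bound[OF integrable_weight[OF assms]] AE_I2)
      (auto simp: weight_def)
qed

lemma integrable_tau:
  assumes "sobolev y y'" "sobolev z z'"
  shows "integrable lebesgue (\<lambda>x. of_real (\<tau> x) * y x * cnj (z x))"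
proof (rule Bochner_Integration.integrable_bound)
  note [measurable] = sobolevD(4)[OF assms(1)] sobolevD(4)[OF assms(2)]
  show "integrable lebesgue (\<lambda>x. weight x * (cmod (y x))\<^sup>2 + weight x * (cmod (z x))\<^sup>2)"
    using assms by (intro Bochner_Integration.integrable_add integrable_weight)
  show "(\<lambda>x. of_real (\<tau> x) * y x * cnj (z x)) \<in> borel_measurable lebesgue" by measurable
  show "AE x in lebesgue. norm (of_real (\<tau> x) * y x * cnj (z x)) \<le>
      norm (weight x * (cmod (y x))\<^sup>2 + weight x * (cmod (z x))\<^sup>2)"
  proof (intro AE_I2)
    fix x
    have "cmod (y x) * cmod (z x) \<le> (cmod (y x))\<^sup>2 + (cmod (z x))\<^sup>2"
      by (rule mult_le_sum_squares) auto
    then have "\<bar>\<tau> x\<bar> * (cmod (y x) * cmod (z x)) \<le> weight x * ((cmod (y x))\<^sup>2 + (cmod (z x))\<^sup>2)"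
      by (intro mult_mono) (auto simp: weight_def)
    then show "norm (of_real (\<tau> x) * y x * cnj (z x)) \<le>
        norm (weight x * (cmod (y x))\<^sup>2 + weight x * (cmod (z x))\<^sup>2)"
      by (simp add: norm_mult mult.assoc distrib_left)
  qed
qed

lemma form_integrable_terms:
  assumes y: "sobolev y y'" and z: "sobolev z z'"
  shows "integrable lebesgue (\<lambda>x. y' x * cnj (z' x))"
    "integrable lebesgue (\<lambda>x. of_real (\<sigma> x) * y' x * cnj (z x))"
    "integrable lebesgue (\<lambda>x. of_real (\<sigma> x) * y x * cnj (z' x))"
    "integrable lebesgue (\<lambda>x. of_real (\<tau> x) * y x * cnj (z x))"
  using square_integrable_mult[OF sobolevD(3)[OF y] sobolevD(3)[OF z]]
    square_integrable_mult[OF sobolevD(3)[OF y] square_integrable_sigma[OF z]]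
    square_integrable_mult[OF square_integrable_sigma[OF y] sobolevD(3)[OF z]]
    integrable_tau[OF y z]
  by (simp_all add: mult_ac)

lemma integrable_form_integrand:
  assumes "sobolev y y'" "sobolev z z'"
  shows "integrable lebesgue (form_integrand y y' z z')"
  unfolding form_integrand_def [abs_def] using form_integrable_terms[OF assms] by simp

lemma form_t_abs:
  assumes y: "sobolev y y'" and z: "sobolev z z'"
  shows "form_t \<sigma> \<tau> (abs_l2 y) (abs_l2 z) = (LINT x|lebesgue. form_integrand y y' z z' x)"
proof -
  note [measurable] = sobolevD(4,5)[OF y] sobolevD(4,5)[OF z]
  have [measurable]: "rep_l2 u \<in> borel_measurable lebesgue" for u
    by (intro square_integrable_measurable square_integrable_rep)
  note ae = rep_abs_l2[OF sobolevD(2)[OF y]] rep_abs_l2[OF sobolevD(3)[OF y]]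
    rep_abs_l2[OF sobolevD(2)[OF z]] rep_abs_l2[OF sobolevD(3)[OF z]]
  have "pairing (rep_l2 (abs_l2 y')) (rep_l2 (abs_l2 z')) = (LINT x|lebesgue. y' x * cnj (z' x))"
    unfolding pairing_def by (rule integral_cong_AE, measurable) (use ae(2,4) in \<open>eventually_elim, simp\<close>)
  moreover have "pairing (\<lambda>x. of_real (\<sigma> x) * rep_l2 (abs_l2 y') x) (rep_l2 (abs_l2 z)) =
      (LINT x|lebesgue. of_real (\<sigma> x) * y' x * cnj (z x))"
    unfolding pairing_def by (rule integral_cong_AE, measurable) (use ae(2,3) in \<open>eventually_elim, simp\<close>)
  moreover have "pairing (\<lambda>x. of_real (\<sigma> x) * rep_l2 (abs_l2 y) x) (rep_l2 (abs_l2 z')) =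
      (LINT x|lebesgue. of_real (\<sigma> x) * y x * cnj (z' x))"
    unfolding pairing_def by (rule integral_cong_AE, measurable) (use ae(1,4) in \<open>eventually_elim, simp\<close>)
  moreover have "pairing (\<lambda>x. of_real (\<tau> x) * rep_l2 (abs_l2 y) x) (rep_l2 (abs_l2 z)) =
      (LINT x|lebesgue. of_real (\<tau> x) * y x * cnj (z x))"
    unfolding pairing_def by (rule integral_cong_AE, measurable) (use ae(1,3) in \<open>eventually_elim, simp\<close>)
  ultimately show ?thesis
    unfolding form_t_def Let_def sobolev_W12(2)[OF y] sobolev_W12(2)[OF z] form_integrand_def
    using form_integrable_terms[OF y z] by simp
qed

lemma form_t_add:
  assumes "u \<in> W12" "v \<in> W12" "w \<in> W12"
  shows "form_t \<sigma> \<tau> (u + v) w = form_t \<sigma> \<tau> u w + form_t \<sigma> \<tau> v w"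
proof -
  obtain y y' where y: "sobolev y y'" "u = abs_l2 y" "l2_deriv u = abs_l2 y'" using W12E[OF assms(1)] .
  obtain z z' where z: "sobolev z z'" "v = abs_l2 z" "l2_deriv v = abs_l2 z'" using W12E[OF assms(2)] .
  obtain x x' where x: "sobolev x x'" "w = abs_l2 x" "l2_deriv w = abs_l2 x'" using W12E[OF assms(3)] .
  have "u + v = abs_l2 (\<lambda>s. y s + z s)" using y z by (simp add: add_abs_l2 sobolevD)
  moreover have "form_integrand (\<lambda>s. y s + z s) (\<lambda>s. y' s + z' s) x x' s =
      form_integrand y y' x x' s + form_integrand z z' x x' s" for s
    by (simp add: form_integrand_def algebra_simps)
  ultimately show ?thesis
    using y(1) z(1) x(1) unfolding y(2) z(2) x(2)
    by (simp add: form_t_abs[OF sobolev_add[OF y(1) z(1)] x(1)] form_t_abs integrable_form_integrand)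
qed

lemma form_t_scaleC:
  assumes "u \<in> W12" "w \<in> W12"
  shows "form_t \<sigma> \<tau> (scaleC c u) w = c * form_t \<sigma> \<tau> u w"
proof -
  obtain y y' where y: "sobolev y y'" "u = abs_l2 y" "l2_deriv u = abs_l2 y'" using W12E[OF assms(1)] .
  obtain x x' where x: "sobolev x x'" "w = abs_l2 x" "l2_deriv w = abs_l2 x'" using W12E[OF assms(2)] .
  have "scaleC c u = abs_l2 (\<lambda>s. c * y s)" using y by (simp add: scaleC_abs_l2 sobolevD)
  moreover have "form_integrand (\<lambda>s. c * y s) (\<lambda>s. c * y' s) x x' s = c * form_integrand y y' x x' s" for s
    by (simp add: form_integrand_def algebra_simps)
  ultimately show ?thesis
    unfolding y(2) x(2)
    by (simp add: form_t_abs[OF sobolev_cmult[OF y(1)] x(1)] form_t_abs[OF y(1) x(1)])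
qed

lemma form_t_commute:
  assumes "u \<in> W12" "v \<in> W12"
  shows "form_t \<sigma> \<tau> u v = cnj (form_t \<sigma> \<tau> v u)"
proof -
  obtain y y' where y: "sobolev y y'" "u = abs_l2 y" "l2_deriv u = abs_l2 y'" using W12E[OF assms(1)] .
  obtain z z' where z: "sobolev z z'" "v = abs_l2 z" "l2_deriv v = abs_l2 z'" using W12E[OF assms(2)] .
  have "form_integrand y y' z z' = (\<lambda>s. cnj (form_integrand z z' y y' s))"
    by (simp add: form_integrand_def algebra_simps fun_eq_iff)
  then show ?thesis
    unfolding y(2) z(2) form_t_abs[OF y(1) z(1)] form_t_abs[OF z(1) y(1)]
    by (simp only: Bochner_Integration.integral_cnj)
qed

text \<open>The mixed terms are read as twice the product of \<open>cmod (y' x) / 2\<close> and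
  \<open>2 * (\<bar>\<sigma> x\<bar> * cmod (y x))\<close>, whose squares carry the factors 1/4 and
  4.\<close>

lemma form_integrand_diag_bound:
  "cmod (form_integrand y y' y y' x - of_real ((cmod (y' x))\<^sup>2)) \<le>
    1 / 4 * (cmod (y' x))\<^sup>2 + weight x * (cmod (y x))\<^sup>2"
proof -
  have "form_integrand y y' y y' x - of_real ((cmod (y' x))\<^sup>2) =
      of_real (\<tau> x) * y x * cnj (y x) - (of_real (\<sigma> x) * y' x * cnj (y x) + of_real (\<sigma> x) * y x * cnj (y' x))"
    unfolding complex_norm_square form_integrand_def by simp
  also have "cmod \<dots> \<le> \<bar>\<tau> x\<bar> * (cmod (y x))\<^sup>2 + 2 * (cmod (y' x) / 2) * (2 * (\<bar>\<sigma> x\<bar> * cmod (y x)))"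
    by (rule order_trans[OF norm_triangle_ineq4 add_mono[OF _ order_trans[OF norm_triangle_ineq]]])
      (simp_all add: norm_mult power2_eq_square)
  also have "2 * (cmod (y' x) / 2) * (2 * (\<bar>\<sigma> x\<bar> * cmod (y x))) \<le>
      (cmod (y' x) / 2)\<^sup>2 + (2 * (\<bar>\<sigma> x\<bar> * cmod (y x)))\<^sup>2"
    by (rule sum_squares_bound)
  finally show ?thesis
    by (simp add: weight_def power_mult_distrib power_divide algebra_simps)
qed

lemma form_t_bound:
  obtains c where "0 \<le> c"
    "\<And>u. u \<in> W12 \<Longrightarrow> cmod (form_t \<sigma> \<tau> u u - of_real ((norm (l2_deriv u))\<^sup>2)) \<le>
       1 / 2 * (norm (l2_deriv u))\<^sup>2 + c * (norm u)\<^sup>2"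
proof -
  obtain M where M: "unif_weight weight M"
    using unif_weight_exists[OF \<sigma> \<tau>] unfolding weight_def [abs_def] by blast
  then have M0: "0 \<le> M" by (simp add: unif_weight_def)
  \<comment> \<open>Makes \<open>M * e\<close> at most 1/4, which together with the quarter from
    \<open>form_integrand_diag_bound\<close> gives 1/2; \<open>M + 1\<close> excludes division by
    0.\<close>
  define e where "e = 1 / (4 * (M + 1))"
  have e: "e > 0" using M0 by (simp add: e_def)
  have Me: "M * e \<le> 1 / 4" using M0 by (simp add: e_def field_simps)
  show ?thesis
  proof (rule that[of "M * (1 + 1 / e)"])
    show "0 \<le> M * (1 + 1 / e)" using M0 e by (intro mult_nonneg_nonneg add_nonneg_nonneg) auto
    fix u assume "u \<in> W12"
    then obtain y y' where y: "sobolev y y'" "u = abs_l2 y" "l2_deriv u = abs_l2 y'" using W12E by blast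
    have int: "integrable lebesgue (\<lambda>t. (cmod (y t))\<^sup>2)" "integrable lebesgue (\<lambda>t. (cmod (y' t))\<^sup>2)"
      using sobolevD[OF y(1)] by (auto simp: square_integrable_def)
    let ?n = "LINT x|lebesgue. (cmod (y x))\<^sup>2" and ?N = "LINT x|lebesgue. (cmod (y' x))\<^sup>2"
    have n: "(norm u)\<^sup>2 = ?n" "(norm (l2_deriv u))\<^sup>2 = ?N"
      unfolding y(3) unfolding y(2) using sobolevD[OF y(1)] by (simp_all only: norm_abs_l2)
    have eq: "form_t \<sigma> \<tau> u u - of_real ?N =
        (LINT x|lebesgue. form_integrand y y' y y' x - of_real ((cmod (y' x))\<^sup>2))"
      unfolding y(2) form_t_abs[OF y(1) y(1)] integral_complex_of_real[symmetric]
      using int(2) by (intro Bochner_Integration.integral_diff[symmetric] integrable_form_integrand y)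
        (simp only: complex_of_real_integrable_eq)
    have "cmod (form_t \<sigma> \<tau> u u - of_real ?N) \<le> (LINT x|lebesgue. 1 / 4 * (cmod (y' x))\<^sup>2 + weight x * (cmod (y x))\<^sup>2)"
      unfolding eq
    proof (rule Bochner_Integration.integral_norm_bound_integral)
      show "integrable lebesgue (\<lambda>x. form_integrand y y' y y' x - of_real ((cmod (y' x))\<^sup>2))"
        using int(2) by (intro Bochner_Integration.integrable_diff integrable_form_integrand y)
          (simp only: complex_of_real_integrable_eq)
      show "integrable lebesgue (\<lambda>x. 1 / 4 * (cmod (y' x))\<^sup>2 + weight x * (cmod (y x))\<^sup>2)"
        using int(2) integrable_weight[OF y(1)] by simp
    qed (rule form_integrand_diag_bound)
    moreover have "(LINT x|lebesgue. 1 / 4 * (cmod (y' x))\<^sup>2 + weight x * (cmod (y x))\<^sup>2) =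
        1 / 4 * ?N + (LINT x|lebesgue. weight x * (cmod (y x))\<^sup>2)"
      using int(2) integrable_weight[OF y(1)] by simp
    moreover have "(LINT x|lebesgue. weight x * (cmod (y x))\<^sup>2) \<le> M * ((1 + 1 / e) * ?n + e * ?N)"
      by (rule sobolev_weight_bound(2)[OF y(1) M e])
    moreover have "M * ((1 + 1 / e) * ?n + e * ?N) = (M * e) * ?N + M * (1 + 1 / e) * ?n"
      by (simp only: algebra_simps)
    moreover have "(M * e) * ?N \<le> 1 / 4 * ?N"
      by (intro mult_right_mono Me) auto
    ultimately have "cmod (form_t \<sigma> \<tau> u u - of_real ?N) \<le> 1 / 2 * ?N + M * (1 + 1 / e) * ?n"
      by linarith
    then show "cmod (form_t \<sigma> \<tau> u u - of_real ((norm (l2_deriv u))\<^sup>2)) \<le>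
        1 / 2 * (norm (l2_deriv u))\<^sup>2 + M * (1 + 1 / e) * (norm u)\<^sup>2"
      unfolding n .
  qed
qed

text \<open>The coercive side of \<open>form_t_bound\<close>. It yields semiboundedness, the Cauchy
  property of derivatives, and the energy bound for cut off elements of the domain of
  \<open>S\<close>.\<close>

lemma form_t_lower_bound:
  obtains c where "0 \<le> c"
    "\<And>u. u \<in> W12 \<Longrightarrow> 1 / 2 * (norm (l2_deriv u))\<^sup>2 \<le> Re (form_t \<sigma> \<tau> u u) + c * (norm u)\<^sup>2"
proof -
  obtain c where c: "0 \<le> c"
    "\<And>u. u \<in> W12 \<Longrightarrow> cmod (form_t \<sigma> \<tau> u u - of_real ((norm (l2_deriv u))\<^sup>2)) \<le>
       1 / 2 * (norm (l2_deriv u))\<^sup>2 + c * (norm u)\<^sup>2"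
    using form_t_bound by blast
  show ?thesis
  proof (rule that[OF c(1)])
    fix u assume "u \<in> W12"
    from c(2)[OF this] abs_Re_le_cmod[of "form_t \<sigma> \<tau> u u - of_real ((norm (l2_deriv u))\<^sup>2)"]
    show "1 / 2 * (norm (l2_deriv u))\<^sup>2 \<le> Re (form_t \<sigma> \<tau> u u) + c * (norm u)\<^sup>2"
      by simp
  qed
qed

lemma form_t_bounded_below: "form_bounded_below W12 (form_t \<sigma> \<tau>)"
proof -
  obtain c where c: "0 \<le> c"
    "\<And>u. u \<in> W12 \<Longrightarrow> 1 / 2 * (norm (l2_deriv u))\<^sup>2 \<le> Re (form_t \<sigma> \<tau> u u) + c * (norm u)\<^sup>2"
    using form_t_lower_bound by blast
  have "form_t \<sigma> \<tau> u u \<in> \<real> \<and> - c * (norm u)\<^sup>2 \<le> Re (form_t \<sigma> \<tau> u u)" if "u \<in> W12" for u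
  proof
    show "form_t \<sigma> \<tau> u u \<in> \<real>"
      using form_t_commute[OF that that] by (simp add: Reals_cnj_iff)
    show "- c * (norm u)\<^sup>2 \<le> Re (form_t \<sigma> \<tau> u u)"
      using c(2)[OF that] zero_le_power2[of "norm (l2_deriv u)"] by linarith
  qed
  then show ?thesis unfolding form_bounded_below_def by blast
qed

text \<open>Convergence in norm and smallness of the form on differences make the derivatives Cauchy
  by the lower bound, and \<open>W12_closed\<close> identifies their limit. The two-sided bound then
  forces the form on \<open>X n - x\<close> to 0.\<close>

lemma form_t_closed: "closed_form W12 (form_t \<sigma> \<tau>)"
  unfolding closed_form_def
proof (intro allI impI)
  fix X :: "nat \<Rightarrow> l2" and x
  assume X: "\<forall>n. X n \<in> W12" and x: "X \<longlonglongrightarrow> x"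
    and C: "\<forall>e>0. \<exists>N. \<forall>m\<ge>N. \<forall>n\<ge>N. cmod (form_t \<sigma> \<tau> (X m - X n) (X m - X n)) < e"
  obtain c where c: "0 \<le> c"
    "\<And>u. u \<in> W12 \<Longrightarrow> 1 / 2 * (norm (l2_deriv u))\<^sup>2 \<le> Re (form_t \<sigma> \<tau> u u) + c * (norm u)\<^sup>2"
    using form_t_lower_bound by blast
  have "Cauchy (\<lambda>n. l2_deriv (X n))"
    unfolding Cauchy_def dist_norm
  proof (intro allI impI)
    fix e :: real assume "e > 0"
    \<comment> \<open>Half the squared derivative is bounded by the form plus \<open>c\<close> times
      the squared norm; each gets a share \<open>e\<^sup>2 / 4\<close>. Using \<open>c + 1\<close>
      avoids a division by 0 when \<open>c = 0\<close>.\<close>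
    then have e: "e\<^sup>2 / 4 > 0" "e / (2 * sqrt (c + 1)) > 0" using c(1) by auto
    obtain N1 where N1: "\<And>m n. m \<ge> N1 \<Longrightarrow> n \<ge> N1 \<Longrightarrow> cmod (form_t \<sigma> \<tau> (X m - X n) (X m - X n)) < e\<^sup>2 / 4"
      using C e(1) by meson
    obtain N2 where N2: "\<And>m n. m \<ge> N2 \<Longrightarrow> n \<ge> N2 \<Longrightarrow> norm (X m - X n) < e / (2 * sqrt (c + 1))"
      using LIMSEQ_imp_Cauchy[OF x] e(2) unfolding Cauchy_def dist_norm by meson
    have "norm (l2_deriv (X m) - l2_deriv (X n)) < e" if mn: "m \<ge> max N1 N2" "n \<ge> max N1 N2" for m n
    proof -
      have d: "X m - X n \<in> W12" "l2_deriv (X m - X n) = l2_deriv (X m) - l2_deriv (X n)"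
        using W12_diff X by blast+
      have "(norm (X m - X n))\<^sup>2 \<le> (e / (2 * sqrt (c + 1)))\<^sup>2"
        using N2[of m n] mn by (intro power_mono) auto
      then have "(c + 1) * (norm (X m - X n))\<^sup>2 \<le> (c + 1) * (e\<^sup>2 / (4 * (c + 1)))"
        using c(1) by (intro mult_left_mono) (auto simp: power_divide power_mult_distrib)
      moreover have "(c + 1) * (e\<^sup>2 / (4 * (c + 1))) = e\<^sup>2 / 4" using c(1) by (simp add: divide_simps)
      ultimately have "(c + 1) * (norm (X m - X n))\<^sup>2 \<le> e\<^sup>2 / 4" by (rule ord_le_eq_trans)
      then have "c * (norm (X m - X n))\<^sup>2 \<le> e\<^sup>2 / 4"
        using zero_le_power2[of "norm (X m - X n)"] unfolding distrib_right by linarith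
      moreover have "Re (form_t \<sigma> \<tau> (X m - X n) (X m - X n)) < e\<^sup>2 / 4"
        using N1[of m n] mn complex_Re_le_cmod[of "form_t \<sigma> \<tau> (X m - X n) (X m - X n)"] by simp
      ultimately have "(norm (l2_deriv (X m) - l2_deriv (X n)))\<^sup>2 < e\<^sup>2"
        using c(2)[OF d(1)] unfolding d(2) by simp
      then show ?thesis using \<open>e > 0\<close> by (meson less_imp_le power2_less_imp_less)
    qed
    then show "\<exists>M. \<forall>m\<ge>M. \<forall>n\<ge>M. norm (l2_deriv (X m) - l2_deriv (X n)) < e"
      by (intro exI[of _ "max N1 N2"] allI impI)
  qed
  then obtain v where v: "(\<lambda>n. l2_deriv (X n)) \<longlonglongrightarrow> v"
    using Cauchy_convergent convergent_def by blast
  have W: "x \<in> W12" "l2_deriv x = v" using W12_closed[OF _ x v] X by auto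
  obtain c' where c': "0 \<le> c'"
    "\<And>u. u \<in> W12 \<Longrightarrow> cmod (form_t \<sigma> \<tau> u u - of_real ((norm (l2_deriv u))\<^sup>2)) \<le>
       1 / 2 * (norm (l2_deriv u))\<^sup>2 + c' * (norm u)\<^sup>2"
    using form_t_bound by blast
  have "(\<lambda>n. form_t \<sigma> \<tau> (X n - x) (X n - x)) \<longlonglongrightarrow> 0"
  proof (rule Lim_null_comparison)
    \<comment> \<open>3/2 is the 1/2 of the two-sided bound plus the square of the derivative that
      was subtracted there.\<close>
    have "norm (form_t \<sigma> \<tau> (X n - x) (X n - x)) \<le> 3 / 2 * (norm (l2_deriv (X n) - v))\<^sup>2 + c' * (norm (X n - x))\<^sup>2" for n
    proof -
      have d: "X n - x \<in> W12" "l2_deriv (X n - x) = l2_deriv (X n) - v"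
        using W12_diff X W by auto
      have "norm (form_t \<sigma> \<tau> (X n - x) (X n - x)) \<le>
          cmod (form_t \<sigma> \<tau> (X n - x) (X n - x) - of_real ((norm (l2_deriv (X n - x)))\<^sup>2)) + (norm (l2_deriv (X n - x)))\<^sup>2"
        using norm_triangle_ineq[of "form_t \<sigma> \<tau> (X n - x) (X n - x) - of_real ((norm (l2_deriv (X n - x)))\<^sup>2)"
            "of_real ((norm (l2_deriv (X n - x)))\<^sup>2)"] by (simp add: norm_power)
      then show ?thesis using c'(2)[OF d(1)] unfolding d(2) by linarith
    qed
    then show "\<forall>\<^sub>F n in sequentially. norm (form_t \<sigma> \<tau> (X n - x) (X n - x)) \<le>
        3 / 2 * (norm (l2_deriv (X n) - v))\<^sup>2 + c' * (norm (X n - x))\<^sup>2" by simp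
    have "(\<lambda>n. 3 / 2 * (norm (l2_deriv (X n) - v))\<^sup>2 + c' * (norm (X n - x))\<^sup>2) \<longlonglongrightarrow>
        3 / 2 * (norm (v - v))\<^sup>2 + c' * (norm (x - x))\<^sup>2"
      by (intro tendsto_intros v x)
    then show "(\<lambda>n. 3 / 2 * (norm (l2_deriv (X n) - v))\<^sup>2 + c' * (norm (X n - x))\<^sup>2) \<longlonglongrightarrow> 0" by simp
  qed
  with W show "x \<in> W12 \<and> (\<lambda>n. form_t \<sigma> \<tau> (X n - x) (X n - x)) \<longlonglongrightarrow> 0" by simp
qed

sublocale closed_semibounded_form W12 "form_t \<sigma> \<tau>"
proof
  show "h = 0" if "\<And>v. v \<in> W12 \<Longrightarrow> cinner h v = 0" for h
    using that by (rule W12_orthogonal)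
qed (fact W12_0 W12_add(1) W12_scaleC(1) form_t_add form_t_scaleC form_t_commute
    form_t_closed form_t_bounded_below)+

end

section \<open>Cutoff functions\<close>

text \<open>Squaring the positive part of the parabola makes the function continuously
  differentiable at both ends of its support, which is enough for a primitive, and keeps the
  derivative explicit enough for the bound \<open>4 / R\<close>.\<close>

definition cutoff :: "real \<Rightarrow> real \<Rightarrow> real" where
  "cutoff R x = (max 0 (1 - (x / R)\<^sup>2))\<^sup>2"

definition cutoff_deriv :: "real \<Rightarrow> real \<Rightarrow> real" where
  "cutoff_deriv R x = 2 * max 0 (1 - (x / R)\<^sup>2) * (- 2 * x / R\<^sup>2)"

lemma has_derivative_max_0_square:
  "((\<lambda>s::real. (max 0 s)\<^sup>2) has_real_derivative 2 * max 0 s) (at s)"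
proof -
  consider "s > 0" | "s < 0" | "s = 0" by linarith
  then show ?thesis
  proof cases
    case 1
    have "((\<lambda>s::real. s\<^sup>2) has_real_derivative 2 * s) (at s)"
      by (auto intro!: derivative_eq_intros)
    then have "((\<lambda>s::real. (max 0 s)\<^sup>2) has_real_derivative 2 * s) (at s)"
      by (rule has_field_derivative_transform_within_open[of _ _ _ "{0<..}"]) (use 1 in auto)
    then show ?thesis using 1 by simp
  next
    case 2
    have "((\<lambda>s::real. 0) has_real_derivative 0) (at s)" by simp
    then have "((\<lambda>s::real. (max 0 s)\<^sup>2) has_real_derivative 0) (at s)"
      by (rule has_field_derivative_transform_within_open[of _ _ _ "{..<0}"]) (use 2 in auto)
    then show ?thesis using 2 by simp
  next
    case 3
    have "((\<lambda>h::real. ((max 0 (0 + h))\<^sup>2 - (max 0 0)\<^sup>2) / h) \<longlongrightarrow> 0) (at 0)"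
    proof (rule Lim_null_comparison)
      show "\<forall>\<^sub>F h in at (0::real). norm (((max 0 (0 + h))\<^sup>2 - (max 0 0)\<^sup>2) / h) \<le> \<bar>h\<bar>"
        by (intro always_eventually allI) (auto simp: max_def power2_eq_square)
      show "((\<lambda>h::real. \<bar>h\<bar>) \<longlongrightarrow> 0) (at 0)"
        using tendsto_rabs[OF tendsto_ident_at[of "0::real" UNIV]] by simp
    qed
    then show ?thesis using 3 by (simp add: DERIV_def)
  qed
qed

lemma cutoff_has_derivative:
  assumes "R > 0"
  shows "(cutoff R has_real_derivative cutoff_deriv R x) (at x)"
proof -
  have "((\<lambda>x. 1 - (x / R)\<^sup>2) has_real_derivative - 2 * x / R\<^sup>2) (at x)"
    using assms by (auto intro!: derivative_eq_intros simp: power2_eq_square)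
  from DERIV_chain2[OF has_derivative_max_0_square this]
  show ?thesis by (simp add: cutoff_def [abs_def] cutoff_deriv_def)
qed

lemma cutoff_bounds: "0 \<le> cutoff R x" "cutoff R x \<le> 1"
  by (auto simp: cutoff_def intro!: power_le_one)

lemma cutoff_eq_0:
  assumes "R > 0" "\<bar>x\<bar> \<ge> R"
  shows "cutoff R x = 0" "cutoff_deriv R x = 0"
proof -
  have "1\<^sup>2 \<le> \<bar>x / R\<bar>\<^sup>2" using assms by (intro power_mono) auto
  then have "1 \<le> (x / R)\<^sup>2" by (simp only: power2_abs one_power2)
  then show "cutoff R x = 0" "cutoff_deriv R x = 0" by (simp_all add: cutoff_def cutoff_deriv_def)
qed

lemma cutoff_deriv_bound:
  assumes "R > 0"
  shows "\<bar>cutoff_deriv R x\<bar> \<le> 4 / R"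
proof (cases "\<bar>x\<bar> \<ge> R")
  case True
  then show ?thesis using assms by (simp add: cutoff_eq_0)
next
  case False
  have "\<bar>cutoff_deriv R x\<bar> = max 0 (1 - (x / R)\<^sup>2) * (4 * \<bar>x\<bar> / R\<^sup>2)"
    by (simp add: cutoff_deriv_def abs_mult)
  also have "\<dots> \<le> 1 * (4 * \<bar>x\<bar> / R\<^sup>2)" by (intro mult_right_mono) auto
  also have "\<dots> \<le> 4 * R / R\<^sup>2" using False by (simp add: divide_right_mono)
  also have "\<dots> = 4 / R" using assms by (simp add: power2_eq_square)
  finally show ?thesis .
qed

lemma cutoff_ge_half:
  assumes "R > 0" "\<bar>x\<bar> \<le> R / 2"
  shows "1 / 2 \<le> cutoff R x"
proof -
  have "\<bar>x / R\<bar>\<^sup>2 \<le> (1 / 2)\<^sup>2" using assms by (intro power_mono) (auto simp: field_simps)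
  then have "(x / R)\<^sup>2 \<le> 1 / 4" by (simp add: power2_eq_square)
  then have "(3 / 4)\<^sup>2 \<le> cutoff R x" unfolding cutoff_def by (intro power_mono) auto
  then show ?thesis by (simp add: power2_eq_square)
qed

text \<open>The radii start at 4 because the derivative is bounded by \<open>4 / R\<close>: all
  cutoffs in the sequence have derivative at most 1 in modulus.\<close>

lemma cutoff_tendsto: "(\<lambda>n. cutoff (real n + 4) x) \<longlonglongrightarrow> 1"
proof -
  have *: "(\<lambda>n. x / (real n + 4)) \<longlonglongrightarrow> 0"
    by (intro tendsto_divide_0[OF tendsto_const] filterlim_at_top_imp_at_infinity
        filterlim_at_top_mono[OF filterlim_real_sequentially]) simp
  have "(\<lambda>n. (max 0 (1 - (x / (real n + 4))\<^sup>2))\<^sup>2) \<longlonglongrightarrow> (max 0 (1 - 0\<^sup>2))\<^sup>2"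
    by (intro tendsto_intros *)
  then show ?thesis by (simp add: cutoff_def)
qed

lemma cutoff_deriv_tendsto: "(\<lambda>n. cutoff_deriv (real n + 4) x) \<longlonglongrightarrow> 0"
proof (rule Lim_null_comparison)
  show "\<forall>\<^sub>F n in sequentially. norm (cutoff_deriv (real n + 4) x) \<le> 4 * inverse (real (Suc n))"
  proof (intro always_eventually allI)
    fix n
    have "\<bar>cutoff_deriv (real n + 4) x\<bar> \<le> 4 / (real n + 4)" by (rule cutoff_deriv_bound) simp
    also have "\<dots> \<le> 4 / real (Suc n)" by (intro divide_left_mono) auto
    finally show "norm (cutoff_deriv (real n + 4) x) \<le> 4 * inverse (real (Suc n))"
      by (simp add: divide_inverse)
  qed
  show "(\<lambda>n. 4 * inverse (real (Suc n))) \<longlonglongrightarrow> 0"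
    using tendsto_mult_right_zero[OF LIMSEQ_inverse_real_of_nat, of 4] by simp
qed

lemma continuous_cutoff_deriv: "R > 0 \<Longrightarrow> continuous_on UNIV (\<lambda>x. complex_of_real (cutoff_deriv R x))"
  unfolding cutoff_deriv_def by (intro continuous_intros) auto

lemma primitive_cutoff:
  assumes "R > 0"
  shows "primitive (\<lambda>x. of_real (cutoff R x)) (\<lambda>x. of_real (cutoff_deriv R x))"
proof (rule primitive_C1)
  show "((\<lambda>x. complex_of_real (cutoff R x)) has_vector_derivative of_real (cutoff_deriv R x)) (at x)" for x
    using cutoff_has_derivative[OF assms]
    by (intro has_vector_derivative_of_real) (simp add: has_real_derivative_iff_has_vector_derivative)
qed (rule continuous_cutoff_deriv[OF assms])

lemma square_integrable_continuous_bounded_support: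
  assumes f: "continuous_on UNIV f" and supp: "\<And>x. x \<notin> {a..b} \<Longrightarrow> f x = 0"
  shows "square_integrable f"
proof -
  have "integrable lebesgue (\<lambda>x. f x * cnj (f x))"
    using supp by (intro integrable_bounded_support[of _ a b] locally_integrable_continuous continuous_intros f) auto
  moreover have "(\<lambda>x. f x * cnj (f x)) = (\<lambda>x. complex_of_real ((cmod (f x))\<^sup>2))"
    by (simp only: complex_norm_square)
  ultimately have "integrable lebesgue (\<lambda>x. (cmod (f x))\<^sup>2)"
    by (simp only: complex_of_real_integrable_eq)
  then show ?thesis
    using borel_measurable_continuous_onI[OF f] by (simp add: square_integrable_def measurable_completion)
qed

lemma sobolev_cutoff:
  assumes "R > 0"
  shows "sobolev (\<lambda>x. of_real (cutoff R x)) (\<lambda>x. of_real (cutoff_deriv R x))"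
proof -
  have "R \<le> \<bar>x\<bar>" if "x \<notin> {- R..R}" for x using that by auto
  then have "square_integrable (\<lambda>x. complex_of_real (cutoff R x))"
    "square_integrable (\<lambda>x. complex_of_real (cutoff_deriv R x))"
    using cutoff_eq_0[OF assms] continuous_cutoff_deriv[OF assms] primitive_continuous[OF primitive_cutoff[OF assms]]
    by (auto intro!: square_integrable_continuous_bounded_support[of _ "- R" R])
  then show ?thesis using primitive_cutoff[OF assms] by (simp add: sobolev_def)
qed

text \<open>A cutoff is at least 1/2 on the inner half of its support, so it can be divided out
  there. In this way global facts about pairs in \<open>sobolev\<close> yield local
  integrability.\<close>

lemma locally_integrable_cutoffI:
  assumes m: "f \<in> borel_measurable lebesgue"
    and i: "\<And>R. R > 0 \<Longrightarrow> integrable lebesgue (\<lambda>x. of_real (cutoff R x) * f x)"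
  shows "locally_integrable f"
proof (rule locally_integrableI_bound[OF m])
  fix a b :: real
  define R where "R = 2 * (\<bar>a\<bar> + \<bar>b\<bar> + 1)"
  have R: "R > 0" by (simp add: R_def)
  have "set_integrable lebesgue {a..b} (\<lambda>x. 2 * cmod (of_real (cutoff R x) * f x))"
    unfolding set_integrable_def using i[OF R] by (intro integrable_mult_indicator) auto
  moreover have "cmod (f x) \<le> 2 * cmod (of_real (cutoff R x) * f x)" if "x \<in> {a..b}" for x
  proof -
    have "\<bar>x\<bar> \<le> R / 2" using that by (auto simp: R_def)
    then have "1 / 2 * cmod (f x) \<le> cutoff R x * cmod (f x)"
      using cutoff_ge_half[OF R] by (intro mult_right_mono) auto
    then show ?thesis using cutoff_bounds(1)[of R x] by (simp add: norm_mult)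
  qed
  ultimately show "\<exists>g. set_integrable lebesgue {a..b} g \<and>
      (AE x in lebesgue. x \<in> {a..b} \<longrightarrow> cmod (f x) \<le> (g x :: real))"
    by blast
qed

section \<open>The differential operator\<close>

context singular_potential
begin

section \<open>Local integrability of the terms with coefficients\<close>

lemma locally_integrable_sigma_mult:
  assumes "square_integrable f"
  shows "locally_integrable (\<lambda>x. of_real (\<sigma> x) * f x)"
proof (rule locally_integrable_cutoffI)
  note [measurable] = square_integrable_measurable[OF assms]
  show "(\<lambda>x. of_real (\<sigma> x) * f x) \<in> borel_measurable lebesgue" by measurable
  fix R :: real assume "R > 0"
  have "square_integrable (\<lambda>x. cnj (of_real (\<sigma> x) * of_real (cutoff R x)))"
    using \<open>R > 0\<close> by (intro square_integrable_cnj square_integrable_sigma[OF sobolev_cutoff])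
  from square_integrable_mult[OF assms this]
  show "integrable lebesgue (\<lambda>x. of_real (cutoff R x) * (of_real (\<sigma> x) * f x))"
    by (simp add: mult_ac)
qed

lemma locally_integrable_tau_mult:
  assumes "sobolev y y'"
  shows "locally_integrable (\<lambda>x. of_real (\<tau> x) * y x)"
proof (rule locally_integrable_cutoffI)
  note [measurable] = sobolevD(4)[OF assms]
  show "(\<lambda>x. of_real (\<tau> x) * y x) \<in> borel_measurable lebesgue" by measurable
  fix R :: real assume "R > 0"
  from integrable_tau[OF assms sobolev_cutoff[OF this]]
  show "integrable lebesgue (\<lambda>x. of_real (cutoff R x) * (of_real (\<tau> x) * y x))"
    by (simp add: mult_ac)
qed

text \<open>Testing with smooth functions says that \<open>w0\<close>, the quasi-derivative, has the
  weak derivative \<open>w1\<close>, so its continuous representative can serve as the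
  \<open>w\<close> in \<open>op_S\<close>.\<close>

lemma form_operator_subset_op_S: "form_operator \<subseteq> op_S \<sigma> \<tau>"
proof (rule subrelI)
  fix u f assume "(u, f) \<in> form_operator"
  then have u: "u \<in> W12" and t: "\<And>v. v \<in> W12 \<Longrightarrow> cinner f v = form_t \<sigma> \<tau> u v"
    by (auto simp: form_operator_def)
  obtain y y' where y: "sobolev y y'" "u = abs_l2 y" "l2_deriv u = abs_l2 y'" using W12E[OF u] .
  note [measurable] = sobolevD(4,5)[OF y(1)]
  define g where "g = rep_l2 f"
  have g: "square_integrable g" "f = abs_l2 g" by (simp_all add: g_def square_integrable_rep abs_rep_l2)
  define w0 where "w0 x = y' x - of_real (\<sigma> x) * y x" for x
  \<comment> \<open>Obtained by solving \<open>Su = g\<close> for the derivative of the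
    quasi-derivative; with this choice the differential expression equals \<open>g\<close>
    identically.\<close>
  define w1 where "w1 x = - g x - of_real (\<sigma> x) * y' x + of_real (\<tau> x) * y x" for x
  have lw0: "locally_integrable w0"
    unfolding w0_def [abs_def] using y(1)
    by (intro square_integrable_locally_integrable square_integrable_diff square_integrable_sigma sobolevD(3))
  have lw1: "locally_integrable w1"
    unfolding w1_def [abs_def]
    by (intro locally_integrable_add locally_integrable_diff locally_integrable_uminus
        locally_integrable_sigma_mult[OF sobolevD(3)[OF y(1)]] locally_integrable_tau_mult[OF y(1)]
        square_integrable_locally_integrable[OF g(1)])
  have "w0 has_distr_deriv w1"
    unfolding has_distr_deriv_def
  proof (intro conjI lw0 lw1 allI impI)
    fix \<phi> assume \<phi>: "test_function \<phi>"
    let ?z = "\<lambda>x. cnj (\<phi> x)" and ?z' = "\<lambda>x. cnj (vderiv \<phi> x)"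
    have z: "sobolev ?z ?z'"
      using test_function_sobolev[OF \<phi>] by (simp add: sobolev_def primitive_cnj square_integrable_cnj)
    have "(LINT x|lebesgue. g x * \<phi> x) = cinner f (abs_l2 ?z)"
      using cinner_test_function[OF \<phi>, of f] by (simp add: g_def)
    also have "\<dots> = (LINT x|lebesgue. form_integrand y y' ?z ?z' x)"
      unfolding t[OF sobolev_W12(1)[OF z]] unfolding y(2) by (rule form_t_abs[OF y(1) z])
    also have "\<dots> = (LINT x|lebesgue. w0 x * vderiv \<phi> x + (w1 x * \<phi> x + g x * \<phi> x))"
      by (simp add: form_integrand_def w0_def w1_def algebra_simps)
    also have "\<dots> = (LINT x|lebesgue. w0 x * vderiv \<phi> x) + ((LINT x|lebesgue. w1 x * \<phi> x) + (LINT x|lebesgue. g x * \<phi> x))"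
      using integrable_mult_test_function[OF lw0 test_function_vderiv[OF \<phi>]] integrable_mult_test_function[OF lw1 \<phi>]
        integrable_mult_test_function[OF square_integrable_locally_integrable[OF g(1)] \<phi>] by simp
    finally show "(LINT x|lebesgue. w1 x * \<phi> x) = - (LINT x|lebesgue. w0 x * vderiv \<phi> x)"
      by (simp add: eq_neg_iff_add_eq_0 add.commute)
  qed
  then obtain w where w: "primitive w w1" "AE x in lebesgue. w0 x = w x"
    using distr_deriv_imp_primitive by blast
  have "(\<lambda>x. - w1 x - of_real (\<sigma> x) * y' x + of_real (\<tau> x) * y x) = g"
    by (simp add: w1_def fun_eq_iff)
  moreover have "AE x in lebesgue. w x = y' x - of_real (\<sigma> x) * y x"
    using w(2) by eventually_elim (simp add: w0_def)
  moreover have "y has_distr_deriv y'" "w has_distr_deriv w1"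
    using sobolevD(1)[OF y(1)] w(1) by (auto intro: primitive_imp_distr_deriv)
  ultimately show "(u, f) \<in> op_S \<sigma> \<tau>"
    unfolding op_S_def Let_def using y g w(1) sobolevD[OF y(1)]
    by (intro CollectI case_prodI exI[of _ y] exI[of _ y'] exI[of _ w] exI[of _ w1])
      (simp add: primitive_W11_loc)
qed

text \<open>The derivative of \<open>w * \<zeta>\<close> integrates to 0 by compact support, which
  moves the derivative from \<open>w\<close> to \<zeta>. \<open>Z\<close> is integrable because it
  agrees almost everywhere with the sum of that derivative and the left-hand integrand.\<close>

lemma weak_identity:
  assumes y: "primitive y y'" and w: "primitive w w'"
    and eq: "AE x in lebesgue. w x = y' x - of_real (\<sigma> x) * y x"
    and l: "locally_integrable (\<lambda>x. - w' x - of_real (\<sigma> x) * y' x + of_real (\<tau> x) * y x)"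
    and \<zeta>: "primitive \<zeta> \<zeta>'" and R: "R > 0" and supp: "\<And>x. \<bar>x\<bar> \<ge> R \<Longrightarrow> \<zeta> x = 0 \<and> \<zeta>' x = 0"
  defines "Z \<equiv> \<lambda>x. (y' x - of_real (\<sigma> x) * y x) * \<zeta>' x - of_real (\<sigma> x) * y' x * \<zeta> x + of_real (\<tau> x) * y x * \<zeta> x"
  shows "integrable lebesgue Z"
    and "(LINT x|lebesgue. (- w' x - of_real (\<sigma> x) * y' x + of_real (\<tau> x) * y x) * \<zeta> x) = (LINT x|lebesgue. Z x)"
proof -
  note [measurable] = locally_integrable_measurable[OF primitiveD(1)[OF y]]
    locally_integrable_measurable[OF locally_integrable_continuous[OF primitive_continuous[OF y]]]
    locally_integrable_measurable[OF primitiveD(1)[OF \<zeta>]]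
    locally_integrable_measurable[OF locally_integrable_continuous[OF primitive_continuous[OF \<zeta>]]]
  have s: "\<zeta> x = 0" "\<zeta>' x = 0" if "x \<notin> {- R..R}" for x
  proof -
    have "R \<le> \<bar>x\<bar>" using that by auto
    then show "\<zeta> x = 0" "\<zeta>' x = 0" using supp by auto
  qed
  let ?l = "\<lambda>x. - w' x - of_real (\<sigma> x) * y' x + of_real (\<tau> x) * y x"
  have P: "primitive (\<lambda>x. w x * \<zeta> x) (\<lambda>x. w' x * \<zeta> x + w x * \<zeta>' x)" (is "primitive _ ?d")
    using w \<zeta> by (rule primitive_mult)
  have d: "integrable lebesgue ?d"
    by (rule integrable_bounded_support[OF primitiveD(1)[OF P], of "- R" R]) (simp add: s)
  have d0: "(LINT x|lebesgue. ?d x) = 0"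
    by (rule integral_primitive_eq_0[OF P _ R]) (simp add: supp)
  have i: "integrable lebesgue (\<lambda>x. ?l x * \<zeta> x)"
    by (rule integrable_bounded_support[OF locally_integrable_mult_continuous'[OF l primitive_continuous[OF \<zeta>]], of "- R" R])
      (simp add: s)
  have Z: "AE x in lebesgue. ?l x * \<zeta> x + ?d x = Z x"
    using eq
  proof eventually_elim
    case (elim x)
    show ?case unfolding Z_def elim by (simp add: algebra_simps)
  qed
  have m: "Z \<in> borel_measurable lebesgue" unfolding Z_def by measurable
  have id: "integrable lebesgue (\<lambda>x. ?l x * \<zeta> x + ?d x)"
    using i d by (rule Bochner_Integration.integrable_add)
  show "integrable lebesgue Z" by (rule integrable_cong_AE_imp[OF id m]) (use Z in simp)
  have "(LINT x|lebesgue. Z x) = (LINT x|lebesgue. ?l x * \<zeta> x + ?d x)"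
    using Z id m by (intro integral_cong_AE) auto
  also have "\<dots> = (LINT x|lebesgue. ?l x * \<zeta> x)"
    unfolding Bochner_Integration.integral_add[OF i d] d0 by simp
  finally show "(LINT x|lebesgue. ?l x * \<zeta> x) = (LINT x|lebesgue. Z x)" ..
qed

text \<open>Multiply \<open>y' = w + \<sigma> y\<close> by the cutoff: \<open>w\<close> and
  \<open>y\<close> are continuous, hence bounded on the support, and \<sigma> times the cutoff is in
  L2.\<close>

lemma sobolev_cutoff_mult:
  assumes y: "primitive y y'" and w: "continuous_on UNIV w"
    and eq: "AE x in lebesgue. w x = y' x - of_real (\<sigma> x) * y x" and R: "R > 0"
  shows "sobolev (\<lambda>x. of_real (cutoff R x) * y x)
    (\<lambda>x. of_real (cutoff_deriv R x) * y x + of_real (cutoff R x) * y' x)"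
proof -
  note yc = primitive_continuous[OF y] and ec = primitive_continuous[OF primitive_cutoff[OF R]]
  note [measurable] = locally_integrable_measurable[OF primitiveD(1)[OF y]]
    locally_integrable_measurable[OF locally_integrable_continuous[OF yc]]
    locally_integrable_measurable[OF locally_integrable_continuous[OF ec]]
  have s: "cutoff R x = 0" "cutoff_deriv R x = 0" if "x \<notin> {- R..R}" for x
  proof -
    have "R \<le> \<bar>x\<bar>" using that by auto
    then show "cutoff R x = 0" "cutoff_deriv R x = 0" using cutoff_eq_0[OF R] by auto
  qed
  note bs = square_integrable_continuous_bounded_support[of _ "- R" R]
  have s1: "square_integrable (\<lambda>x. of_real (cutoff R x) * y x)"
    by (rule bs) (auto intro!: continuous_on_mult ec yc simp: s)
  have s2: "square_integrable (\<lambda>x. of_real (cutoff_deriv R x) * y x)"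
    by (rule bs) (auto intro!: continuous_on_mult continuous_cutoff_deriv[OF R] yc simp: s)
  have s3: "square_integrable (\<lambda>x. of_real (cutoff R x) * w x)"
    by (rule bs) (auto intro!: continuous_on_mult ec w simp: s)
  have s4: "square_integrable (\<lambda>x. (of_real (\<sigma> x) * of_real (cutoff R x)) * y x)"
  proof -
    have "compact (y ` {- R..R})"
      by (rule compact_continuous_image) (auto intro: continuous_on_subset[OF yc])
    then obtain B where B: "\<And>x. x \<in> {- R..R} \<Longrightarrow> cmod (y x) \<le> B"
      by (metis compact_imp_bounded bounded_iff imageI)
    have b: "cmod ((of_real (\<sigma> x) * of_real (cutoff R x)) * y x) \<le>
        cmod (of_real B * (of_real (\<sigma> x) * of_real (cutoff R x)))" for x
    proof (cases "x \<in> {- R..R}")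
      case True
      have "cmod (of_real (\<sigma> x) * of_real (cutoff R x)) * cmod (y x) \<le> cmod (of_real (\<sigma> x) * of_real (cutoff R x)) * \<bar>B\<bar>"
        using B[OF True] by (intro mult_left_mono) auto
      then show ?thesis by (simp add: norm_mult mult_ac)
    qed (simp add: s)
    show ?thesis
      by (rule square_integrable_bound[OF square_integrable_cmult[OF square_integrable_sigma[OF sobolev_cutoff[OF R]], of "of_real B"]])
        (measurable, use b in auto)
  qed
  have "square_integrable (\<lambda>x. of_real (cutoff R x) * w x + (of_real (\<sigma> x) * of_real (cutoff R x)) * y x)"
    using s3 s4 by (rule square_integrable_add)
  moreover have "AE x in lebesgue. of_real (cutoff R x) * w x + (of_real (\<sigma> x) * of_real (cutoff R x)) * y x =
      of_real (cutoff R x) * y' x"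
    using eq
  proof eventually_elim
    case (elim x)
    show ?case unfolding elim by (simp add: algebra_simps)
  qed
  ultimately have "square_integrable (\<lambda>x. of_real (cutoff R x) * y' x)"
    by (rule square_integrable_cong_AE)
  with s2 have "square_integrable (\<lambda>x. of_real (cutoff_deriv R x) * y x + of_real (cutoff R x) * y' x)"
    by (rule square_integrable_add)
  with s1 primitive_mult[OF primitive_cutoff[OF R] y] show ?thesis
    by (simp add: sobolev_def)
qed

text \<open>The point is independence of \<open>R\<close>. On the right, \<open>L + Y\<close> bounds
  the pairing with \<zeta>, a second \<open>Y\<close> bounds the term with the derivative of the
  cutoff, at most 1 in modulus for \<open>R \<ge> 4\<close>, and \<open>c * Y\<close> comes from the
  lower bound of the form; the factor 2 clears its 1/2.\<close>

lemma cutoff_energy_bound: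
  assumes y: "primitive y y'" and ys: "square_integrable y" and w: "primitive w w'"
    and eq: "AE x in lebesgue. w x = y' x - of_real (\<sigma> x) * y x"
    and l: "square_integrable l" "l = (\<lambda>x. - w' x - of_real (\<sigma> x) * y' x + of_real (\<tau> x) * y x)"
    and c: "0 \<le> c"
      "\<And>u. u \<in> W12 \<Longrightarrow> 1 / 2 * (norm (l2_deriv u))\<^sup>2 \<le> Re (form_t \<sigma> \<tau> u u) + c * (norm u)\<^sup>2"
    and R: "R \<ge> 4"
  shows "(LINT x|lebesgue. (cmod (of_real (cutoff_deriv R x) * y x + of_real (cutoff R x) * y' x))\<^sup>2) \<le>
    2 * ((LINT x|lebesgue. (cmod (l x))\<^sup>2) + (2 + c) * (LINT x|lebesgue. (cmod (y x))\<^sup>2))"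
proof -
  have R0: "R > 0" using R by simp
  define e d where "e x = complex_of_real (cutoff R x)" and "d x = complex_of_real (cutoff_deriv R x)" for x
  define z z' where "z x = e x * y x" and "z' x = d x * y x + e x * y' x" for x
  have z: "sobolev z z'"
    using sobolev_cutoff_mult[OF y primitive_continuous[OF w] eq R0]
    by (simp add: z_def [abs_def] z'_def [abs_def] e_def d_def)
  have ed: "primitive e d" using primitive_cutoff[OF R0] by (simp add: e_def [abs_def] d_def [abs_def])
  have ei: "cmod (e x) \<le> 1" and di: "cmod (d x) \<le> 1" for x
  proof -
    show "cmod (e x) \<le> 1" using cutoff_bounds[of R x] by (simp add: e_def)
    have "4 / R \<le> 1" using R by simp
    then show "cmod (d x) \<le> 1" using cutoff_deriv_bound[OF R0, of x] by (simp add: d_def)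
  qed
  note [measurable] = square_integrable_measurable[OF ys] square_integrable_measurable[OF l(1)]
    locally_integrable_measurable[OF primitiveD(1)[OF ed]]
    locally_integrable_measurable[OF locally_integrable_continuous[OF primitive_continuous[OF ed]]]
  define Y L where "Y = (LINT x|lebesgue. (cmod (y x))\<^sup>2)" and "L = (LINT x|lebesgue. (cmod (l x))\<^sup>2)"
  have int: "integrable lebesgue (\<lambda>x. (cmod (y x))\<^sup>2)" "integrable lebesgue (\<lambda>x. (cmod (l x))\<^sup>2)"
    using ys l(1) by (auto simp: square_integrable_def)
  \<comment> \<open>The equation is paired with \<open>y\<close> times the squared cutoff: one
    factor \<open>e\<close> goes to each argument of the form at \<open>z = e y\<close>.\<close>
  define \<zeta> \<zeta>' where "\<zeta> x = cnj (y x) * (e x * e x)"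
    and "\<zeta>' x = cnj (y' x) * (e x * e x) + cnj (y x) * (d x * e x + e x * d x)" for x
  have \<zeta>: "primitive \<zeta> \<zeta>'"
    unfolding \<zeta>_def [abs_def] \<zeta>'_def [abs_def]
    by (rule primitive_mult[OF primitive_cnj[OF y] primitive_mult[OF ed ed]])
  have supp: "\<zeta> x = 0 \<and> \<zeta>' x = 0" if "\<bar>x\<bar> \<ge> R" for x
    using cutoff_eq_0[OF R0 that] by (simp add: \<zeta>_def \<zeta>'_def e_def d_def)
  define Z where "Z x = (y' x - of_real (\<sigma> x) * y x) * \<zeta>' x - of_real (\<sigma> x) * y' x * \<zeta> x + of_real (\<tau> x) * y x * \<zeta> x" for x
  have Z: "integrable lebesgue Z" "(LINT x|lebesgue. l x * \<zeta> x) = (LINT x|lebesgue. Z x)"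
    using weak_identity[OF y w eq square_integrable_locally_integrable[OF l(1)[unfolded l(2)]] \<zeta> R0 supp]
    by (simp_all add: Z_def [abs_def] l(2))
  have id: "integrable lebesgue (\<lambda>x. (cmod (d x * y x))\<^sup>2)" and dY: "(LINT x|lebesgue. (cmod (d x * y x))\<^sup>2) \<le> Y"
  proof -
    have le: "(cmod (d x * y x))\<^sup>2 \<le> (cmod (y x))\<^sup>2" for x
      using di[of x] by (intro power_mono) (auto simp: norm_mult intro: mult_left_le_one_le)
    show i: "integrable lebesgue (\<lambda>x. (cmod (d x * y x))\<^sup>2)"
      by (rule Bochner_Integration.integrable_bound[OF int(1)]) (measurable, use le in auto)
    show "(LINT x|lebesgue. (cmod (d x * y x))\<^sup>2) \<le> Y"
      unfolding Y_def by (rule integral_mono[OF i int(1) le])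
  qed
  have zY: "(LINT x|lebesgue. (cmod (z x))\<^sup>2) \<le> Y"
  proof -
    have "(cmod (z x))\<^sup>2 \<le> (cmod (y x))\<^sup>2" for x
      using ei[of x] by (intro power_mono) (auto simp: z_def norm_mult intro: mult_left_le_one_le)
    moreover have "integrable lebesgue (\<lambda>x. (cmod (z x))\<^sup>2)"
      using sobolevD(2)[OF z] by (simp add: square_integrable_def)
    ultimately show ?thesis unfolding Y_def by (intro integral_mono int)
  qed
  \<comment> \<open>The cancellation: \<open>e\<close> and \<open>d\<close> are real, so the term
    with \<open>y x * cnj (y' x) - y' x * cnj (y x)\<close> is purely imaginary, and only the square
    of \<open>d x * y x\<close> remains in the real part.\<close>
  have pw: "Re (form_integrand z z' z z' x) = Re (Z x) + (cmod (d x * y x))\<^sup>2" for x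
  proof -
    have "form_integrand z z' z z' x =
        Z x + (d x * y x) * cnj (d x * y x) + e x * d x * (y x * cnj (y' x) - y' x * cnj (y x))"
      by (simp add: form_integrand_def z_def z'_def Z_def \<zeta>_def \<zeta>'_def e_def d_def algebra_simps)
    moreover have "Re (e x * d x * (y x * cnj (y' x) - y' x * cnj (y x))) = 0"
      by (simp add: e_def d_def)
    ultimately show ?thesis
      by (simp only: complex_norm_square[symmetric] plus_complex.sel Re_complex_of_real)
  qed
  have "Re (form_t \<sigma> \<tau> (abs_l2 z) (abs_l2 z)) = (LINT x|lebesgue. Re (form_integrand z z' z z' x))"
    unfolding form_t_abs[OF z z] using integrable_form_integrand[OF z z] by (rule integral_Re[symmetric])
  also have "\<dots> = Re (LINT x|lebesgue. Z x) + (LINT x|lebesgue. (cmod (d x * y x))\<^sup>2)"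
    unfolding pw using Z(1) id by simp
  finally have t: "Re (form_t \<sigma> \<tau> (abs_l2 z) (abs_l2 z)) \<le> Re (LINT x|lebesgue. l x * \<zeta> x) + Y"
    using dY unfolding Z(2) by simp
  have "cmod (LINT x|lebesgue. l x * \<zeta> x) \<le> (LINT x|lebesgue. (cmod (l x))\<^sup>2 + (cmod (y x))\<^sup>2)"
  proof (rule Bochner_Integration.integral_norm_bound_integral)
    have b: "cmod (l x * \<zeta> x) \<le> (cmod (l x))\<^sup>2 + (cmod (y x))\<^sup>2" for x
    proof -
      have "cmod (e x) * cmod (e x) \<le> 1" using ei[of x] by (simp add: mult_le_one)
      then have "cmod (l x * \<zeta> x) \<le> cmod (l x) * (cmod (y x) * 1)"
        unfolding \<zeta>_def norm_mult complex_mod_cnj by (intro mult_left_mono) auto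
      also have "\<dots> \<le> (cmod (l x))\<^sup>2 + (cmod (y x))\<^sup>2"
        using mult_le_sum_squares[of "cmod (l x)" "cmod (y x)"] by simp
      finally show ?thesis .
    qed
    show i: "integrable lebesgue (\<lambda>x. (cmod (l x))\<^sup>2 + (cmod (y x))\<^sup>2)" using int by simp
    show "integrable lebesgue (\<lambda>x. l x * \<zeta> x)"
      by (rule Bochner_Integration.integrable_bound[OF i])
        (unfold \<zeta>_def, measurable, use b in \<open>auto simp: \<zeta>_def\<close>)
    show "norm (l x * \<zeta> x) \<le> (cmod (l x))\<^sup>2 + (cmod (y x))\<^sup>2" for x by (rule b)
  qed
  also have "\<dots> = L + Y" using int by (simp add: L_def Y_def)
  finally have X: "Re (LINT x|lebesgue. l x * \<zeta> x) \<le> L + Y"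
    using complex_Re_le_cmod order_trans by blast
  have "1 / 2 * (LINT x|lebesgue. (cmod (z' x))\<^sup>2) \<le>
      Re (form_t \<sigma> \<tau> (abs_l2 z) (abs_l2 z)) + c * (LINT x|lebesgue. (cmod (z x))\<^sup>2)"
    using c(2)[OF sobolev_W12(1)[OF z]] sobolevD(2,3)[OF z]
    unfolding sobolev_W12(2)[OF z] by (simp only: norm_abs_l2)
  also have "\<dots> \<le> ((L + Y) + Y) + c * Y"
    by (intro add_mono mult_left_mono zY c(1) order_trans[OF t] X order_refl)
  finally have "(LINT x|lebesgue. (cmod (z' x))\<^sup>2) \<le> 2 * (L + (2 + c) * Y)"
    by (simp add: algebra_simps)
  then show ?thesis by (simp add: z'_def e_def d_def L_def Y_def)
qed

text \<open>The bound on the cut off derivatives is the same for all radii from 4 on and the cutoffs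
  tend to 1, so Fatou's lemma puts \<open>y'\<close> into L2.\<close>

lemma operator_domain_sobolev:
  assumes y: "primitive y y'" and ys: "square_integrable y" and w: "primitive w w'"
    and eq: "AE x in lebesgue. w x = y' x - of_real (\<sigma> x) * y x"
    and l: "square_integrable (\<lambda>x. - w' x - of_real (\<sigma> x) * y' x + of_real (\<tau> x) * y x)"
  shows "sobolev y y'"
proof -
  note [measurable] = locally_integrable_measurable[OF primitiveD(1)[OF y]] square_integrable_measurable[OF ys]
  have cm [measurable]: "(\<lambda>x. complex_of_real (cutoff R x)) \<in> borel_measurable lebesgue" if "R > 0" for R
    using locally_integrable_measurable[OF locally_integrable_continuous[OF primitive_continuous[OF primitive_cutoff[OF that]]]] .
  obtain c where c: "0 \<le> c"
    "\<And>u. u \<in> W12 \<Longrightarrow> 1 / 2 * (norm (l2_deriv u))\<^sup>2 \<le> Re (form_t \<sigma> \<tau> u u) + c * (norm u)\<^sup>2"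
    using form_t_lower_bound by blast
  define l where "l x = - w' x - of_real (\<sigma> x) * y' x + of_real (\<tau> x) * y x" for x
  define Y where "Y = (LINT x|lebesgue. (cmod (y x))\<^sup>2)"
  \<comment> \<open>From \<open>\<eta> y' = (\<eta> y)' - \<eta>' y\<close> with \<eta>' at most 1
    in modulus: twice the energy bound plus twice \<open>Y\<close>.\<close>
  define K where "K = 2 * (2 * ((LINT x|lebesgue. (cmod (l x))\<^sup>2) + (2 + c) * Y)) + 2 * Y"
  have int: "integrable lebesgue (\<lambda>x. (cmod (y x))\<^sup>2)"
    using ys by (simp add: square_integrable_def)
  have bound: "(\<integral>\<^sup>+x. ennreal ((cmod (of_real (cutoff R x) * y' x))\<^sup>2) \<partial>lebesgue) \<le> ennreal K" if R: "R \<ge> 4" for R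
  proof -
    have R0: "R > 0" using R by simp
    note [measurable] = cm[OF R0]
    define z' where "z' x = of_real (cutoff_deriv R x) * y x + of_real (cutoff R x) * y' x" for x
    have z': "integrable lebesgue (\<lambda>x. (cmod (z' x))\<^sup>2)"
      using sobolevD(3)[OF sobolev_cutoff_mult[OF y primitive_continuous[OF w] eq R0]]
      by (simp add: square_integrable_def z'_def [abs_def])
    have "4 / R \<le> 1" using R by simp
    then have d: "\<bar>cutoff_deriv R x\<bar> \<le> 1" for x using cutoff_deriv_bound[OF R0, of x] by simp
    have le: "(cmod (of_real (cutoff R x) * y' x))\<^sup>2 \<le> 2 * (cmod (z' x))\<^sup>2 + 2 * (cmod (y x))\<^sup>2" for x
    proof -
      have "of_real (cutoff R x) * y' x = z' x - of_real (cutoff_deriv R x) * y x" by (simp add: z'_def)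
      then have "cmod (of_real (cutoff R x) * y' x) \<le> cmod (z' x) + cmod (of_real (cutoff_deriv R x) * y x)"
        by (simp only: norm_triangle_ineq4)
      also have "\<dots> \<le> cmod (z' x) + cmod (y x)"
        using d[of x] by (simp add: norm_mult mult_left_le_one_le)
      finally have "(cmod (of_real (cutoff R x) * y' x))\<^sup>2 \<le> (cmod (z' x) + cmod (y x))\<^sup>2"
        by (intro power_mono) auto
      also have "\<dots> \<le> 2 * (cmod (z' x))\<^sup>2 + 2 * (cmod (y x))\<^sup>2"
        using sum_squares_bound[of "cmod (z' x)" "cmod (y x)"] by (simp add: power2_sum)
      finally show ?thesis .
    qed
    have "(\<integral>\<^sup>+x. ennreal ((cmod (of_real (cutoff R x) * y' x))\<^sup>2) \<partial>lebesgue) \<le>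
        (\<integral>\<^sup>+x. ennreal (2 * (cmod (z' x))\<^sup>2 + 2 * (cmod (y x))\<^sup>2) \<partial>lebesgue)"
      by (intro nn_integral_mono ennreal_leI le)
    also have "\<dots> = ennreal (LINT x|lebesgue. 2 * (cmod (z' x))\<^sup>2 + 2 * (cmod (y x))\<^sup>2)"
      using z' int by (intro nn_integral_eq_integral) auto
    also have "\<dots> \<le> ennreal K"
    proof (rule ennreal_leI)
      have "(LINT x|lebesgue. 2 * (cmod (z' x))\<^sup>2 + 2 * (cmod (y x))\<^sup>2) = 2 * (LINT x|lebesgue. (cmod (z' x))\<^sup>2) + 2 * Y"
        using z' int by (simp add: Y_def)
      also have "\<dots> \<le> K"
        unfolding K_def z'_def Y_def
        by (intro add_right_mono mult_left_mono cutoff_energy_bound[OF y ys w eq _ _ c R])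
          (use l in \<open>auto simp: l_def [abs_def]\<close>)
      finally show "(LINT x|lebesgue. 2 * (cmod (z' x))\<^sup>2 + 2 * (cmod (y x))\<^sup>2) \<le> K" .
    qed
    finally show ?thesis .
  qed
  have "(\<integral>\<^sup>+x. ennreal ((cmod (y' x))\<^sup>2) \<partial>lebesgue) =
      (\<integral>\<^sup>+x. liminf (\<lambda>n. ennreal ((cmod (of_real (cutoff (real n + 4) x) * y' x))\<^sup>2)) \<partial>lebesgue)"
  proof (rule nn_integral_cong)
    fix x
    have "(\<lambda>n. ennreal ((cmod (of_real (cutoff (real n + 4) x) * y' x))\<^sup>2)) \<longlonglongrightarrow> ennreal ((cmod (of_real 1 * y' x))\<^sup>2)"
      by (intro tendsto_intros cutoff_tendsto)
    then show "ennreal ((cmod (y' x))\<^sup>2) = liminf (\<lambda>n. ennreal ((cmod (of_real (cutoff (real n + 4) x) * y' x))\<^sup>2))"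
      by (intro lim_imp_Liminf[symmetric]) auto
  qed
  also have "\<dots> \<le> liminf (\<lambda>n. \<integral>\<^sup>+x. ennreal ((cmod (of_real (cutoff (real n + 4) x) * y' x))\<^sup>2) \<partial>lebesgue)"
  proof (rule nn_integral_liminf)
    fix n :: nat
    have [measurable]: "(\<lambda>x. of_real (cutoff (real n + 4) x) * y' x) \<in> borel_measurable lebesgue"
      by (intro borel_measurable_times cm locally_integrable_measurable[OF primitiveD(1)[OF y]]) simp
    show "(\<lambda>x. ennreal ((cmod (of_real (cutoff (real n + 4) x) * y' x))\<^sup>2)) \<in> borel_measurable lebesgue"
      by measurable
  qed
  also have "\<dots> \<le> liminf (\<lambda>n::nat. ennreal K)"
    by (intro Liminf_mono always_eventually allI bound) simp
  also have "\<dots> < \<infinity>" by (simp add: Liminf_const)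
  finally have "integrable lebesgue (\<lambda>x. (cmod (y' x))\<^sup>2)"
    by (intro integrableI_bounded) auto
  then have "square_integrable y'" by (simp add: square_integrable_def)
  with y ys show ?thesis by (simp add: sobolev_def)
qed

text \<open>Once \<open>y'\<close> is known to be square integrable, the identity for the multiplier
  cutoff times \<open>cnj z\<close> passes to the limit by dominated convergence, for every
  \<open>z\<close> in the form domain.\<close>

lemma op_S_subset_form_operator: "op_S \<sigma> \<tau> \<subseteq> form_operator"
proof (rule subrelI)
  fix u f assume "(u, f) \<in> op_S \<sigma> \<tau>"
  then obtain y y' w w' where yw: "y \<in> W11_loc" "square_integrable y" "u = abs_l2 y" "y has_distr_deriv y'"
      "w \<in> W11_loc" "AE x in lebesgue. w x = y' x - of_real (\<sigma> x) * y x" "w has_distr_deriv w'"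
    and l: "square_integrable (\<lambda>x. - w' x - of_real (\<sigma> x) * y' x + of_real (\<tau> x) * y x)"
    and f: "f = abs_l2 (\<lambda>x. - w' x - of_real (\<sigma> x) * y' x + of_real (\<tau> x) * y x)"
    unfolding op_S_def Let_def by blast
  \<comment> \<open>Continuity makes \<open>y\<close> and \<open>w\<close> themselves primitives,
    not just equal to primitives almost everywhere.\<close>
  have y: "primitive y y'" and w: "primitive w w'"
    using yw by (auto intro: continuous_distr_deriv_imp_primitive W11_loc_continuous)
  have sy: "sobolev y y'" by (rule operator_domain_sobolev[OF y yw(2) w yw(6) l])
  define l' where "l' x = - w' x - of_real (\<sigma> x) * y' x + of_real (\<tau> x) * y x" for x
  have l': "square_integrable l'" "f = abs_l2 l'" using l f by (simp_all add: l'_def [abs_def])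
  have "cinner f v = form_t \<sigma> \<tau> u v" if v: "v \<in> W12" for v
  proof -
    obtain z z' where z: "sobolev z z'" "v = abs_l2 z" "l2_deriv v = abs_l2 z'" using W12E[OF v] .
    note [measurable] = sobolevD(4,5)[OF sy] sobolevD(4,5)[OF z(1)] square_integrable_measurable[OF l'(1)]
    define e d where "e n x = complex_of_real (cutoff (real n + 4) x)"
      and "d n x = complex_of_real (cutoff_deriv (real n + 4) x)" for n :: nat and x
    have ed: "primitive (e n) (d n)" for n
      using primitive_cutoff[of "real n + 4"] by (simp add: e_def [abs_def] d_def [abs_def])
    have [measurable]: "e n \<in> borel_measurable lebesgue" "d n \<in> borel_measurable lebesgue" for n
      using locally_integrable_measurable[OF primitiveD(1)[OF ed]]
        locally_integrable_measurable[OF locally_integrable_continuous[OF primitive_continuous[OF ed]]] by auto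
    have elim: "(\<lambda>n. e n x) \<longlonglongrightarrow> 1" and dlim: "(\<lambda>n. d n x) \<longlonglongrightarrow> 0" for x
      using tendsto_of_real[OF cutoff_tendsto[of x], where 'a=complex]
        tendsto_of_real[OF cutoff_deriv_tendsto[of x], where 'a=complex]
      by (simp_all add: e_def d_def)
    have e1: "cmod (e n x) \<le> 1" for n x
      using cutoff_bounds[of "real n + 4" x] by (simp add: e_def)
    have d1: "cmod (d n x) \<le> 1" for n x
    proof -
      have "\<bar>cutoff_deriv (real n + 4) x\<bar> \<le> 4 / (real n + 4)" by (rule cutoff_deriv_bound) simp
      also have "\<dots> \<le> 1" by simp
      finally show ?thesis by (simp add: d_def)
    qed
    define \<zeta> \<zeta>' where "\<zeta> n x = e n x * cnj (z x)"
      and "\<zeta>' n x = d n x * cnj (z x) + e n x * cnj (z' x)" for n x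
    have \<zeta>: "primitive (\<zeta> n) (\<zeta>' n)" for n
      unfolding \<zeta>_def [abs_def] \<zeta>'_def [abs_def]
      by (rule primitive_mult[OF ed primitive_cnj[OF sobolevD(1)[OF z(1)]]])
    have supp: "\<zeta> n x = 0 \<and> \<zeta>' n x = 0" if "\<bar>x\<bar> \<ge> real n + 4" for n x
      using cutoff_eq_0[OF _ that] by (simp add: \<zeta>_def \<zeta>'_def e_def d_def)
    \<comment> \<open>The factor that the derivative of the cutoff multiplies. It is integrable
      because \<open>y'\<close> is square integrable, so this boundary contribution tends to
      0.\<close>
    define q where "q x = (y' x - of_real (\<sigma> x) * y x) * cnj (z x)" for x
    have q: "integrable lebesgue q"
      unfolding q_def [abs_def]
      by (intro square_integrable_mult square_integrable_diff square_integrable_sigma[OF sy] sobolevD(2,3)[OF sy] sobolevD(2)[OF z(1)])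
    have fi: "integrable lebesgue (form_integrand y y' z z')"
      using sy z(1) by (rule integrable_form_integrand)
    have identity: "(LINT x|lebesgue. l' x * (e n x * cnj (z x))) =
        (LINT x|lebesgue. e n x * form_integrand y y' z z' x + d n x * q x)" for n
    proof -
      have "(LINT x|lebesgue. l' x * \<zeta> n x) = (LINT x|lebesgue. (y' x - of_real (\<sigma> x) * y x) * \<zeta>' n x
          - of_real (\<sigma> x) * y' x * \<zeta> n x + of_real (\<tau> x) * y x * \<zeta> n x)"
        using weak_identity(2)[OF y w yw(6) square_integrable_locally_integrable[OF l] \<zeta>, of "real n + 4" n] supp[of n]
        by (simp add: l'_def)
      also have "\<dots> = (LINT x|lebesgue. e n x * form_integrand y y' z z' x + d n x * q x)"
        by (simp add: \<zeta>_def \<zeta>'_def q_def form_integrand_def algebra_simps)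
      finally show ?thesis by (simp add: \<zeta>_def)
    qed
    have "(\<lambda>n. LINT x|lebesgue. l' x * (e n x * cnj (z x))) \<longlonglongrightarrow> (LINT x|lebesgue. l' x * (1 * cnj (z x)))"
    proof (rule integral_dominated_convergence[where w="\<lambda>x. cmod (l' x * cnj (z x))"])
      show "integrable lebesgue (\<lambda>x. cmod (l' x * cnj (z x)))"
        by (intro integrable_norm square_integrable_mult l' sobolevD(2)[OF z(1)])
      show "AE x in lebesgue. (\<lambda>n. l' x * (e n x * cnj (z x))) \<longlonglongrightarrow> l' x * (1 * cnj (z x))"
        by (intro AE_I2 tendsto_intros elim)
      show "AE x in lebesgue. norm (l' x * (e n x * cnj (z x))) \<le> cmod (l' x * cnj (z x))" for n
        using e1 by (intro AE_I2) (simp add: norm_mult mult_left_le_one_le mult_left_mono)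
    qed measurable
    moreover have "(\<lambda>n. LINT x|lebesgue. e n x * form_integrand y y' z z' x + d n x * q x) \<longlonglongrightarrow>
        (LINT x|lebesgue. 1 * form_integrand y y' z z' x + 0 * q x)"
    proof (rule integral_dominated_convergence[where w="\<lambda>x. cmod (form_integrand y y' z z' x) + cmod (q x)"])
      show "integrable lebesgue (\<lambda>x. cmod (form_integrand y y' z z' x) + cmod (q x))"
        using fi q by (intro Bochner_Integration.integrable_add integrable_norm)
      show "AE x in lebesgue. (\<lambda>n. e n x * form_integrand y y' z z' x + d n x * q x) \<longlonglongrightarrow>
          1 * form_integrand y y' z z' x + 0 * q x"
        by (intro AE_I2 tendsto_intros elim dlim)
      show "AE x in lebesgue. norm (e n x * form_integrand y y' z z' x + d n x * q x) \<le>
          cmod (form_integrand y y' z z' x) + cmod (q x)" for n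
      proof (intro AE_I2 order_trans[OF norm_triangle_ineq] add_mono)
        fix x
        show "norm (e n x * form_integrand y y' z z' x) \<le> cmod (form_integrand y y' z z' x)"
          "norm (d n x * q x) \<le> cmod (q x)"
          using e1[of n x] d1[of n x] by (simp_all add: norm_mult mult_left_le_one_le)
      qed
    qed (use borel_measurable_integrable[OF fi] borel_measurable_integrable[OF q] in measurable)
    ultimately have "(LINT x|lebesgue. l' x * (1 * cnj (z x))) = (LINT x|lebesgue. 1 * form_integrand y y' z z' x + 0 * q x)"
      unfolding identity by (rule LIMSEQ_unique)
    then have "pairing l' z = (LINT x|lebesgue. form_integrand y y' z z' x)"
      by (simp add: pairing_def)
    then show ?thesis
      unfolding l'(2) yw(3) z(2) form_t_abs[OF sy z(1)] using cinner_abs[OF l'(1) sobolevD(2)[OF z(1)]] by simp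
  qed
  then show "(u, f) \<in> form_operator"
    using sobolev_W12(1)[OF sy] yw(3) by (simp add: form_operator_def)
qed

lemma op_S_eq_form_operator: "op_S \<sigma> \<tau> = form_operator"
  using op_S_subset_form_operator form_operator_subset_op_S by (rule subset_antisym)

end

text \<open>The equivalence for all \<open>T\<close> contains the existence as well as the
  uniqueness of the associated operator.\<close>

theorem theorem3p4:
  fixes \<sigma> \<tau> :: "real \<Rightarrow> real"
  assumes "\<sigma> \<in> L2_unif" and "\<tau> \<in> L1_unif"
  shows "closed_form W12 (form_t \<sigma> \<tau>) \<and> form_bounded_below W12 (form_t \<sigma> \<tau>) \<and>
    (\<forall>T. associated_operator W12 (form_t \<sigma> \<tau>) T \<longleftrightarrow> T = op_S \<sigma> \<tau>) \<and>
    selfadjoint (op_S \<sigma> \<tau>) \<and> operator_bounded_below (op_S \<sigma> \<tau>) \<and>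
    Domain (op_S \<sigma> \<tau>) \<subseteq> W12"
proof -
  interpret singular_potential \<sigma> \<tau> by standard (fact assms)+
  have "Domain form_operator \<subseteq> W12" by (auto simp: form_operator_def)
  then show ?thesis
    unfolding op_S_eq_form_operator
    using form_t_closed form_t_bounded_below associated_operator_iff selfadjoint_form_operator
      form_operator_bounded_below by blast
qed

end
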